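(* Consider the closed-loop system $\dot{\mathbf{x}}=\mathbf{P}(\mathbf{x})\mathbf{u}(\mathbf{x})$ on $\mathbb{S}^n$, $n\ge 2$, with star-shaped constraint sets $\mathcal{U}_1,\dots,\mathcal{U}_m$, free space $\mathcal{M}_0=\mathbb{S}^n\setminus\mathcal{U}^{\circ}$, target $\mathbf{x}_d\in\mathcal{M}_0^{\circ}$ and the feedback law $\mathbf{u}$ (with parameters $k_1>0$, $\kappa>0$, $\epsilon$, $\mathbf{g}_i$) described in the context. Assume the following two conditions. (A1) There is $\delta\in(0,\frac{\pi}{2}]$ such that $\max_{\mathbf{a}\in\mathcal{U}_i,\,\mathbf{b}\in\mathcal{U}_j}\mathbf{a}^\top\mathbf{b}\le\cos(2\delta)$ for all $i,j\in\mathbb{I}$, $i\ne j$ (this is the $\delta$ used in the choice of $\epsilon$). (A2) $\mathcal{R}_i\cap\mathcal{R}_j=\emptyset$ for all $i,j\in\mathbb{I}$ with $i\neq j$, where the sets $\mathcal{R}_i$ are defined in the context. Then: 1. The set $\mathcal{M}_0$ is forward invariant, i.e., if $\mathbf{x}(0)\in\mathcal{M}_0$ then $\mathbf{x}(t)\in\mathcal{M}_0$ for all $t\ge 0$. 2. There exists $\bar{\kappa}>0$ such that if $\kappa>\bar{\kappa}$, then the desired equilibrium point $\mathbf{x}_d$ is almost globally asymptotically stable over $\mathcal{M}_0$, i.e., $\mathbf{x}_d$ is stable and is attractive from all initial conditions in $\mathcal{M}_0$ except a set of zero Lebesgue measure (on $\mathbb{S}^n$).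
   Context: **Sphere.** $\mathbb{S}^n=\{\mathbf{x}\in\mathbb{R}^{n+1}:\|\mathbf{x}\|=1\}$, $n\ge2$; $\mathbf{P}(\mathbf{x})=\mathbf{I}_{n+1}-\mathbf{x}\mathbf{x}^\top$. For $\mathcal{A}\subset\mathbb{S}^n$, the closure, the interior $\mathcal{A}^\circ$ and the boundary $\partial\mathcal{A}$ are taken in $\mathbb{S}^n$. **Separation.** For $\mathbf{x},\mathbf{a}\in\mathbb{S}^n$, $d_s(\mathbf{x},\mathbf{a})=1-\mathbf{x}^\top\mathbf{a}$, and $d_s(\mathbf{x},\mathcal{A})=\inf_{\mathbf{a}\in\mathcal{A}}(1-\mathbf{x}^\top\mathbf{a})$. For $p>0$, $\mathcal{D}_p(\mathcal{A})=\{\mathbf{x}\in\mathbb{S}^n: d_s(\mathbf{x},\mathcal{A})\le p\}$ and $\mathcal{N}_p(\mathcal{A})=\mathcal{D}_p(\mathcal{A})\setminus\mathcal{A}^\circ$. **Geodesics.** For $\mathbf{a},\mathbf{b}\in\mathbb{S}^n$ with $\mathbf{a}\neq\pm\mathbf{b}$, $\mathcal{G}(\mathbf{a},\mathbf{b})=\left\{\frac{\sin((1-\lambda)\theta)\mathbf{a}+\sin(\lambda\theta)\mathbf{b}}{\sin\theta}:\lambda\in[0,1]\right\}$, $\theta=\arccos(\mathbf{a}^\top\mathbf{b})$ (the minimal great-circle arc); $\mathcal{G}(\mathbf{a},\mathbf{a})=\{\mathbf{a}\}$. **Star-shaped sets.** $\mathcal{A}\subset\mathbb{S}^n$ is star-shaped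 on $\mathbb{S}^n$ if there is $\mathbf{g}\in\mathcal{A}$ with $-\mathbf{g}\notin\mathcal{A}$ and $\mathcal{G}(\mathbf{g},\mathbf{x})\subset\mathcal{A}$ for all $\mathbf{x}\in\mathcal{A}$. The set of all such $\mathbf{g}$ is denoted $\sigma(\mathcal{A})$. **Setting.** $\mathbb{I}=\{1,\dots,m\}$, $m\in\mathbb{N}$; each $\mathcal{U}_i\subset\mathbb{S}^n$ ($i\in\mathbb{I}$) is closed and star-shaped on $\mathbb{S}^n$; $\mathcal{U}=\bigcup_{i\in\mathbb{I}}\mathcal{U}_i$. For $p\ge0$, $\mathcal{M}_p=\{\mathbf{x}\in\mathbb{S}^n\setminus\mathcal{U}^\circ: d_s(\mathbf{x},\mathcal{U})\ge p\}$. The target satisfies $\mathbf{x}_d\in\mathcal{M}_0^\circ$. **Control law.** Fix $\bar\epsilon>0$ with $\mathbf{x}_d\notin\mathcal{N}_{\bar\epsilon}(\mathcal{U})$, and $\epsilon\in(0,\min\{\bar\epsilon,1-\cos\delta\})$. For each $i\in\mathbb{I}$ fix $\mathbf{g}_i\in\sigma(\mathcal{U}_i)\cap\mathcal{U}_i^\circ$ with $\mathbf{g}_i\ne-\mathbf{x}_d$. With $k_1>0$ and $\kappa>0$, for $\mathbf{x}\in\mathcal{M}_0$, $$\mathbf{u}(\mathbf{x})=\begin{cases}k_1\mathbf{u}_i(\mathbf{x}),&\mathbf{x}\in\mathcal{N}_\epsilon(\mathcal{U}_i),\\ k_1\mathbf{x}_d,&\mathbf{x}\notin\mathcal{N}_\epsilon(\mathcal{U}),\end{cases}\qquad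 \mathbf{u}_i(\mathbf{x})=\frac{d_s(\mathbf{x},\mathcal{U}_i)}{\epsilon}\mathbf{x}_d-\frac1\kappa\left(1-\frac{d_s(\mathbf{x},\mathcal{U}_i)}{\epsilon}\right)\mathbf{g}_i .$$ (Under (A1) and the choice of $\epsilon$ the sets $\mathcal{D}_\epsilon(\mathcal{U}_i)$ are pairwise disjoint, so $\mathbf{u}$ is single-valued.) **Sets $\mathcal{R}_i$.** $\mathbb{I}_a=\{i\in\mathbb{I}:-\mathbf{x}_d\notin\mathcal{D}_\epsilon(\mathcal{U}_i)\}$. For $\mathbf{y}\in\{\mathbf{x}_d,-\mathbf{x}_d\}$, $\mathcal{S}_i(\mathbf{y})=\bigcup_{\mathbf{x}\in\mathcal{D}_\epsilon(\mathcal{U}_i)}\mathcal{G}(\mathbf{x},\mathbf{y})$. For $i\in\mathbb{I}_a$, $$\mathcal{R}_i=\{\mathbf{x}\in\mathcal{S}_i(\mathbf{x}_d)\setminus\mathcal{U}_i^\circ: d_s(\mathbf{x},\mathbf{x}_d)\ge d_s(\mathbf{x}_d,\mathcal{D}_\epsilon(\mathcal{U}_i))\},$$ and for $i\in\mathbb{I}\setminus\mathbb{I}_a$, $\mathcal{R}_i=\mathcal{S}_i(-\mathbf{x}_d)\setminus\mathcal{U}_i^\circ$. *)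

theory Defs
  imports "HOL-Analysis.Analysis"
begin

text \<open>
  The ambient space \<open>'a\<close> plays the role of \<open>R^(n+1)\<close>, so that \<open>n \<ge> 2\<close> becomes \<open>DIM('a) \<ge> 3\<close>.
\<close>

abbreviation unit_sphere :: "'a::euclidean_space set" where
  "unit_sphere \<equiv> sphere 0 1"

definition sphere_interior :: "'a::euclidean_space set \<Rightarrow> 'a set" where
  "sphere_interior A = top_of_set unit_sphere interior_of A"

text \<open>\<open>tangent_proj x\<close> is the linear map with matrix \<open>I - x x\<^sup>T\<close>.\<close>

definition tangent_proj :: "'a::euclidean_space \<Rightarrow> 'a \<Rightarrow> 'a" where
  "tangent_proj x v = v - (x \<bullet> v) *\<^sub>R x"


subsection \<open>Separation\<close>

definition sep :: "'a::euclidean_space \<Rightarrow> 'a \<Rightarrow> real" where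
  "sep x a = 1 - x \<bullet> a"

definition set_sep :: "'a::euclidean_space \<Rightarrow> 'a set \<Rightarrow> real" where
  "set_sep x A = (INF a\<in>A. sep x a)"

definition dilation :: "real \<Rightarrow> 'a::euclidean_space set \<Rightarrow> 'a set" where
  "dilation p A = {x \<in> unit_sphere. set_sep x A \<le> p}"

definition collar :: "real \<Rightarrow> 'a::euclidean_space set \<Rightarrow> 'a set" where
  "collar p A = dilation p A - sphere_interior A"

definition free_set :: "real \<Rightarrow> 'a::euclidean_space set \<Rightarrow> 'a set" where
  "free_set p A = {x \<in> unit_sphere - sphere_interior A. set_sep x A \<ge> p}"


subsection \<open>Geodesics and star-shaped sets\<close>

text \<open>
  The value for antipodal arguments is meaningless (division by \<open>sin pi = 0\<close>).  It is never used:
  star centres \<open>g\<close> satisfy \<open>- g \<notin> A\<close>, and the target and its antipode are joined below only to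
  points of dilations that do not contain the opposite point.
\<close>

definition geodesic :: "'a::euclidean_space \<Rightarrow> 'a \<Rightarrow> 'a set" where
  "geodesic a b =
     (if a = b then {a}
      else (let \<theta> = arccos (a \<bullet> b) in
        (\<lambda>l. (1 / sin \<theta>) *\<^sub>R (sin ((1 - l) * \<theta>) *\<^sub>R a + sin (l * \<theta>) *\<^sub>R b)) ` {0..1}))"

definition star_centers :: "'a::euclidean_space set \<Rightarrow> 'a set" where
  "star_centers A = {g \<in> A. - g \<notin> A \<and> (\<forall>x\<in>A. geodesic g x \<subseteq> A)}"

definition star_shaped :: "'a::euclidean_space set \<Rightarrow> bool" where
  "star_shaped A \<longleftrightarrow> A \<subseteq> unit_sphere \<and> star_centers A \<noteq> {}"


subsection \<open>The feedback law\<close>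

definition local_control ::
    "'a::euclidean_space \<Rightarrow> real \<Rightarrow> real \<Rightarrow> 'a set \<Rightarrow> 'a \<Rightarrow> 'a \<Rightarrow> 'a" where
  "local_control xd \<kappa> \<epsilon> A g x =
     (set_sep x A / \<epsilon>) *\<^sub>R xd - ((1 / \<kappa>) * (1 - set_sep x A / \<epsilon>)) *\<^sub>R g"

text \<open>
  The index selected by \<open>THE\<close> is unique because the dilations of the sets \<open>U i\<close> are disjoint in the
  intended setting.  On the free space the second branch is exactly the complement of
  \<open>collar \<epsilon> (\<Union>i\<in>{1..m}. U i)\<close>, see \<open>collar_Union_iff\<close> below.
\<close>

definition control ::
    "nat \<Rightarrow> (nat \<Rightarrow> 'a::euclidean_space set) \<Rightarrow> 'a \<Rightarrow> (nat \<Rightarrow> 'a) \<Rightarrow> real \<Rightarrow> real \<Rightarrow> real \<Rightarrow> 'a \<Rightarrow> 'a"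
  where
  "control m U xd g k1 \<kappa> \<epsilon> x =
     (if \<exists>i\<in>{1..m}. x \<in> collar \<epsilon> (U i)
      then (let i = (THE i. i \<in> {1..m} \<and> x \<in> collar \<epsilon> (U i))
            in k1 *\<^sub>R local_control xd \<kappa> \<epsilon> (U i) (g i) x)
      else k1 *\<^sub>R xd)"


subsection \<open>The sets required to be disjoint\<close>

definition shadow :: "real \<Rightarrow> 'a::euclidean_space set \<Rightarrow> 'a \<Rightarrow> 'a set" where
  "shadow \<epsilon> A y = (\<Union>x\<in>dilation \<epsilon> A. geodesic x y)"

definition region :: "'a::euclidean_space \<Rightarrow> real \<Rightarrow> 'a set \<Rightarrow> 'a set" where
  "region xd \<epsilon> A =
     (if - xd \<notin> dilation \<epsilon> A
      then {x \<in> shadow \<epsilon> A xd - sphere_interior A. sep x xd \<ge> set_sep xd (dilation \<epsilon> A)}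
      else shadow \<epsilon> A (- xd) - sphere_interior A)"


subsection \<open>Surface measure\<close>

text \<open>
  The surface measure of a Borel set \<open>A\<close> of the unit sphere is \<open>DIM('a)\<close> times the volume of the
  cone \<open>{r a | 0 < r \<le> 1, a \<in> A}\<close>.
\<close>

definition sphere_measure :: "'a::euclidean_space measure" where
  "sphere_measure =
     scale_measure (of_nat DIM('a))
       (distr (restrict_space lborel (cball 0 1 - {0})) (restrict_space borel unit_sphere)
          (\<lambda>x. x /\<^sub>R norm x))"

lemma space_sphere_measure [simp]: "space sphere_measure = unit_sphere"
  by (simp add: sphere_measure_def space_scale_measure space_restrict_space)

lemma sets_sphere_measure [simp]:
  "sets sphere_measure = sets (restrict_space borel unit_sphere)"
  by (simp add: sphere_measure_def)

lemma measurable_radial_projection: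
  "(\<lambda>x::'a::euclidean_space. x /\<^sub>R norm x)
     \<in> restrict_space lborel (cball 0 1 - {0}) \<rightarrow>\<^sub>M restrict_space borel unit_sphere"
  by (rule measurable_restrict_space3) (auto simp: Pi_iff)

lemma emeasure_sphere_measure:
  fixes A :: "'a::euclidean_space set"
  assumes "A \<in> sets borel" "A \<subseteq> unit_sphere"
  shows "emeasure sphere_measure A =
    of_nat DIM('a) * emeasure lborel {x \<in> cball 0 1 - {0}. x /\<^sub>R norm x \<in> A}"
proof -
  have A: "A \<in> sets (restrict_space borel unit_sphere)"
    using assms by (simp add: sets_restrict_space_iff)
  have eq: "(\<lambda>x::'a. x /\<^sub>R norm x) -` A \<inter> space (restrict_space lborel (cball 0 1 - {0})) =
      {x \<in> cball 0 1 - {0}. x /\<^sub>R norm x \<in> A}"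
    by (auto simp: space_restrict_space)
  have "emeasure sphere_measure A = of_nat DIM('a) *
      emeasure (restrict_space lborel (cball 0 1 - {0})) {x \<in> cball 0 1 - {0}. x /\<^sub>R norm x \<in> A}"
    unfolding sphere_measure_def emeasure_scale_measure
      emeasure_distr[OF measurable_radial_projection A] eq ..
  also have "emeasure (restrict_space lborel (cball 0 1 - {0})) {x \<in> cball 0 1 - {0}. x /\<^sub>R norm x \<in> A}
      = emeasure lborel {x::'a \<in> cball 0 1 - {0}. x /\<^sub>R norm x \<in> A}"
    by (rule emeasure_restrict_space) auto
  finally show ?thesis .
qed


subsection \<open>Closed-loop dynamics\<close>

definition closed_loop_solution ::
    "('a::euclidean_space \<Rightarrow> 'a) \<Rightarrow> real set \<Rightarrow> (real \<Rightarrow> 'a) \<Rightarrow> bool" where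
  "closed_loop_solution u J x \<longleftrightarrow>
     (\<forall>t\<in>J. x t \<in> unit_sphere \<and>
        (x has_vector_derivative tangent_proj (x t) (u (x t))) (at t within J))"

text \<open>
  Solutions are curves in the whole sphere.  The first conjunct says that the closed-loop system has
  a solution for all nonnegative times from every initial state in \<open>M\<close>; the second, that no solution
  starting in \<open>M\<close>, not even one existing for a bounded time only, can leave \<open>M\<close>.
\<close>

definition forward_invariant :: "('a::euclidean_space \<Rightarrow> 'a) \<Rightarrow> 'a set \<Rightarrow> bool" where
  "forward_invariant u M \<longleftrightarrow>
     (\<forall>x0\<in>M. \<exists>x. closed_loop_solution u {0..} x \<and> x 0 = x0) \<and>
     (\<forall>T>0. \<forall>x. closed_loop_solution u {0..T} x \<and> x 0 \<in> M \<longrightarrow> (\<forall>t\<in>{0..T}. x t \<in> M))"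

definition equilibrium :: "('a::euclidean_space \<Rightarrow> 'a) \<Rightarrow> 'a \<Rightarrow> bool" where
  "equilibrium u x \<longleftrightarrow> tangent_proj x (u x) = 0"

definition stable_over :: "('a::euclidean_space \<Rightarrow> 'a) \<Rightarrow> 'a set \<Rightarrow> 'a \<Rightarrow> bool" where
  "stable_over u M xd \<longleftrightarrow>
     (\<forall>\<eta>>0. \<exists>\<rho>>0. \<forall>x. closed_loop_solution u {0..} x \<and> x 0 \<in> M \<and> dist (x 0) xd < \<rho>
        \<longrightarrow> (\<forall>t\<ge>0. dist (x t) xd < \<eta>))"

definition attracted :: "('a::euclidean_space \<Rightarrow> 'a) \<Rightarrow> 'a \<Rightarrow> 'a \<Rightarrow> bool" where
  "attracted u xd x0 \<longleftrightarrow>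
     (\<forall>x. closed_loop_solution u {0..} x \<and> x 0 = x0 \<longrightarrow> (x \<longlongrightarrow> xd) at_top)"

text \<open>
  Subsets of null sets count as null in \<open>AE\<close>, so this is Lebesgue (completed) surface measure zero.
\<close>

definition almost_globally_asymptotically_stable ::
    "('a::euclidean_space \<Rightarrow> 'a) \<Rightarrow> 'a set \<Rightarrow> 'a \<Rightarrow> bool" where
  "almost_globally_asymptotically_stable u M xd \<longleftrightarrow>
     xd \<in> M \<and> equilibrium u xd \<and> stable_over u M xd \<and>
     (AE x0 in sphere_measure. x0 \<in> M \<longrightarrow> attracted u xd x0)"


subsection \<open>Consistency of the case distinction in the feedback law\<close>

lemma bdd_below_sep: "A \<subseteq> unit_sphere \<Longrightarrow> bdd_below (sep x ` A)"
proof (rule bdd_belowI2)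
  fix a assume "A \<subseteq> unit_sphere" "a \<in> A"
  then have "norm a = 1" by auto
  then show "1 - norm x \<le> sep x a"
    using norm_cauchy_schwarz[of x a] by (simp add: sep_def)
qed

lemma set_sep_Union_le_iff:
  assumes "finite I" "I \<noteq> {}" "\<And>i. i \<in> I \<Longrightarrow> A i \<noteq> {} \<and> A i \<subseteq> unit_sphere"
  shows "set_sep x (\<Union>i\<in>I. A i) \<le> p \<longleftrightarrow> (\<exists>i\<in>I. set_sep x (A i) \<le> p)"
proof -
  have "set_sep x (\<Union>i\<in>I. A i) = (INF i\<in>I. set_sep x (A i))"
    unfolding set_sep_def
  proof (rule cINF_UNION)
    have "bdd_below (sep x ` (\<Union>i\<in>I. A i))"
      by (rule bdd_below_sep) (use assms in blast)
    then show "bdd_below (\<Union>i\<in>I. sep x ` A i)"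
      by (simp add: image_UN)
  qed (use assms in auto)
  also have "\<dots> = Min ((\<lambda>i. set_sep x (A i)) ` I)"
    using assms by (simp add: cInf_eq_Min)
  finally show ?thesis
    using assms by (simp add: Min_le_iff)
qed

lemma collar_Union_iff:
  assumes "finite I" "I \<noteq> {}" "\<And>i. i \<in> I \<Longrightarrow> A i \<noteq> {} \<and> A i \<subseteq> unit_sphere"
    and "x \<notin> sphere_interior (\<Union>i\<in>I. A i)"
  shows "x \<in> collar p (\<Union>i\<in>I. A i) \<longleftrightarrow> (\<exists>i\<in>I. x \<in> collar p (A i))"
proof -
  have "sphere_interior (A i) \<subseteq> sphere_interior (\<Union>i\<in>I. A i)" if "i \<in> I" for i
    unfolding sphere_interior_def using that by (intro interior_of_mono) auto
  then show ?thesis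
    using assms(4) set_sep_Union_le_iff[OF assms(1-3), where x = x and p = p]
    by (auto simp: collar_def dilation_def)
qed

end

theory Submission
  imports Defs
begin

text \<open>
  On the free space the feedback equals a field \<open>F\<close> that is Lipschitz on the whole sphere, and the
  closed loop is the radial projection of the flow of \<open>X' = |X| F (X / |X|)\<close>, which is homogeneous and
  globally Lipschitz.  In this picture a motion towards \<open>xd\<close> adds a positive multiple of \<open>xd\<close> to \<open>X\<close>, and
  a motion in the collar of \<open>U i\<close> adds positive multiples of \<open>xd\<close> and of \<open>- g i\<close>.  Hence a trajectory
  entering the interior of a star-shaped \<open>U i\<close> would already have been there before.

  Disjointness of the regions makes the level at which successive regions are left decrease, so no
  region is visited again after another one and eventually a single obstacle \<open>i\<close> matters.  From then
  on \<open>X = X0 + P xd - Q (g i)\<close> with increasing \<open>P\<close>, \<open>Q\<close>; if \<open>X0\<close> is outside the plane of \<open>xd\<close> and \<open>g i\<close>, then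
  \<open>|X|\<close> stays away from \<open>0\<close>, so \<open>P + Q\<close> is unbounded and \<open>X / |X|\<close> approaches the arc from \<open>xd\<close> to
  \<open>- g i\<close>.  This arc misses \<open>U i\<close>, so \<open>Q\<close> is at most a small multiple of \<open>P\<close> for large \<open>\<kappa>\<close>, and
  \<open>X / |X|\<close> converges to \<open>xd\<close>.  The exceptional initial states lie in countably many preimages of
  planes under time-\<open>n\<close> maps with Lipschitz inverse, which are null sets as the dimension is at least 3.
\<close>

subsection \<open>Lipschitz differential equations\<close>

text \<open>The cone keeps the radial part of the motion that the projection discards, so a fixed
  direction of the law integrates to a fixed added vector. The obstacle is that the feedback is not
  continuous: in the interior of a \<open>U i\<close>, \<open>control\<close> falls back to
  \<open>k1 *\<^sub>R xd\<close>, whereas \<open>F\<close> continues the collar law. Uniqueness for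
  \<open>F\<close> covers only curves known to stay in the free space, so invariance is proved
  twice, for the flow of \<open>F\<close> and for arbitrary solutions. The level of a region is the
  separation of \<open>xd\<close> from the dilation: leaving the region towards \<open>xd\<close>
  brings the separation strictly below it, and entering happens at or above it. If the dilation
  contains \<open>- xd\<close>, the region cannot be entered by a motion towards \<open>xd\<close>,
  and any level above 2 serves. The threshold for \<kappa> compares rates: where the cut-off is at
  least \<open>\<eta>0\<close>, \<open>Q\<close> grows at most
  \<open>1 / (\<kappa> * \<eta>0)\<close> times as fast as \<open>P\<close>; this must be below a
  radius \<open>\<rho>\<close> around \<open>xd\<close> within which the cut-off is 1.\<close>

lemma has_real_derivative_inner_self:
  fixes z :: "real \<Rightarrow> 'a::real_inner"
  assumes "(z has_vector_derivative z') (at t within S)"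
  shows "((\<lambda>t. z t \<bullet> z t) has_real_derivative 2 * (z t \<bullet> z')) (at t within S)"
  using bounded_bilinear.has_vector_derivative[OF bounded_bilinear_inner assms assms]
  by (simp add: has_real_derivative_iff_has_vector_derivative inner_commute)

lemma nonneg_derivative_imp_le:
  fixes f :: "real \<Rightarrow> real"
  assumes "a \<le> b"
    and "\<And>t. t \<in> {a..b} \<Longrightarrow> (f has_real_derivative f' t) (at t within {a..b})"
    and "\<And>t. t \<in> {a..b} \<Longrightarrow> f' t \<ge> 0"
  shows "f a \<le> f b"
proof -
  have "(f' has_integral (f b - f a)) {a..b}"
    using assms by (intro fundamental_theorem_of_calculus)
      (auto simp: has_real_derivative_iff_has_vector_derivative)
  then have "0 \<le> f b - f a"
    using assms(3) by (rule has_integral_nonneg)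
  then show ?thesis by simp
qed

text \<open>
  \<open>exp (- 2 L t) |x - y|\<^sup>2\<close> decreases and \<open>exp (2 L t) |x - y|\<^sup>2\<close> increases; the second fact
  makes the time-\<open>T\<close> map injective with Lipschitz inverse without solving backwards.
\<close>

lemma lipschitz_ode_dist:
  fixes x y :: "real \<Rightarrow> 'a::real_inner"
  assumes T: "0 \<le> T"
    and x: "\<And>t. t \<in> {0..T} \<Longrightarrow> (x has_vector_derivative H (x t)) (at t within {0..T})"
    and y: "\<And>t. t \<in> {0..T} \<Longrightarrow> (y has_vector_derivative H (y t)) (at t within {0..T})"
    and lip: "\<And>u v. norm (H u - H v) \<le> L * norm (u - v)"
  shows "norm (x T - y T) \<le> exp (L * T) * norm (x 0 - y 0)"
    and "norm (x 0 - y 0) \<le> exp (L * T) * norm (x T - y T)"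
proof -
  define z where "z t = x t - y t" for t
  define z' where "z' t = H (x t) - H (y t)" for t
  have z: "((\<lambda>t. z t \<bullet> z t) has_real_derivative 2 * (z t \<bullet> z' t)) (at t within {0..T})"
    if "t \<in> {0..T}" for t
    unfolding z_def z'_def
    by (intro has_real_derivative_inner_self derivative_intros x y that)
  have est: "\<bar>z t \<bullet> z' t\<bar> \<le> L * (z t \<bullet> z t)" for t
  proof -
    have "\<bar>z t \<bullet> z' t\<bar> \<le> norm (z t) * norm (z' t)" by (rule Cauchy_Schwarz_ineq2)
    also have "\<dots> \<le> norm (z t) * (L * norm (z t))"
      unfolding z'_def z_def by (intro mult_left_mono lip) auto
    finally show ?thesis by (simp add: dot_square_norm power2_eq_square mult_ac)
  qed
  have 1: "exp (- 2 * L * T) * (z T \<bullet> z T) \<le> exp (- 2 * L * 0) * (z 0 \<bullet> z 0)"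
  proof -
    have "- (exp (- 2 * L * 0) * (z 0 \<bullet> z 0)) \<le> - (exp (- 2 * L * T) * (z T \<bullet> z T))"
    proof (rule nonneg_derivative_imp_le[OF T,
        where f' = "\<lambda>t. exp (- 2 * L * t) * (2 * L * (z t \<bullet> z t) - 2 * (z t \<bullet> z' t))"])
      fix t assume t: "t \<in> {0..T}"
      show "((\<lambda>t. - (exp (- 2 * L * t) * (z t \<bullet> z t))) has_real_derivative
        exp (- 2 * L * t) * (2 * L * (z t \<bullet> z t) - 2 * (z t \<bullet> z' t))) (at t within {0..T})"
        by (rule derivative_eq_intros z[OF t] refl | simp add: algebra_simps)+
      show "exp (- 2 * L * t) * (2 * L * (z t \<bullet> z t) - 2 * (z t \<bullet> z' t)) \<ge> 0"
        using est[of t] by (intro mult_nonneg_nonneg) auto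
    qed
    then show ?thesis by simp
  qed
  have 2: "exp (2 * L * 0) * (z 0 \<bullet> z 0) \<le> exp (2 * L * T) * (z T \<bullet> z T)"
  proof (rule nonneg_derivative_imp_le[OF T,
        where f' = "\<lambda>t. exp (2 * L * t) * (2 * L * (z t \<bullet> z t) + 2 * (z t \<bullet> z' t))"])
    fix t assume t: "t \<in> {0..T}"
    show "((\<lambda>t. exp (2 * L * t) * (z t \<bullet> z t)) has_real_derivative
        exp (2 * L * t) * (2 * L * (z t \<bullet> z t) + 2 * (z t \<bullet> z' t))) (at t within {0..T})"
      by (rule derivative_eq_intros z[OF t] refl | simp add: algebra_simps)+
    show "exp (2 * L * t) * (2 * L * (z t \<bullet> z t) + 2 * (z t \<bullet> z' t)) \<ge> 0"
      using est[of t] by (intro mult_nonneg_nonneg) auto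
  qed
  have e: "exp (2 * L * T) = (exp (L * T))\<^sup>2"
    by (simp add: exp_double[symmetric] mult_ac)
  then have e': "exp (L * (T * 2)) = (exp (L * T))\<^sup>2"
    by (simp add: mult_ac)
  have "(norm (z T))\<^sup>2 \<le> (exp (L * T) * norm (z 0))\<^sup>2"
    using 1 by (simp add: dot_square_norm exp_minus e e' power_mult_distrib divide_simps mult_ac)
  then show "norm (x T - y T) \<le> exp (L * T) * norm (x 0 - y 0)"
    unfolding z_def by (rule power2_le_imp_le) simp
  have "(norm (z 0))\<^sup>2 \<le> (exp (L * T) * norm (z T))\<^sup>2"
    using 2 by (simp add: dot_square_norm e power_mult_distrib)
  then show "norm (x 0 - y 0) \<le> exp (L * T) * norm (x T - y T)"
    unfolding z_def by (rule power2_le_imp_le) simp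
qed

lemma at_within_atLeast_eq:
  fixes t :: real
  assumes "a \<le> t" "t < b"
  shows "at t within {a..} = at t within {a..b}"
  by (rule at_within_nhd[where S = "{..<b}"]) (use assms in auto)

lemma integral_has_vector_derivative_atLeast:
  fixes h :: "real \<Rightarrow> 'a::banach"
  assumes "continuous_on {a..} h" "a \<le> t"
  shows "((\<lambda>s. integral {a..s} h) has_vector_derivative h t) (at t within {a..})"
proof -
  have "((\<lambda>s. integral {a..s} h) has_vector_derivative h t) (at t within {a..t+1})"
    using assms by (intro integral_has_vector_derivative) (auto intro: continuous_on_subset)
  then show ?thesis
    using at_within_atLeast_eq[of a t "t+1"] assms by simp
qed

text \<open>Source of the contraction factor in the Picard iteration: against the Lipschitz constant
  \<open>L\<close>, integrating the weight with exponent \<open>2 * L\<close> contributes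
  \<open>1 / (2 * L)\<close>, leaving \<open>1 / 2\<close>.\<close>

lemma has_integral_exp_scaled:
  fixes L D :: real
  assumes "L > 0" "0 \<le> s"
  shows "((\<lambda>t. L * exp (2 * L * t) * D) has_integral (D / 2 * (exp (2 * L * s) - 1))) {0..s}"
proof -
  have "((\<lambda>t. L * exp (2 * L * t) * D) has_integral
      (D / 2 * exp (2 * L * s) - D / 2 * exp (2 * L * 0))) {0..s}"
    by (rule fundamental_theorem_of_calculus[OF assms(2)],
        unfold has_real_derivative_iff_has_vector_derivative[symmetric])
      (rule derivative_eq_intros refl | simp)+
  then show ?thesis by (simp add: algebra_simps)
qed

text \<open>
  Picard iteration for \<open>v t = exp (- 2 L t) x t\<close>: this weight makes the integral operator a
  contraction with constant \<open>1/2\<close> on the whole half line.  The clamp \<open>max 0 t\<close> only serves to work with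
  functions on all of \<open>\<real>\<close>.
\<close>

lemma lipschitz_ode_exists:
  fixes H :: "'a::euclidean_space \<Rightarrow> 'a"
  assumes L: "L > 0" and lip: "\<And>u v. norm (H u - H v) \<le> L * norm (u - v)" and H0: "H 0 = 0"
  shows "\<exists>x. x 0 = x0 \<and> (\<forall>t\<ge>0. (x has_vector_derivative H (x t)) (at t within {0..}))"
proof -
  have contH: "continuous_on S H" for S
    by (rule lipschitz_on_continuous_on[of L])
      (use lip L in \<open>auto simp: lipschitz_on_def dist_norm\<close>)
  define h where "h v t = H (exp (2 * L * t) *\<^sub>R apply_bcontfun v t)" for v t
  have h: "continuous_on S (h v)" for S v
    unfolding h_def
    by (intro continuous_on_compose2[OF contH[of UNIV]] continuous_intros) auto
  define J where "J v s = integral {0..s} (h v)" for v s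
  have J: "(J v has_vector_derivative h v t) (at t within {0..})" if "0 \<le> t" for v t
    unfolding J_def by (rule integral_has_vector_derivative_atLeast[OF h that])
  have contJ: "continuous_on {0..} (J v)" for v
    by (rule continuous_on_vector_derivative[OF J]) auto
  define \<Gamma> where "\<Gamma> v t = exp (- 2 * L * max 0 t) *\<^sub>R (x0 + J v (max 0 t))" for v t
  have cont\<Gamma>: "continuous_on UNIV (\<Gamma> v)" for v
    unfolding \<Gamma>_def by (intro continuous_intros continuous_on_compose2[OF contJ]) auto
  have hdiff: "norm (h v t - h w t) \<le> L * exp (2 * L * t) * D" if "dist v w \<le> D" for v w t D
  proof -
    have "norm (h v t - h w t) \<le> L * norm (exp (2 * L * t) *\<^sub>R (apply_bcontfun v t - apply_bcontfun w t))"
      unfolding h_def using lip by (metis scaleR_diff_right)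
    also have "\<dots> = L * exp (2 * L * t) * dist (apply_bcontfun v t) (apply_bcontfun w t)"
      by (simp add: dist_norm)
    also have "\<dots> \<le> L * exp (2 * L * t) * D"
      using L that dist_bounded[of v t w] by (intro mult_left_mono) auto
    finally show ?thesis .
  qed
  have Jdiff: "norm (J v s - J w s) \<le> D / 2 * exp (2 * L * s)" if "dist v w \<le> D" "0 \<le> s" for v w s D
  proof -
    have D: "D \<ge> 0" using that(1) zero_le_dist order_trans by blast
    have "norm (J v s - J w s) = norm (integral {0..s} (\<lambda>t. h v t - h w t))"
      unfolding J_def
      by (subst integral_diff) (auto intro!: integrable_continuous_real h)
    also have "\<dots> \<le> integral {0..s} (\<lambda>t. L * exp (2 * L * t) * D)"
      using hdiff[OF that(1)] has_integral_exp_scaled[OF L that(2)]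
      by (intro integral_norm_bound_integral)
        (auto intro!: integrable_continuous_real continuous_intros h simp: has_integral_integrable)
    also have "\<dots> = D / 2 * (exp (2 * L * s) - 1)"
      using has_integral_exp_scaled[OF L that(2)] by (rule integral_unique)
    finally show ?thesis using D by (simp add: algebra_simps)
  qed
  have weight: "norm (exp (- 2 * L * s) *\<^sub>R (J v s - J w s)) \<le> D / 2"
    if "dist v w \<le> D" "0 \<le> s" for v w s D
    unfolding norm_scaleR using Jdiff[OF that] by (simp add: exp_minus field_simps)
  \<comment> \<open>Since \<open>H 0 = 0\<close>, the zero curve has vanishing integral; the
    contraction estimate against it also yields the boundedness of \<open>\<Gamma> v\<close>, needed
    to stay within the bounded continuous functions.\<close>
  have J0: "J 0 s = 0" for s
    unfolding J_def h_def by (simp add: H0)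
  have bd: "norm (\<Gamma> v t) \<le> norm x0 + dist v 0 / 2" for v t
  proof -
    let ?s = "max 0 t"
    have "norm (\<Gamma> v t) \<le> norm (exp (- 2 * L * ?s) *\<^sub>R x0) + norm (exp (- 2 * L * ?s) *\<^sub>R (J v ?s - J 0 ?s))"
      unfolding \<Gamma>_def J0 scaleR_add_right by (simp add: norm_triangle_ineq del: norm_scaleR)
    also have "\<dots> \<le> norm x0 + dist v 0 / 2"
    proof (rule add_mono)
      have "exp (- (2 * L * ?s)) * norm x0 \<le> 1 * norm x0"
        using L by (intro mult_right_mono) auto
      then show "norm (exp (- 2 * L * ?s) *\<^sub>R x0) \<le> norm x0" by simp
    qed (rule weight, auto)
    finally show ?thesis .
  qed
  define G where "G v = Bcontfun (\<Gamma> v)" for v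
  have G: "apply_bcontfun (G v) = \<Gamma> v" for v
    unfolding G_def by (rule Bcontfun_inverse) (rule bcontfun_normI[OF cont\<Gamma> bd])
  have "dist (G v) (G w) \<le> 1 / 2 * dist v w" for v w
  proof (rule dist_bound)
    fix t
    have "dist (G v t) (G w t) = norm (exp (- 2 * L * max 0 t) *\<^sub>R (J v (max 0 t) - J w (max 0 t)))"
      unfolding G \<Gamma>_def dist_norm by (metis add_diff_cancel_left scaleR_diff_right)
    also have "\<dots> \<le> dist v w / 2" by (rule weight) auto
    finally show "dist (G v t) (G w t) \<le> 1 / 2 * dist v w" by simp
  qed
  then obtain v where "G v = v"
    using banach_fix_type[of "1/2" G] by auto
  then have v: "apply_bcontfun v t = \<Gamma> v t" for t using G by metis
  define x where "x t = x0 + J v t" for t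
  have hx: "h v t = H (x t)" if "t \<ge> 0" for t
    unfolding h_def v using that by (simp add: \<Gamma>_def x_def exp_minus)
  have "(x has_vector_derivative H (x t)) (at t within {0..})" if "t \<ge> 0" for t
    unfolding x_def[abs_def] using J[OF that, of v] hx[OF that]
    by (auto simp: x_def intro!: derivative_eq_intros)
  moreover have "x 0 = x0" by (simp add: x_def J_def)
  ultimately show ?thesis by blast
qed


subsection \<open>Lifting the flow from the sphere to its cone\<close>

text \<open>The norm has derivative \<open>X t \<bullet> u\<close>, so the quotient rule subtracts
  exactly the radial part of \<open>u\<close>, and the factor \<open>norm (X t)\<close>
  cancels.\<close>

lemma radial_projection_has_vector_derivative:
  fixes X :: "real \<Rightarrow> 'a::euclidean_space"
  assumes X: "(X has_vector_derivative norm (X t) *\<^sub>R u) (at t within S)" and nz: "X t \<noteq> 0"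
  shows "((\<lambda>t. X t /\<^sub>R norm (X t)) has_vector_derivative tangent_proj (X t /\<^sub>R norm (X t)) u) (at t within S)"
proof -
  have n: "((\<lambda>t. norm (X t)) has_real_derivative X t \<bullet> u) (at t within S)"
  proof -
    have "((\<lambda>t. sqrt (X t \<bullet> X t)) has_real_derivative
        (inverse (sqrt (X t \<bullet> X t)) / 2) * (2 * (X t \<bullet> (norm (X t) *\<^sub>R u)))) (at t within S)"
      by (rule DERIV_chain2[OF DERIV_real_sqrt has_real_derivative_inner_self[OF X]]) (use nz in simp)
    then show ?thesis using nz by (simp add: norm_eq_sqrt_inner[symmetric] mult.assoc[symmetric])
  qed
  have "((\<lambda>t. X t /\<^sub>R norm (X t)) has_vector_derivative
      inverse (norm (X t)) *\<^sub>R (norm (X t) *\<^sub>R u)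
        + - (inverse (norm (X t)) * (X t \<bullet> u) * inverse (norm (X t))) *\<^sub>R X t) (at t within S)"
    by (rule has_vector_derivative_scaleR[OF DERIV_inverse'[OF n] X]) (use nz in simp)
  then show ?thesis using nz by (simp add: tangent_proj_def mult_ac)
qed

text \<open>\<open>E\<close> solves \<open>E' = E * (x \<bullet> u)\<close>, which restores the
  radial component removed by \<open>tangent_proj\<close>. The control enters only through its
  values along the curve, so a discontinuous feedback can be lifted wherever those values vary
  continuously.\<close>

lemma sphere_solution_lift:
  fixes x :: "real \<Rightarrow> 'a::euclidean_space"
  assumes x: "\<And>t. t \<in> {a..b} \<Longrightarrow> (x has_vector_derivative tangent_proj (x t) (u t)) (at t within {a..b})"
    and u: "continuous_on {a..b} u"
  obtains E :: "real \<Rightarrow> real" where "E a = 1" "\<And>t. E t > 0" "continuous_on {a..b} E"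
    "\<And>t. t \<in> {a..b} \<Longrightarrow> ((\<lambda>t. E t *\<^sub>R x t) has_vector_derivative E t *\<^sub>R u t) (at t within {a..b})"
proof
  have contx: "continuous_on {a..b} x" by (rule continuous_on_vector_derivative[OF x])
  define E where "E t = exp (integral {a..t} (\<lambda>s. x s \<bullet> u s))" for t
  have I: "((\<lambda>t. integral {a..t} (\<lambda>s. x s \<bullet> u s)) has_real_derivative x t \<bullet> u t) (at t within {a..b})"
    if "t \<in> {a..b}" for t
    by (rule integral_has_real_derivative[OF continuous_on_inner[OF contx u] that])
  have E: "(E has_real_derivative E t * (x t \<bullet> u t)) (at t within {a..b})" if "t \<in> {a..b}" for t
    unfolding E_def[abs_def] by (rule DERIV_chain2[OF DERIV_exp I[OF that]])
  show "E a = 1" "\<And>t. E t > 0" by (simp_all add: E_def)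
  show "continuous_on {a..b} E" by (rule DERIV_continuous_on[OF E])
  fix t assume t: "t \<in> {a..b}"
  show "((\<lambda>t. E t *\<^sub>R x t) has_vector_derivative E t *\<^sub>R u t) (at t within {a..b})"
    using has_vector_derivative_scaleR[OF E[OF t] x[OF t]] by (simp add: tangent_proj_def algebra_simps)
qed


subsection \<open>Geodesics and interiors\<close>

text \<open>Trades the trigonometric parametrisation for the convex cone of the endpoints, the form
  that fits motions adding multiples of fixed vectors.\<close>

lemma mem_geodesic_iff:
  fixes a b :: "'a::euclidean_space"
  assumes a: "norm a = 1" and b: "norm b = 1" and ab: "a \<noteq> - b"
  shows "x \<in> geodesic a b \<longleftrightarrow> norm x = 1 \<and> (\<exists>\<alpha>\<ge>0. \<exists>\<beta>\<ge>0. x = \<alpha> *\<^sub>R a + \<beta> *\<^sub>R b)"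
proof (cases "a = b")
  case True
  have "x = a" if "norm x = 1" "\<alpha> \<ge> 0" "\<beta> \<ge> 0" "x = \<alpha> *\<^sub>R a + \<beta> *\<^sub>R a" for \<alpha> \<beta>
  proof -
    have x: "x = (\<alpha> + \<beta>) *\<^sub>R a" using that by (simp add: scaleR_left_distrib)
    then have "\<alpha> + \<beta> = 1" using that a by simp
    then show ?thesis using x by simp
  qed
  moreover have "\<exists>\<alpha>\<ge>0. \<exists>\<beta>\<ge>0. a = \<alpha> *\<^sub>R a + \<beta> *\<^sub>R a"
    by (rule exI[of _ 1], simp, rule exI[of _ 0], simp)
  ultimately show ?thesis using True a by (auto simp: geodesic_def)
next
  case False
  define \<theta> where "\<theta> = arccos (a \<bullet> b)"
  have aa: "a \<bullet> a = 1" "b \<bullet> b = 1" using a b by (simp_all add: dot_square_norm)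
  have "\<bar>a \<bullet> b\<bar> \<le> 1" using Cauchy_Schwarz_ineq2[of a b] a b by simp
  moreover have "a \<bullet> b \<noteq> 1" "a \<bullet> b \<noteq> -1"
  proof -
    have "(norm (a - b))\<^sup>2 = 2 - 2 * (a \<bullet> b)" "(norm (a + b))\<^sup>2 = 2 + 2 * (a \<bullet> b)"
      using aa by (simp_all add: power2_norm_eq_inner inner_diff_left inner_diff_right inner_add_left
          inner_add_right inner_commute)
    then show "a \<bullet> b \<noteq> 1" "a \<bullet> b \<noteq> -1" using False ab by (auto simp: add_eq_0_iff2)
  qed
  ultimately have lt: "-1 < a \<bullet> b" "a \<bullet> b < 1" by auto
  have \<theta>: "0 < \<theta>" "\<theta> < pi" "cos \<theta> = a \<bullet> b"
    using arccos_lt_bounded[OF lt] lt by (simp_all add: \<theta>_def)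
  then have s: "sin \<theta> > 0" by (intro sin_gt_zero)
  have sc: "(sin \<theta>)\<^sup>2 = 1 - (cos \<theta>)\<^sup>2" by (simp add: sin_squared_eq)
  have nrm: "(norm (p *\<^sub>R a + q *\<^sub>R b))\<^sup>2 = p\<^sup>2 + q\<^sup>2 + 2 * p * q * cos \<theta>" for p q
    using aa \<theta>(3)
    unfolding power2_norm_eq_inner
    by (simp add: inner_add_left inner_add_right inner_commute[of b a] power2_eq_square algebra_simps)
  have geo: "x \<in> geodesic a b \<longleftrightarrow> (\<exists>l\<in>{0..1}. x = (sin ((1 - l) * \<theta>) / sin \<theta>) *\<^sub>R a + (sin (l * \<theta>) / sin \<theta>) *\<^sub>R b)"
    using False by (auto simp: geodesic_def Let_def \<theta>_def image_iff scaleR_add_right divide_inverse mult.commute)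
  show ?thesis
  proof
    assume "x \<in> geodesic a b"
    then obtain l where l: "l \<in> {0..1}" "x = (sin ((1 - l) * \<theta>) / sin \<theta>) *\<^sub>R a + (sin (l * \<theta>) / sin \<theta>) *\<^sub>R b"
      using geo by blast
    define P where "P = (1 - l) * \<theta>"
    define Q where "Q = l * \<theta>"
    have PQ: "P + Q = \<theta>" by (simp add: P_def Q_def algebra_simps)
    have "0 \<le> P" "P \<le> \<theta>" "0 \<le> Q" "Q \<le> \<theta>"
      using l(1) \<theta>(1) by (auto simp: P_def Q_def mult_le_cancel_right1 mult_le_cancel_left1)
    then have pos: "sin P \<ge> 0" "sin Q \<ge> 0" using \<theta> by (auto intro!: sin_ge_zero)
    have id: "(sin P)\<^sup>2 + (sin Q)\<^sup>2 + 2 * sin P * sin Q * cos \<theta> = (sin \<theta>)\<^sup>2"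
    proof -
      have 1: "(cos P)\<^sup>2 = 1 - (sin P)\<^sup>2" "(cos Q)\<^sup>2 = 1 - (sin Q)\<^sup>2" by (simp_all add: cos_squared_eq)
      have "(sin \<theta>)\<^sup>2 = (sin P)\<^sup>2 * (cos Q)\<^sup>2 + (cos P)\<^sup>2 * (sin Q)\<^sup>2 + 2 * sin P * sin Q * (cos P * cos Q)"
        unfolding PQ[symmetric] sin_add by (simp add: power2_eq_square algebra_simps)
      also have "\<dots> = (sin P)\<^sup>2 + (sin Q)\<^sup>2 + 2 * sin P * sin Q * (cos P * cos Q - sin P * sin Q)"
        unfolding 1 by (simp add: power2_eq_square algebra_simps)
      finally show ?thesis unfolding PQ[symmetric] cos_add by simp
    qed
    have "(norm x)\<^sup>2 = ((sin P)\<^sup>2 + (sin Q)\<^sup>2 + 2 * sin P * sin Q * cos \<theta>) / (sin \<theta>)\<^sup>2"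
      unfolding l(2) P_def[symmetric] Q_def[symmetric] nrm using s by (simp add: field_simps power2_eq_square)
    then have "(norm x)\<^sup>2 = 1" unfolding id using s by simp
    then have "norm x = 1" by (simp add: power2_eq_1_iff) (use norm_ge_zero[of x] in linarith)
    moreover have "sin P / sin \<theta> \<ge> 0" "sin Q / sin \<theta> \<ge> 0" using pos s by simp_all
    ultimately show "norm x = 1 \<and> (\<exists>\<alpha>\<ge>0. \<exists>\<beta>\<ge>0. x = \<alpha> *\<^sub>R a + \<beta> *\<^sub>R b)"
      using l(2) unfolding P_def Q_def by blast
  next
    assume "norm x = 1 \<and> (\<exists>\<alpha>\<ge>0. \<exists>\<beta>\<ge>0. x = \<alpha> *\<^sub>R a + \<beta> *\<^sub>R b)"
    then obtain \<alpha> \<beta> where x: "norm x = 1" "\<alpha> \<ge> 0" "\<beta> \<ge> 0" "x = \<alpha> *\<^sub>R a + \<beta> *\<^sub>R b" by blast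
    have 1: "\<alpha>\<^sup>2 + \<beta>\<^sup>2 + 2 * \<alpha> * \<beta> * cos \<theta> = 1" using nrm[of \<alpha> \<beta>] x by simp
    \<comment> \<open>\<open>C\<close> is \<open>a \<bullet> x\<close>, so \<phi> below is the angle
      from \<open>a\<close> to \<open>x\<close>, and the geodesic parameter will be
      \<open>\<phi> / \<theta>\<close>.\<close>
    define C where "C = \<alpha> + \<beta> * cos \<theta>"
    have C2: "1 - C\<^sup>2 = (\<beta> * sin \<theta>)\<^sup>2"
      unfolding power_mult_distrib sc C_def using 1 by (simp add: power2_eq_square algebra_simps)
    then have "C\<^sup>2 \<le> 1" by (metis diff_ge_0_iff_ge zero_le_power2)
    then have C: "-1 \<le> C" "C \<le> 1" using abs_square_le_1[of C] by auto
    define \<phi> where "\<phi> = arccos C"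
    have \<phi>: "0 \<le> \<phi>" "\<phi> \<le> pi" "cos \<phi> = C" using C by (simp_all add: \<phi>_def arccos_lbound arccos_ubound)
    have sph: "sin \<phi> = \<beta> * sin \<theta>"
      unfolding \<phi>_def sin_arccos[OF C] C2 using x(3) s by simp
    have sd: "sin (\<theta> - \<phi>) = \<alpha> * sin \<theta>"
      unfolding sin_diff sph \<phi>(3) C_def by (simp add: algebra_simps)
    \<comment> \<open>Beyond \<theta> the coefficient of \<open>a\<close> would be negative.\<close>
    have "\<phi> \<le> \<theta>"
    proof (rule ccontr)
      assume "\<not> \<phi> \<le> \<theta>"
      then have "sin (\<phi> - \<theta>) > 0" using \<phi> \<theta> by (intro sin_gt_zero) auto
      then have "sin (\<theta> - \<phi>) < 0" by (metis minus_diff_eq neg_less_0_iff_less sin_minus)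
      moreover have "\<alpha> * sin \<theta> \<ge> 0" using x(2) s by (intro mult_nonneg_nonneg) auto
      ultimately show False using sd by linarith
    qed
    then have "\<phi> / \<theta> \<in> {0..1}" using \<phi>(1) \<theta>(1) by simp
    moreover have "(1 - \<phi> / \<theta>) * \<theta> = \<theta> - \<phi>" "\<phi> / \<theta> * \<theta> = \<phi>" using \<theta>(1) by (simp_all add: field_simps)
    ultimately show "x \<in> geodesic a b"
      unfolding geo using sd sph s x(4) by (intro bexI[of _ "\<phi> / \<theta>"]) simp_all
  qed
qed

lemma sphere_interior_iff:
  "x \<in> sphere_interior A \<longleftrightarrow> norm x = 1 \<and> (\<exists>e>0. \<forall>y. norm y = 1 \<and> dist y x < e \<longrightarrow> y \<in> A)"
proof
  assume "x \<in> sphere_interior A"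
  then obtain T where "openin (top_of_set (sphere 0 1)) T" and T: "x \<in> T" "T \<subseteq> A"
    unfolding sphere_interior_def interior_of_def by blast
  then obtain e where "T \<subseteq> sphere 0 1" "e > 0" and e: "\<And>y. y \<in> sphere 0 1 \<Longrightarrow> dist y x < e \<Longrightarrow> y \<in> T"
    unfolding openin_euclidean_subtopology_iff by blast
  then show "norm x = 1 \<and> (\<exists>e>0. \<forall>y. norm y = 1 \<and> dist y x < e \<longrightarrow> y \<in> A)"
    using T by (intro conjI exI[of _ e]) auto
next
  assume "norm x = 1 \<and> (\<exists>e>0. \<forall>y. norm y = 1 \<and> dist y x < e \<longrightarrow> y \<in> A)"
  then obtain e where "norm x = 1" "e > 0" and e: "\<And>y. norm y = 1 \<Longrightarrow> dist y x < e \<Longrightarrow> y \<in> A" by blast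
  have "openin (top_of_set (sphere 0 1)) (sphere 0 1 \<inter> ball x e)"
    by (rule openin_open_Int) simp
  moreover have "x \<in> sphere 0 1 \<inter> ball x e" using \<open>norm x = 1\<close> \<open>e > 0\<close> by simp
  moreover have "sphere 0 1 \<inter> ball x e \<subseteq> A" using e by (auto simp: dist_commute)
  ultimately show "x \<in> sphere_interior A"
    unfolding sphere_interior_def interior_of_def by blast
qed

lemma sphere_interior_subset: "sphere_interior A \<subseteq> A"
  unfolding sphere_interior_def by (rule interior_of_subset)

text \<open>The map \<open>h\<close>, which subtracts \<open>\<beta> *\<^sub>R g\<close> and
  normalises, is continuous at \<open>x\<close> and sends it to \<open>y\<close>. Unit vectors
  \<open>z\<close> near \<open>x\<close> are therefore sent into \<open>A\<close>, and each lies on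
  the geodesic from \<open>g\<close> to \<open>h z\<close>. Applied to a motion along
  \<open>- g\<close> read backwards, this keeps earlier points in the interior.\<close>

lemma star_center_interior:
  fixes A :: "'a::euclidean_space set"
  assumes A: "A \<subseteq> unit_sphere" and g: "g \<in> star_centers A" and y: "y \<in> sphere_interior A"
    and x: "x = \<alpha> *\<^sub>R y + \<beta> *\<^sub>R g" "norm x = 1" and \<alpha>: "\<alpha> > 0" and \<beta>: "\<beta> \<ge> 0"
  shows "x \<in> sphere_interior A"
proof -
  have g1: "norm g = 1" "- g \<notin> A" using g A by (auto simp: star_centers_def)
  obtain e where y1: "norm y = 1" and e: "e > 0" "\<And>z. norm z = 1 \<Longrightarrow> dist z y < e \<Longrightarrow> z \<in> A"
    using y unfolding sphere_interior_iff by blast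
  define h where "h z = (z - \<beta> *\<^sub>R g) /\<^sub>R norm (z - \<beta> *\<^sub>R g)" for z
  have hx: "x - \<beta> *\<^sub>R g = \<alpha> *\<^sub>R y" using x by simp
  then have nz: "x - \<beta> *\<^sub>R g \<noteq> 0" using \<alpha> y1 by auto
  have hxy: "h x = y" unfolding h_def hx using \<alpha> y1 by simp
  have "isCont h x"
    unfolding h_def by (intro continuous_intros) (use nz in simp)
  then have "(h \<longlongrightarrow> y) (nhds x)"
    by (metis hxy isCont_def tendsto_at_iff_tendsto_nhds)
  then have "\<forall>\<^sub>F z in nhds x. dist (h z) y < e"
    using e(1) by (rule tendstoD)
  moreover have "\<forall>\<^sub>F z in nhds x. z - \<beta> *\<^sub>R g \<noteq> 0"
  proof -
    have "open {z. z - \<beta> *\<^sub>R g \<noteq> 0}" by (intro open_Collect_neq continuous_intros)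
    from eventually_nhds_in_open[OF this, of x] show ?thesis using nz by simp
  qed
  ultimately have "\<forall>\<^sub>F z in nhds x. dist (h z) y < e \<and> z - \<beta> *\<^sub>R g \<noteq> 0" by (rule eventually_conj)
  then obtain d where "d > 0" and d: "\<And>z. dist z x < d \<Longrightarrow> dist (h z) y < e \<and> z - \<beta> *\<^sub>R g \<noteq> 0"
    unfolding eventually_nhds_metric by blast
  have "z \<in> A" if z: "norm z = 1" "dist z x < d" for z
  proof -
    have n: "norm (h z) = 1" using d[OF z(2)] unfolding h_def by simp
    then have hA: "h z \<in> A" using e(2) d[OF z(2)] by blast
    then have "g \<noteq> - h z" using g1(2) by (metis minus_minus)
    have "z = \<beta> *\<^sub>R g + norm (z - \<beta> *\<^sub>R g) *\<^sub>R h z"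
      using d[OF z(2)] unfolding h_def by simp
    then have "z \<in> geodesic g (h z)"
      unfolding mem_geodesic_iff[OF g1(1) n \<open>g \<noteq> - h z\<close>] using z(1) \<beta> norm_ge_zero by blast
    then show "z \<in> A" using g hA by (auto simp: star_centers_def)
  qed
  then show ?thesis unfolding sphere_interior_iff using x(2) \<open>d > 0\<close> by blast
qed


subsection \<open>Separation from a compact set\<close>

lemma sep_commute: "sep x y = sep y x"
  by (simp add: sep_def inner_commute)

lemma set_sep_le: "A \<subseteq> unit_sphere \<Longrightarrow> a \<in> A \<Longrightarrow> set_sep x A \<le> sep x a"
  unfolding set_sep_def by (rule cINF_lower[OF bdd_below_sep])

lemma set_sep_attained:
  assumes "compact A" "A \<noteq> {}" "A \<subseteq> unit_sphere"
  obtains a where "a \<in> A" "set_sep x A = sep x a"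
proof -
  have "continuous_on A (sep x)" unfolding sep_def[abs_def] by (intro continuous_intros)
  then obtain a where a: "a \<in> A" "\<And>b. b \<in> A \<Longrightarrow> sep x a \<le> sep x b"
    using continuous_attains_inf[OF assms(1,2)] by blast
  then have "set_sep x A = sep x a"
    unfolding set_sep_def by (intro cInf_eq_minimum) auto
  then show thesis using that a(1) by blast
qed

lemma set_sep_lipschitz:
  assumes "A \<noteq> {}" "A \<subseteq> unit_sphere"
  shows "\<bar>set_sep x A - set_sep y A\<bar> \<le> norm (x - y)"
proof -
  have "set_sep x A - norm (x - y) \<le> set_sep y A" for x y :: 'a
    unfolding set_sep_def[of y]
  proof (rule cINF_greatest[OF assms(1)])
    fix a assume a: "a \<in> A"
    have "(y - x) \<bullet> a \<le> norm (y - x) * norm a" by (rule norm_cauchy_schwarz)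
    moreover have "norm a = 1" using a assms(2) by auto
    ultimately have "(y - x) \<bullet> a \<le> norm (x - y)" by (simp add: norm_minus_commute)
    then show "set_sep x A - norm (x - y) \<le> sep y a"
      using set_sep_le[OF assms(2) a, of x] by (simp add: sep_def inner_diff_left)
  qed
  from this[of x y] this[of y x] show ?thesis by (simp add: norm_minus_commute)
qed

lemma continuous_on_set_sep:
  assumes "A \<noteq> {}" "A \<subseteq> unit_sphere"
  shows "continuous_on S (\<lambda>x. set_sep x A)"
  by (rule lipschitz_on_continuous_on[of 1])
    (use set_sep_lipschitz[OF assms] in \<open>auto simp: lipschitz_on_def dist_norm\<close>)

lemma sep_eq_norm:
  assumes "norm x = 1" "norm y = 1"
  shows "sep x y = (norm (x - y))\<^sup>2 / 2"
proof -
  have "x \<bullet> x = 1" "y \<bullet> y = 1" using assms by (simp_all add: dot_square_norm)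
  then show ?thesis
    unfolding sep_def power2_norm_eq_inner inner_diff_left inner_diff_right
    by (simp add: inner_commute[of y x])
qed

lemma set_sep_nonneg:
  assumes "A \<noteq> {}" "A \<subseteq> unit_sphere" "norm x \<le> 1"
  shows "set_sep x A \<ge> 0"
  unfolding set_sep_def
proof (rule cINF_greatest[OF assms(1)])
  fix a assume "a \<in> A"
  then have "norm a = 1" using assms by auto
  then show "0 \<le> sep x a" using norm_cauchy_schwarz[of x a] assms by (simp add: sep_def)
qed

lemma set_sep_eq_0_iff:
  assumes "compact A" "A \<noteq> {}" "A \<subseteq> unit_sphere" "norm x = 1"
  shows "set_sep x A = 0 \<longleftrightarrow> x \<in> A"
proof
  assume "set_sep x A = 0"
  then obtain a where "a \<in> A" "sep x a = 0" using set_sep_attained[OF assms(1-3)] by metis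
  moreover have "norm a = 1" using \<open>a \<in> A\<close> assms by auto
  ultimately show "x \<in> A" using assms(4) by (simp add: sep_eq_norm)
next
  assume "x \<in> A"
  then have "set_sep x A \<le> sep x x" using assms by (intro set_sep_le)
  then have "set_sep x A \<le> 0" using assms(4) by (simp add: sep_eq_norm)
  then show "set_sep x A = 0" using set_sep_nonneg[of A x] assms by simp
qed

text \<open>\<open>x\<close> lies within angle \<open>\<delta>\<close> of both sets, so the triangle inequality for angles bounds their angular distance by \<open>2 \<delta>\<close>.\<close>

lemma dilations_disjoint:
  fixes A B :: "'a::euclidean_space set"
  assumes "compact A" "A \<noteq> {}" "A \<subseteq> unit_sphere" "compact B" "B \<noteq> {}" "B \<subseteq> unit_sphere"
    and delta: "0 < \<delta>" "\<delta> \<le> pi / 2" and ab: "\<forall>a\<in>A. \<forall>b\<in>B. a \<bullet> b \<le> cos (2 * \<delta>)"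
    and eps: "\<epsilon> < 1 - cos \<delta>"
  shows "dilation \<epsilon> A \<inter> dilation \<epsilon> B = {}"
proof (rule ccontr)
  assume "dilation \<epsilon> A \<inter> dilation \<epsilon> B \<noteq> {}"
  then obtain x where x: "norm x = 1" "set_sep x A \<le> \<epsilon>" "set_sep x B \<le> \<epsilon>"
    by (auto simp: dilation_def)
  obtain a where a: "a \<in> A" "set_sep x A = sep x a" using set_sep_attained[OF assms(1-3)] .
  obtain b where b: "b \<in> B" "set_sep x B = sep x b" using set_sep_attained[OF assms(4-6)] .
  have nab: "norm a = 1" "norm b = 1" using a b assms by auto
  define p where "p = x \<bullet> a"
  define q where "q = x \<bullet> b"
  have c0: "cos \<delta> \<ge> 0" using delta by (intro cos_ge_zero) auto
  have pq: "p > cos \<delta>" "q > cos \<delta>" using a b x eps by (simp_all add: p_def q_def sep_def)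
  have le1: "p \<le> 1" "q \<le> 1"
    using norm_cauchy_schwarz[of x a] norm_cauchy_schwarz[of x b] nab x by (simp_all add: p_def q_def)
  \<comment> \<open>The components orthogonal to \<open>x\<close> have the sines of the angles to
    \<open>x\<close> as lengths; the estimate then replays the addition formula for
    \<open>cos (2 * \<delta>)\<close>.\<close>
  define a' where "a' = a - p *\<^sub>R x"
  define b' where "b' = b - q *\<^sub>R x"
  have xx: "x \<bullet> x = 1" "a \<bullet> a = 1" "b \<bullet> b = 1" using x nab by (simp_all add: dot_square_norm)
  have n: "(norm a')\<^sup>2 = 1 - p\<^sup>2" "(norm b')\<^sup>2 = 1 - q\<^sup>2"
    unfolding a'_def b'_def power2_norm_eq_inner
    by (simp_all add: inner_diff_left inner_diff_right inner_commute xx p_def q_def power2_eq_square)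
  have s: "(sin \<delta>)\<^sup>2 = 1 - (cos \<delta>)\<^sup>2" by (simp add: sin_squared_eq)
  have sp: "sin \<delta> \<ge> 0" using delta by (intro sin_ge_zero) auto
  have "p\<^sup>2 > (cos \<delta>)\<^sup>2" "q\<^sup>2 > (cos \<delta>)\<^sup>2" using pq c0 by (auto intro!: power_strict_mono)
  then have "norm a' \<le> sin \<delta>" "norm b' \<le> sin \<delta>"
    by (auto intro!: power2_le_imp_le[OF _ sp] simp: n s)
  then have "norm a' * norm b' \<le> sin \<delta> * sin \<delta>" by (intro mult_mono) (use sp in auto)
  moreover have "a' \<bullet> b' \<ge> - (norm a' * norm b')"
    using Cauchy_Schwarz_ineq2[of a' b'] by (simp add: abs_le_iff)
  moreover have "a' \<bullet> b' = a \<bullet> b - p * q"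
    unfolding a'_def b'_def by (simp add: inner_diff_left inner_diff_right inner_commute xx p_def q_def)
  moreover have "p * q > cos \<delta> * cos \<delta>"
    using pq c0 by (intro mult_strict_mono') auto
  ultimately have "a \<bullet> b > cos \<delta> * cos \<delta> - sin \<delta> * sin \<delta>" by linarith
  then have "a \<bullet> b > cos (2 * \<delta>)" by (simp add: cos_double power2_eq_square)
  then show False using ab a(1) b(1) by (meson not_le)
qed


subsection \<open>Itineraries\<close>

text \<open>
  \<open>T i\<close> is the set of times spent in the region of obstacle \<open>i\<close>, \<open>f\<close> is the separation from the target
  and \<open>r i\<close> is the level below which the region has been passed.  The level that never increases is
  \<open>r i\<close> on \<open>T i\<close> and \<open>f\<close> elsewhere; comparing it at two times rules out a return to an abandoned region.
\<close>

locale itinerary =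
  fixes I :: "'i set" and T :: "'i \<Rightarrow> real set" and r :: "'i \<Rightarrow> real" and f :: "real \<Rightarrow> real"
  assumes finite: "finite I"
    and closed_T: "\<And>i. i \<in> I \<Longrightarrow> closed (T i)"
    and disjoint_T: "\<And>i j. i \<in> I \<Longrightarrow> j \<in> I \<Longrightarrow> i \<noteq> j \<Longrightarrow> T i \<inter> T j = {}"
    and T_nonneg: "\<And>i. i \<in> I \<Longrightarrow> T i \<subseteq> {0..}"
    and free_le: "\<And>s t. 0 \<le> s \<Longrightarrow> s < t \<Longrightarrow> {s<..<t} \<inter> (\<Union>i\<in>I. T i) = {} \<Longrightarrow> f t \<le> f s"
    and exit: "\<And>i s t. i \<in> I \<Longrightarrow> s \<in> T i \<Longrightarrow> s < t \<Longrightarrow> {s<..t} \<inter> (\<Union>i\<in>I. T i) = {} \<Longrightarrow> f t < r i"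
    and enter: "\<And>i s t. i \<in> I \<Longrightarrow> t \<in> T i \<Longrightarrow> 0 \<le> s \<Longrightarrow> s < t \<Longrightarrow> {s..<t} \<inter> (\<Union>i\<in>I. T i) = {} \<Longrightarrow> r i \<le> f t"
begin

definition "free t \<longleftrightarrow> (\<forall>i\<in>I. t \<notin> T i)"

text \<open>The monotone level is encoded as a bound \<open>c\<close>, so its jumps between
  \<open>r i\<close> and \<open>f\<close> need no one-sided limits. At times in \<open>T i\<close>
  only \<open>r i\<close> counts, whatever \<open>f\<close> does there.\<close>

definition "below c t \<longleftrightarrow> (\<forall>i\<in>I. t \<in> T i \<longrightarrow> r i \<le> c) \<and> (free t \<longrightarrow> f t \<le> c)"

lemma disjoint_free_iff: "S \<inter> (\<Union>i\<in>I. T i) = {} \<longleftrightarrow> (\<forall>t\<in>S. free t)"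
  by (auto simp: free_def)

lemma free_nbhd:
  assumes "free t"
  obtains d where "d > 0" "\<And>s. \<bar>s - t\<bar> < d \<Longrightarrow> free s"
proof -
  have "open (- (\<Union>i\<in>I. T i))" using finite closed_T by (intro open_Compl closed_UN) auto
  moreover have "t \<in> - (\<Union>i\<in>I. T i)" using assms by (auto simp: free_def)
  ultimately obtain d where "d > 0" "ball t d \<subseteq> - (\<Union>i\<in>I. T i)" by (meson open_contains_ball)
  then show thesis using that[of d] by (force simp: free_def dist_real_def subset_iff)
qed

lemma visit_nbhd:
  assumes "i \<in> I" "t \<in> T i"
  obtains d where "d > 0" "\<And>s. \<bar>s - t\<bar> < d \<Longrightarrow> s \<in> T i \<or> free s"
proof -
  have "open (- (\<Union>j\<in>I - {i}. T j))" using finite closed_T by (intro open_Compl closed_UN) auto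
  moreover have "t \<in> - (\<Union>j\<in>I - {i}. T j)" using assms disjoint_T by blast
  ultimately obtain d where "d > 0" "ball t d \<subseteq> - (\<Union>j\<in>I - {i}. T j)" by (meson open_contains_ball)
  then show thesis using that[of d] by (force simp: free_def dist_real_def subset_iff)
qed

lemma last_visit:
  assumes i: "i \<in> I" and s: "s \<in> T i" "s \<le> t"
  obtains u where "u \<in> T i" "s \<le> u" "u \<le> t" "\<And>v. u < v \<Longrightarrow> v \<le> t \<Longrightarrow> v \<notin> T i"
proof -
  have "compact (T i \<inter> {s..t})" using closed_T[OF i] by (intro closed_Int_compact) auto
  moreover have "T i \<inter> {s..t} \<noteq> {}" using s by auto
  ultimately obtain u where u: "u \<in> T i \<inter> {s..t}" and max: "\<And>v. v \<in> T i \<inter> {s..t} \<Longrightarrow> v \<le> u"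
    using compact_attains_sup[of "T i \<inter> {s..t}"] by blast
  have "v \<notin> T i" if "u < v" "v \<le> t" for v
    using max[of v] u that by auto
  then show thesis using that[of u] u by auto
qed

text \<open>Forward half of a real induction. Only a departure from the current region is delicate:
  \<open>exit\<close>, applied at the last visit before \<open>s\<close>, puts \<open>f s\<close>
  below \<open>r i\<close>.\<close>

lemma below_step:
  assumes t: "0 \<le> t" and b: "below c t"
  obtains d where "d > 0" "\<And>s. t \<le> s \<Longrightarrow> s < t + d \<Longrightarrow> below c s"
proof (cases "free t")
  case True
  then obtain d where d: "d > 0" "\<And>s. \<bar>s - t\<bar> < d \<Longrightarrow> free s" using free_nbhd by blast
  have "below c s" if "t \<le> s" "s < t + d" for s
  proof (cases "s = t")
    case False
    then have "f s \<le> f t" using that t d by (intro free_le) (auto simp: disjoint_free_iff)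
    then show ?thesis using b d(2)[of s] that True by (auto simp: below_def free_def)
  qed (use b in simp)
  then show ?thesis using that d(1) by blast
next
  case False
  then obtain i where i: "i \<in> I" "t \<in> T i" by (auto simp: free_def)
  then obtain d where d: "d > 0" "\<And>s. \<bar>s - t\<bar> < d \<Longrightarrow> s \<in> T i \<or> free s" using visit_nbhd by blast
  have ri: "r i \<le> c" using b i by (auto simp: below_def)
  have "below c s" if s: "t \<le> s" "s < t + d" for s
  proof (cases "s \<in> T i")
    case True
    then show ?thesis using i disjoint_T ri by (auto simp: below_def free_def)
  next
    case nT: False
    obtain u where u: "u \<in> T i" "t \<le> u" "u \<le> s" "\<And>v. u < v \<Longrightarrow> v \<le> s \<Longrightarrow> v \<notin> T i"
      using last_visit[OF i s(1)] by blast
    have "free v" if "u < v" "v \<le> s" for v using u that d(2)[of v] s by auto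
    moreover have "u < s" using u nT by (cases "u = s") auto
    ultimately have "f s < r i" using i(1) u(1) by (intro exit) (auto simp: disjoint_free_iff)
    then show ?thesis using ri nT d(2)[of s] s by (auto simp: below_def free_def)
  qed
  then show ?thesis using that d(1) by blast
qed

text \<open>Limit half of the induction. If region \<open>i\<close> is reached at \<open>t\<close>
  through free times only, \<open>enter\<close> gives \<open>r i \<le> f t\<close>, and
  \<open>free_le\<close> carries the bound from an earlier free time to \<open>f t\<close>;
  otherwise an earlier visit already bounds \<open>r i\<close>.\<close>

lemma below_limit:
  assumes a: "0 \<le> a" "a < t" and b: "\<And>s. a \<le> s \<Longrightarrow> s < t \<Longrightarrow> below c s"
  shows "below c t"
proof (cases "free t")
  case True
  then obtain d where d: "d > 0" "\<And>s. \<bar>s - t\<bar> < d \<Longrightarrow> free s" using free_nbhd by blast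
  define s where "s = max a (t - d / 2)"
  have s: "a \<le> s" "s < t" "t - d < s" using a d(1) by (auto simp: s_def)
  have "f t \<le> f s" using s a d(2) by (intro free_le) (auto simp: disjoint_free_iff)
  moreover have "f s \<le> c" using b[of s] s d(2)[of s] by (auto simp: below_def)
  ultimately show ?thesis using True by (auto simp: below_def free_def)
next
  case False
  then obtain i where i: "i \<in> I" "t \<in> T i" by (auto simp: free_def)
  then obtain d where d: "d > 0" "\<And>s. \<bar>s - t\<bar> < d \<Longrightarrow> s \<in> T i \<or> free s" using visit_nbhd by blast
  define s where "s = max a (t - d / 2)"
  have s: "a \<le> s" "s < t" "t - d < s" using a d(1) by (auto simp: s_def)
  have "r i \<le> c"
  proof (cases "\<exists>v\<in>{s..<t}. v \<in> T i")
    case True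
    then obtain v where "v \<in> T i" "s \<le> v" "v < t" by auto
    then show ?thesis using b[of v] s i(1) by (simp add: below_def)
  next
    case no: False
    then have fr: "\<forall>v\<in>{s..<t}. free v" using d(2) s by force
    have "f t \<le> f s" using s a fr by (intro free_le) (auto simp: disjoint_free_iff)
    moreover have "f s \<le> c" using b[of s] s fr by (auto simp: below_def)
    moreover have "r i \<le> f t" using s a fr i by (intro enter[of i t s]) (auto simp: disjoint_free_iff)
    ultimately show ?thesis by simp
  qed
  then show ?thesis using i disjoint_T by (auto simp: below_def free_def)
qed

text \<open>Real induction: at the infimum of the failing times the bound holds by
  \<open>below_limit\<close>, and \<open>below_step\<close> extends it past the infimum.\<close>

lemma below_mono:
  assumes a: "0 \<le> a" "below c a" and "a \<le> b"
  shows "below c b"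
proof (rule ccontr)
  assume nb: "\<not> below c b"
  define S where "S = {t. a \<le> t \<and> \<not> below c t}"
  have S: "b \<in> S" "bdd_below S" using nb assms by (auto simp: S_def intro!: bdd_belowI[of _ a])
  define t where "t = Inf S"
  have at: "a \<le> t" unfolding t_def using S by (intro cInf_greatest) (auto simp: S_def)
  have before: "below c s" if s: "a \<le> s" "s < t" for s
  proof (rule ccontr)
    assume "\<not> below c s"
    then have "s \<in> S" using s by (simp add: S_def)
    then have "t \<le> s" unfolding t_def using S(2) by (rule cInf_lower)
    then show False using s by simp
  qed
  have "below c t"
  proof (cases "a = t")
    case False
    then have "a < t" using at by simp
    from a(1) this before show ?thesis by (rule below_limit)
  qed (use a in simp)
  moreover have "0 \<le> t" using at a by simp
  ultimately obtain d where d: "d > 0" "\<And>s. t \<le> s \<Longrightarrow> s < t + d \<Longrightarrow> below c s"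
    using below_step[of t c] by blast
  have "\<exists>s\<in>S. s < t + d" using S d(1) by (subst cInf_less_iff[symmetric]) (auto simp: t_def)
  then show False using d(2) before by (force simp: S_def not_le)
qed

text \<open>Right after the last visit to \<open>i\<close> before \<open>t\<close> there is a free
  time \<open>w\<close> with \<open>f w < r i\<close>. The bound \<open>f w\<close> persists, but a
  later visit to \<open>i\<close> would need \<open>r i \<le> f w\<close>; the strictness of
  \<open>exit\<close> gives the contradiction.\<close>

lemma no_return:
  assumes "i \<in> I" "j \<in> I" "i \<noteq> j" and s: "s \<in> T i" and t: "t \<in> T j" and v: "v \<in> T i" and "s \<le> t" "t \<le> v"
  shows False
proof -
  obtain u where u: "u \<in> T i" "s \<le> u" "u \<le> t" "\<And>w. u < w \<Longrightarrow> w \<le> t \<Longrightarrow> w \<notin> T i"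
    using last_visit[OF \<open>i \<in> I\<close> s \<open>s \<le> t\<close>] by blast
  have "u \<noteq> t" using u(1) t assms(1-3) disjoint_T by blast
  then have ut: "u < t" using u by simp
  obtain d where d: "d > 0" "\<And>w. \<bar>w - u\<bar> < d \<Longrightarrow> w \<in> T i \<or> free w" using visit_nbhd[OF \<open>i \<in> I\<close> u(1)] by blast
  define w where "w = min t (u + d / 2)"
  have w: "u < w" "w \<le> t" "w < u + d" using ut d(1) by (auto simp: w_def)
  have fr: "free x" if "u < x" "x \<le> w" for x using d(2)[of x] u(4)[of x] that w by auto
  have "{u<..w} \<inter> (\<Union>i\<in>I. T i) = {}" unfolding disjoint_free_iff using fr by simp
  then have "f w < r i" by (rule exit[OF assms(1) u(1) w(1)])
  moreover have "below (f w) w" using fr[of w] w by (auto simp: below_def free_def)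
  moreover have "0 \<le> u" using u(1) T_nonneg[OF \<open>i \<in> I\<close>] by auto
  ultimately have "below (f w) v" using w \<open>t \<le> v\<close> below_mono[of w "f w" v] by simp
  then show False using \<open>f w < r i\<close> v \<open>i \<in> I\<close> by (auto simp: below_def)
qed

lemma eventually_single:
  assumes "I \<noteq> {}"
  obtains i t where "i \<in> I" "t \<ge> 0" "\<And>j s. j \<in> I \<Longrightarrow> j \<noteq> i \<Longrightarrow> t \<le> s \<Longrightarrow> s \<notin> T j"
proof -
  \<comment> \<open>Regions visited at arbitrarily late times; \<open>no_return\<close> leaves at
    most one. If there is none, any index serves, hence the hypothesis
    \<open>I \<noteq> {}\<close>.\<close>
  define B where "B = {j\<in>I. \<forall>t. \<exists>s\<ge>t. s \<in> T j}"
  have uniq: "i = j" if "i \<in> B" "j \<in> B" for i j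
  proof (rule ccontr)
    assume "i \<noteq> j"
    have B: "\<exists>s\<ge>t. s \<in> T k" if "k \<in> B" for k t using that by (simp add: B_def)
    obtain s where s: "s \<in> T i" using B[OF \<open>i \<in> B\<close>] by blast
    obtain t where t: "t \<ge> s" "t \<in> T j" using B[OF \<open>j \<in> B\<close>] by blast
    obtain v where "v \<ge> t" "v \<in> T i" using B[OF \<open>i \<in> B\<close>] by blast
    then show False using no_return[of i j s t v] s t \<open>i \<noteq> j\<close> that by (auto simp: B_def)
  qed
  have "B \<subseteq> I" by (auto simp: B_def)
  then obtain i where i: "i \<in> I" "B \<subseteq> {i}"
    using uniq assms by (cases "B = {}") blast+
  have "\<forall>j\<in>I - {i}. \<exists>t. \<forall>s\<ge>t. s \<notin> T j" using i by (auto simp: B_def)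
  then obtain \<tau> where \<tau>: "\<And>j s. j \<in> I - {i} \<Longrightarrow> \<tau> j \<le> s \<Longrightarrow> s \<notin> T j" by metis
  define t where "t = Max (insert 0 (\<tau> ` (I - {i})))"
  have "t \<ge> 0" "\<And>j. j \<in> I - {i} \<Longrightarrow> \<tau> j \<le> t" unfolding t_def using finite by (auto intro!: Max_ge)
  then show thesis using that[of i t] i \<tau> by (metis DiffI empty_iff insert_iff order_trans)
qed

end


subsection \<open>Homogeneous flows\<close>

lemma normalize_scale: "r > 0 \<Longrightarrow> (r *\<^sub>R z) /\<^sub>R norm (r *\<^sub>R z) = z /\<^sub>R norm z" for z :: "'a::real_normed_vector"
  by simp

locale conic_flow =
  fixes H :: "'a::euclidean_space \<Rightarrow> 'a" and L :: real and \<Phi> :: "'a \<Rightarrow> real \<Rightarrow> 'a"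
  assumes L_pos: "L > 0"
    and lip: "\<And>u v. norm (H u - H v) \<le> L * norm (u - v)"
    and homogeneous: "\<And>c z. c > 0 \<Longrightarrow> H (c *\<^sub>R z) = c *\<^sub>R H z"
    and flow_0: "\<And>z. \<Phi> z 0 = z"
    and flow_atLeast: "\<And>z t. t \<ge> 0 \<Longrightarrow> (\<Phi> z has_vector_derivative H (\<Phi> z t)) (at t within {0..})"
begin

lemma flow:
  assumes "0 \<le> a" "t \<in> {a..b}"
  shows "(\<Phi> z has_vector_derivative H (\<Phi> z t)) (at t within {a..b})"
  by (rule has_vector_derivative_within_subset[OF flow_atLeast]) (use assms in auto)

lemma H_0: "H 0 = 0"
  using homogeneous[of 2 0] by (simp add: scaleR_2)

lemma flow_unique:
  assumes "0 \<le> T" "\<And>t. t \<in> {0..T} \<Longrightarrow> (x has_vector_derivative H (x t)) (at t within {0..T})"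
  shows "x T = \<Phi> (x 0) T"
proof -
  have "norm (x T - \<Phi> (x 0) T) \<le> exp (L * T) * norm (x 0 - \<Phi> (x 0) 0)"
    by (rule lipschitz_ode_dist(1)[where H = H]) (use assms flow lip in auto)
  then show ?thesis by (simp add: flow_0)
qed

lemma flow_dist:
  assumes "0 \<le> T"
  shows "norm (\<Phi> y T - \<Phi> z T) \<le> exp (L * T) * norm (y - z)"
    and "norm (y - z) \<le> exp (L * T) * norm (\<Phi> y T - \<Phi> z T)"
  using lipschitz_ode_dist[OF assms flow flow lip, of y z] assms by (simp_all add: flow_0)

lemma flow_zero: "0 \<le> T \<Longrightarrow> \<Phi> 0 T = 0"
  using flow_unique[of T "\<lambda>_. 0"] by (simp add: H_0)

lemma flow_nonzero: "0 \<le> T \<Longrightarrow> z \<noteq> 0 \<Longrightarrow> \<Phi> z T \<noteq> 0"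
  using flow_dist(2)[of T z 0] by (auto simp: flow_zero)

lemma flow_scale:
  assumes "0 \<le> T" "c > 0"
  shows "\<Phi> (c *\<^sub>R z) T = c *\<^sub>R \<Phi> z T"
proof -
  have "c *\<^sub>R \<Phi> z T = \<Phi> (c *\<^sub>R \<Phi> z 0) T"
  proof (rule flow_unique[OF assms(1)])
    fix t assume t: "t \<in> {0..T}"
    show "((\<lambda>t. c *\<^sub>R \<Phi> z t) has_vector_derivative H (c *\<^sub>R \<Phi> z t)) (at t within {0..T})"
      unfolding homogeneous[OF assms(2)]
      by (rule bounded_linear.has_vector_derivative[OF bounded_linear_scaleR_right flow]) (use t in auto)
  qed
  then show ?thesis by (simp add: flow_0)
qed

lemma flow_continuous: "0 \<le> T \<Longrightarrow> continuous_on S (\<lambda>z. \<Phi> z T)"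
  by (rule lipschitz_on_continuous_on[of "exp (L * T)"])
    (use flow_dist(1) in \<open>simp add: lipschitz_on_def dist_norm\<close>)

text \<open>The second estimate of \<open>flow_dist\<close> makes the inverse of the
  time-\<open>T\<close> map Lipschitz on its range, and a Lipschitz map into a space of the same
  dimension preserves negligible sets.\<close>

lemma negligible_flow_preimage:
  assumes T: "0 \<le> T" and V: "dim V < DIM('a)"
  shows "negligible {z. \<Phi> z T \<in> V}"
proof -
  define \<psi> where "\<psi> = inv (\<lambda>z. \<Phi> z T)"
  have "inj (\<lambda>z. \<Phi> z T)"
  proof (rule injI)
    fix y z assume "\<Phi> y T = \<Phi> z T"
    then show "y = z" using flow_dist(2)[OF T, of y z] by simp
  qed
  then have \<psi>: "\<psi> (\<Phi> z T) = z" for z unfolding \<psi>_def by (rule inv_f_f)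
  \<comment> \<open>The restriction to the range matters: elsewhere \<open>inv\<close> has arbitrary
    values and no Lipschitz bound.\<close>
  define S where "S = V \<inter> range (\<lambda>z. \<Phi> z T)"
  have "negligible S"
    by (rule negligible_subset[OF negligible_lowdim[OF V]]) (auto simp: S_def)
  moreover have "norm (\<psi> y - \<psi> z) \<le> exp (L * T) * norm (y - z)" if "y \<in> S" "z \<in> S" for y z
    using that flow_dist(2)[OF T] by (auto simp: S_def \<psi>)
  ultimately have "negligible (\<psi> ` S)"
    by (intro negligible_locally_Lipschitz_image) (auto intro!: exI[of _ UNIV] exI[of _ "exp (L * T)"])
  moreover have "{z. \<Phi> z T \<in> V} \<subseteq> \<psi> ` S"
  proof
    fix z assume "z \<in> {z. \<Phi> z T \<in> V}"
    then have "\<Phi> z T \<in> S" by (auto simp: S_def)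
    then show "z \<in> \<psi> ` S" using \<psi>[of z] by (metis imageI)
  qed
  ultimately show ?thesis by (rule negligible_subset)
qed

text \<open>By homogeneity the cone over the set lies in the preimage of \<open>V\<close> under the
  flow of the whole space, so volume decides surface measure.\<close>

lemma null_set_flow_preimage:
  assumes T: "0 \<le> T" and V: "subspace V" "dim V < DIM('a)"
  shows "{x \<in> unit_sphere. \<Phi> x T \<in> V} \<in> null_sets sphere_measure"
proof -
  define A where "A = {x \<in> unit_sphere. \<Phi> x T \<in> V}"
  have "closed A"
    unfolding A_def using closed_subspace[OF V(1)] flow_continuous[OF T]
    by (intro continuous_closed_preimage[unfolded vimage_def Int_def mem_Collect_eq]) auto
  then have A: "A \<in> sets borel" "A \<subseteq> unit_sphere" by (auto simp: A_def)
  have "{x \<in> cball 0 1 - {0}. x /\<^sub>R norm x \<in> A} \<subseteq> {z. \<Phi> z T \<in> V}"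
  proof clarsimp
    fix x assume "x \<noteq> 0" "x /\<^sub>R norm x \<in> A"
    then have "inverse (norm x) *\<^sub>R \<Phi> x T \<in> V" using flow_scale[OF T, of "inverse (norm x)" x] by (simp add: A_def)
    then have "norm x *\<^sub>R (inverse (norm x) *\<^sub>R \<Phi> x T) \<in> V" by (rule subspace_scale[OF V(1)])
    then show "\<Phi> x T \<in> V" using \<open>x \<noteq> 0\<close> by simp
  qed
  then have "negligible {x \<in> cball 0 1 - {0}. x /\<^sub>R norm x \<in> A}"
    by (rule negligible_subset[OF negligible_flow_preimage[OF T V(2)]])
  then have null: "{x \<in> cball 0 1 - {0}. x /\<^sub>R norm x \<in> A} \<in> null_sets lebesgue"
    by (simp add: negligible_iff_null_sets)
  have "{x \<in> cball 0 1 - {0}. x /\<^sub>R norm x \<in> A} \<in> sets borel"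
  proof -
    have "(\<lambda>x::'a. x /\<^sub>R norm x) -` A \<inter> space borel \<in> sets borel"
      by (rule measurable_sets[OF _ A(1)]) simp
    then have "(cball 0 1 - {0}) \<inter> ((\<lambda>x::'a. x /\<^sub>R norm x) -` A \<inter> space borel) \<in> sets borel"
      by (intro sets.Int) auto
    moreover have "(cball 0 1 - {0}) \<inter> ((\<lambda>x::'a. x /\<^sub>R norm x) -` A \<inter> space borel)
        = {x \<in> cball 0 1 - {0}. x /\<^sub>R norm x \<in> A}" by auto
    ultimately show ?thesis by simp
  qed
  \<comment> \<open>\<open>negligible\<close> speaks of the completed measure; Borel measurability
    brings the null set back to \<open>lborel\<close>, on which \<open>sphere_measure\<close> is
    built.\<close>
  then have "{x \<in> cball 0 1 - {0}. x /\<^sub>R norm x \<in> A} \<in> null_sets lborel"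
    using null by (simp add: null_sets_completion_iff)
  then have "emeasure sphere_measure A = 0"
    unfolding emeasure_sphere_measure[OF A] by (simp add: null_setsD1)
  then show ?thesis
    unfolding A_def[symmetric] using A by (intro null_setsI) (simp_all add: sets_restrict_space_iff)
qed

end


subsection \<open>Convergence past a single obstacle\<close>

text \<open>\<open>c\<close> stands for \<open>1 / \<kappa>\<close> and \<eta> for the cut-off.
  \<open>near\<close> and \<open>target\<close> quantify over unnormalised \<open>z\<close> because
  \<open>X\<close> is compared with the segment from \<open>xd\<close> to \<open>- g\<close> after
  division by \<open>P + Q\<close>, and with \<open>xd\<close> after division by \<open>P\<close>;
  neither scaling changes \<open>pos\<close>.\<close>

lemma single_obstacle_convergence:
  fixes X :: "real \<Rightarrow> 'a::euclidean_space" and \<eta> :: "'a \<Rightarrow> real"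
  defines "pos \<equiv> \<lambda>t. X t /\<^sub>R norm (X t)"
  assumes xd: "norm xd = 1" and g: "norm g = 1" and k: "k > 0" and c: "c > 0"
    and X: "\<And>t. t \<ge> a \<Longrightarrow> (X has_vector_derivative
          norm (X t) *\<^sub>R (k *\<^sub>R (\<eta> (pos t) *\<^sub>R xd - (c * (1 - \<eta> (pos t))) *\<^sub>R g))) (at t within {a..})"
    and nz: "\<And>t. t \<ge> a \<Longrightarrow> X t \<noteq> 0"
    and \<eta>: "\<And>x. norm x = 1 \<Longrightarrow> 0 \<le> \<eta> x \<and> \<eta> x \<le> 1" "continuous_on (sphere 0 1) \<eta>"
    and \<eta>0: "\<eta>0 > 0" and \<rho>1: "\<rho>1 > 0"
    and near: "\<And>l z. l \<in> {0..1} \<Longrightarrow> norm (z - ((1 - l) *\<^sub>R xd - l *\<^sub>R g)) < \<rho>1 \<Longrightarrow> \<eta>0 \<le> \<eta> (z /\<^sub>R norm z)"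
    and target: "\<And>z. norm (z - xd) < \<rho> \<Longrightarrow> \<eta> (z /\<^sub>R norm z) = 1"
    and small: "c / \<eta>0 < \<rho>"
    and generic: "X a \<notin> span {xd, g}"
  shows "(pos \<longlongrightarrow> xd) at_top"
proof -
  have contX: "continuous_on {a..} X" by (rule continuous_on_vector_derivative[OF X]) auto
  have contpos: "continuous_on {a..} pos"
    unfolding pos_def by (intro continuous_intros contX) (use nz in auto)
  have npos: "norm (pos t) = 1" if "t \<ge> a" for t using nz[OF that] by (simp add: pos_def)
  have cont\<eta>: "continuous_on {a..} (\<lambda>t. \<eta> (pos t))"
    by (rule continuous_on_compose2[OF \<eta>(2) contpos]) (use npos in auto)
  have \<eta>01: "0 \<le> \<eta> (pos t)" "\<eta> (pos t) \<le> 1" if "t \<ge> a" for t using \<eta>(1)[OF npos[OF that]] by auto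
  define p where "p t = k * norm (X t) * \<eta> (pos t)" for t
  define q where "q t = k * norm (X t) * (c * (1 - \<eta> (pos t)))" for t
  define P where "P t = integral {a..t} p" for t
  define Q where "Q t = integral {a..t} q" for t
  have "continuous_on {a..} p" "continuous_on {a..} q"
    unfolding p_def q_def by (intro continuous_intros contX cont\<eta>)+
  then have dP: "(P has_vector_derivative p t) (at t within {a..})"
    and dQ: "(Q has_vector_derivative q t) (at t within {a..})" if "t \<ge> a" for t
    unfolding P_def Q_def using that by (auto intro: integral_has_vector_derivative_atLeast)
  have p0: "p t \<ge> 0" and q0: "q t \<ge> 0" if "t \<ge> a" for t
    using \<eta>01[OF that] k c by (auto simp: p_def q_def)
  have mono: "f s \<le> f t" if "a \<le> s" "s \<le> t" "\<And>u. u \<ge> s \<Longrightarrow> (f has_vector_derivative f' u) (at u within {a..})"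
      "\<And>u. u \<ge> s \<Longrightarrow> f' u \<ge> 0" for f f' :: "real \<Rightarrow> real" and s t
  proof (rule nonneg_derivative_imp_le[OF that(2), where f' = f'])
    fix u assume u: "u \<in> {s..t}"
    then have "(f has_vector_derivative f' u) (at u within {s..t})"
      by (intro has_vector_derivative_within_subset[OF that(3)]) (use that(1) in auto)
    then show "(f has_real_derivative f' u) (at u within {s..t})"
      by (simp add: has_real_derivative_iff_has_vector_derivative)
    show "f' u \<ge> 0" using that(4) u by auto
  qed
  have PQa: "P a = 0" "Q a = 0" by (simp_all add: P_def Q_def)
  have P0: "P t \<ge> 0" if "t \<ge> a" for t using mono[of a t P p] dP p0 PQa that by simp
  have Q0: "Q t \<ge> 0" if "t \<ge> a" for t using mono[of a t Q q] dQ q0 PQa that by simp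
  have repr: "X t = X a + P t *\<^sub>R xd - Q t *\<^sub>R g" if t: "t \<ge> a" for t
  proof -
    have "((\<lambda>t. X t - (P t *\<^sub>R xd - Q t *\<^sub>R g)) has_vector_derivative 0) (at u within {a..})" if "u \<in> {a..}" for u
    proof -
      have u: "u \<ge> a" using that by simp
      have 1: "((\<lambda>t. P t *\<^sub>R xd - Q t *\<^sub>R g) has_vector_derivative (p u *\<^sub>R xd - q u *\<^sub>R g)) (at u within {a..})"
        by (intro has_vector_derivative_diff bounded_linear.has_vector_derivative[OF bounded_linear_scaleR_left]
            dP dQ u)
      show ?thesis
        using has_vector_derivative_diff[OF X[OF u] 1]
        by (simp add: p_def q_def algebra_simps)
    qed
    from has_vector_derivative_zero_constant[OF _ this]
    obtain C where C: "\<And>u. u \<in> {a..} \<Longrightarrow> X u - (P u *\<^sub>R xd - Q u *\<^sub>R g) = C" by (metis convex_real_interval(1))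
    from C[of a] C[of t] t PQa show ?thesis by (simp add: algebra_simps)
  qed
  \<comment> \<open>The displacement from \<open>X a\<close> stays in the plane, so the distance of
    \<open>X a\<close> to the plane bounds the norm from below at all times.\<close>
  define y where "y = infdist (X a) (span {xd, g})"
  have y: "y > 0" unfolding y_def using generic
    by (intro infdist_pos_not_in_closed closed_span) (auto intro: span_zero)
  have Xy: "norm (X t) \<ge> y" if "t \<ge> a" for t
  proof -
    have "Q t *\<^sub>R g - P t *\<^sub>R xd \<in> span {xd, g}" by (intro span_diff span_scale span_base) auto
    then have "y \<le> dist (X a) (Q t *\<^sub>R g - P t *\<^sub>R xd)" unfolding y_def by (rule infdist_le)
    also have "\<dots> = norm (X t)" unfolding repr[OF that] dist_norm by (simp add: algebra_simps)
    finally show ?thesis .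
  qed
  define s where "s t = P t + Q t" for t
  \<comment> \<open>The weights \<eta> and \<open>1 - \<eta>\<close> add up to 1, so
    \<open>p + q / c\<close> equals \<open>k * norm (X u)\<close>, which is at least
    \<open>k * y\<close>.\<close>
  have grow: "k * y * (t - a) \<le> (1 + 1 / c) * s t" if t: "t \<ge> a" for t
  proof -
    have "P a + Q a / c - k * y * (a - a) \<le> P t + Q t / c - k * y * (t - a)"
    proof (rule mono[OF _ t, where f' = "\<lambda>u. p u + q u / c - k * y"])
      fix u assume u: "a \<le> u"
      show "((\<lambda>t. P t + Q t / c - k * y * (t - a)) has_vector_derivative p u + q u / c - k * y) (at u within {a..})"
        using dP[OF u] dQ[OF u] c unfolding has_real_derivative_iff_has_vector_derivative[symmetric]
        by (auto intro!: derivative_eq_intros)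
      have "p u + q u / c = k * norm (X u)" using c by (simp add: p_def q_def field_simps)
      then show "p u + q u / c - k * y \<ge> 0" using Xy[OF u] k by simp
    qed simp
    then have "k * y * (t - a) \<le> P t + Q t / c" using PQa by simp
    also have "\<dots> \<le> (1 + 1 / c) * s t"
      using P0[OF t] Q0[OF t] c by (simp add: s_def field_simps)
    finally show ?thesis .
  qed
  have s_lim: "filterlim s at_top at_top"
  proof (rule filterlim_at_top_mono)
    show "filterlim (\<lambda>t. k * y / (1 + 1 / c) * (- a + t)) at_top at_top"
      using k y c
      by (intro filterlim_tendsto_pos_mult_at_top[OF tendsto_const] filterlim_tendsto_add_at_top[OF tendsto_const] filterlim_ident)
        (auto intro!: divide_pos_pos add_pos_pos)
    show "\<forall>\<^sub>F t in at_top. k * y / (1 + 1 / c) * (- a + t) \<le> s t"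
      using eventually_ge_at_top[of a]
    proof eventually_elim
      case (elim t)
      have "1 + 1 / c > 0" using c by (simp add: add_pos_pos)
      then show ?case using grow[OF elim] by (simp add: divide_simps mult.commute)
    qed
  qed
  obtain T1 where T1: "T1 \<ge> a" "\<And>t. t \<ge> T1 \<Longrightarrow> s t > norm (X a) / \<rho>1"
  proof -
    obtain T where T: "\<And>t. t \<ge> T \<Longrightarrow> s t > norm (X a) / \<rho>1"
      using filterlim_at_top_dense[THEN iffD1, OF s_lim] unfolding eventually_at_top_linorder by blast
    show thesis by (rule that[of "max a T"]) (use T in auto)
  qed
  have \<eta>_ge: "\<eta>0 \<le> \<eta> (pos t)" if t: "t \<ge> T1" for t
  proof -
    have ta: "t \<ge> a" using t T1 by simp
    have "norm (X a) / \<rho>1 \<ge> 0" using \<rho>1 by simp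
    then have s: "s t > 0" using T1(2)[OF t] by linarith
    have "X t /\<^sub>R s t - ((1 - Q t / s t) *\<^sub>R xd - (Q t / s t) *\<^sub>R g) = X a /\<^sub>R s t"
    proof -
      have e: "1 - Q t / s t = P t / s t" using s by (simp add: s_def field_simps)
      show ?thesis unfolding repr[OF ta] e by (simp add: algebra_simps divide_inverse)
    qed
    moreover have "norm (X a /\<^sub>R s t) < \<rho>1" using T1(2)[OF t] s \<rho>1 by (simp add: field_simps)
    ultimately have "\<eta>0 \<le> \<eta> ((X t /\<^sub>R s t) /\<^sub>R norm (X t /\<^sub>R s t))"
      using P0[OF ta] Q0[OF ta] s by (intro near[of "Q t / s t"]) (simp_all add: s_def)
    then show ?thesis using normalize_scale[of "inverse (s t)" "X t"] s by (simp only: pos_def positive_imp_inverse_positive)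
  qed
  \<comment> \<open>Compares integrands: \<open>q\<close> is at most
    \<open>k * norm (X u) * c\<close>, while \<open>p\<close> is at least
    \<open>k * norm (X u) * \<eta>0\<close>.\<close>
  have Q_le: "Q t \<le> Q T1 + c / \<eta>0 * P t" if t: "t \<ge> T1" for t
  proof -
    have "c / \<eta>0 * P T1 - Q T1 \<le> c / \<eta>0 * P t - Q t"
    proof (rule mono[OF T1(1) t, where f' = "\<lambda>u. c / \<eta>0 * p u - q u"])
      fix u assume u: "T1 \<le> u"
      then have ua: "u \<ge> a" using T1 by simp
      show "((\<lambda>t. c / \<eta>0 * P t - Q t) has_vector_derivative c / \<eta>0 * p u - q u) (at u within {a..})"
        using dP[OF ua] dQ[OF ua] \<eta>0 unfolding has_real_derivative_iff_has_vector_derivative[symmetric]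
        by (auto intro!: derivative_eq_intros)
      have "q u \<le> k * norm (X u) * c"
        unfolding q_def using \<eta>01[OF ua] k c by (intro mult_left_mono) (auto simp: mult_le_cancel_left1)
      also have "\<dots> = c / \<eta>0 * (k * norm (X u) * \<eta>0)" using \<eta>0 by simp
      also have "\<dots> \<le> c / \<eta>0 * p u"
        unfolding p_def using \<eta>_ge[OF u] k c \<eta>0 by (intro mult_left_mono) auto
      finally show "c / \<eta>0 * p u - q u \<ge> 0" by simp
    qed
    moreover have "c / \<eta>0 * P T1 \<ge> 0" using P0[OF T1(1)] c \<eta>0 by simp
    ultimately show ?thesis by linarith
  qed
  have P_lim: "filterlim P at_top at_top"
  proof (rule filterlim_at_top_mono)
    show "filterlim (\<lambda>t. 1 / (1 + c / \<eta>0) * (- Q T1 + s t)) at_top at_top"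
      using c \<eta>0
      by (intro filterlim_tendsto_pos_mult_at_top[OF tendsto_const] filterlim_tendsto_add_at_top[OF tendsto_const] s_lim)
        (auto intro!: divide_pos_pos add_pos_pos)
    show "\<forall>\<^sub>F t in at_top. 1 / (1 + c / \<eta>0) * (- Q T1 + s t) \<le> P t"
      using eventually_ge_at_top[of T1]
    proof eventually_elim
      case (elim t)
      have "1 + c / \<eta>0 > 0" using c \<eta>0 by (simp add: add_pos_pos)
      moreover have "- Q T1 + s t \<le> (1 + c / \<eta>0) * P t" using Q_le[OF elim] by (simp add: s_def algebra_simps)
      ultimately show ?case by (simp add: divide_simps mult.commute)
    qed
  qed
  have over_P: "((\<lambda>t. C / P t) \<longlongrightarrow> 0) at_top" for C
    by (rule real_tendsto_divide_at_top[OF tendsto_const P_lim])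
  \<comment> \<open>The margin \<open>\<rho> - c / \<eta>0\<close> is what \<open>small\<close>
    leaves for the contributions of \<open>X a\<close> and \<open>Q T1\<close>.\<close>
  have "\<forall>\<^sub>F t in at_top. (norm (X a) + Q T1) / P t < \<rho> - c / \<eta>0"
    using over_P by (rule order_tendstoD) (use small in simp)
  moreover have "\<forall>\<^sub>F t in at_top. P t > 0"
    using P_lim by (simp add: filterlim_at_top_dense)
  ultimately have "\<forall>\<^sub>F t in at_top. \<eta> (pos t) = 1"
    using eventually_ge_at_top[of T1]
  proof eventually_elim
    case (elim t)
    have ta: "t \<ge> a" using elim T1 by simp
    have "X t /\<^sub>R P t - xd = (X a - Q t *\<^sub>R g) /\<^sub>R P t"
      unfolding repr[OF ta] using elim by (simp add: algebra_simps)
    also have "norm \<dots> = norm (X a - Q t *\<^sub>R g) / P t"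
      unfolding norm_scaleR using elim by (simp add: divide_inverse mult.commute)
    also have "\<dots> \<le> (norm (X a) + Q t) / P t"
      using elim norm_triangle_ineq4[of "X a" "Q t *\<^sub>R g"] g Q0[OF ta] by (intro divide_right_mono) auto
    also have "\<dots> \<le> (norm (X a) + Q T1 + c / \<eta>0 * P t) / P t"
      using elim Q_le[of t] by (intro divide_right_mono) auto
    also have "\<dots> = (norm (X a) + Q T1) / P t + c / \<eta>0" using elim by (simp add: add_divide_distrib)
    also have "\<dots> < \<rho>" using elim by simp
    finally have "\<eta> ((X t /\<^sub>R P t) /\<^sub>R norm (X t /\<^sub>R P t)) = 1" by (rule target)
    then show ?case using normalize_scale[of "inverse (P t)" "X t"] elim by (simp only: pos_def positive_imp_inverse_positive)
  qed
  then obtain T2 where T2: "\<And>t. t \<ge> T2 \<Longrightarrow> \<eta> (pos t) = 1" unfolding eventually_at_top_linorder by blast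
  \<comment> \<open>From \<open>b\<close> on the cut-off is 1, so \<open>q\<close> vanishes,
    \<open>Q\<close> is frozen and only the multiple of \<open>xd\<close> grows.\<close>
  define b where "b = max a T2"
  have Qb: "Q t = Q b" if t: "t \<ge> b" for t
  proof -
    have q_zero: "q u = 0" if "u \<ge> b" for u using T2[of u] that by (simp add: q_def b_def)
    have ab: "a \<le> b" by (simp add: b_def)
    have dQ0: "(Q has_vector_derivative 0) (at u within {a..})" if "u \<ge> b" for u
      using dQ[of u] q_zero[OF that] that ab by simp
    have "Q b \<le> Q t" by (rule mono[OF ab t dQ0]) auto
    moreover have "- Q b \<le> - Q t"
      by (rule mono[OF ab t has_vector_derivative_minus[OF dQ0]]) auto
    ultimately show ?thesis by simp
  qed
  have "((\<lambda>t. xd + (1 / P t) *\<^sub>R (X a - Q b *\<^sub>R g)) \<longlongrightarrow> xd + 0 *\<^sub>R (X a - Q b *\<^sub>R g)) at_top"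
    by (intro tendsto_intros over_P)
  then have Z: "((\<lambda>t. xd + (1 / P t) *\<^sub>R (X a - Q b *\<^sub>R g)) \<longlongrightarrow> xd) at_top" by simp
  have "((\<lambda>t. (xd + (1 / P t) *\<^sub>R (X a - Q b *\<^sub>R g)) /\<^sub>R norm (xd + (1 / P t) *\<^sub>R (X a - Q b *\<^sub>R g)))
      \<longlongrightarrow> xd /\<^sub>R norm xd) at_top"
    by (intro tendsto_scaleR tendsto_inverse tendsto_norm Z) (use xd in auto)
  then have "((\<lambda>t. (xd + (1 / P t) *\<^sub>R (X a - Q b *\<^sub>R g)) /\<^sub>R norm (xd + (1 / P t) *\<^sub>R (X a - Q b *\<^sub>R g)))
      \<longlongrightarrow> xd) at_top"
    using xd by simp
  moreover have "\<forall>\<^sub>F t in at_top. (xd + (1 / P t) *\<^sub>R (X a - Q b *\<^sub>R g)) /\<^sub>R norm (xd + (1 / P t) *\<^sub>R (X a - Q b *\<^sub>R g)) = pos t"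
    using \<open>\<forall>\<^sub>F t in at_top. P t > 0\<close> eventually_ge_at_top[of b]
  proof eventually_elim
    case (elim t)
    have "t \<ge> a" using elim by (simp add: b_def)
    then have "xd + (1 / P t) *\<^sub>R (X a - Q b *\<^sub>R g) = X t /\<^sub>R P t"
      unfolding repr[OF \<open>t \<ge> a\<close>] Qb[OF elim(2)] using elim by (simp add: algebra_simps divide_inverse)
    then show ?case using normalize_scale[of "inverse (P t)" "X t"] elim by (simp only: pos_def positive_imp_inverse_positive)
  qed
  ultimately show ?thesis by (rule Lim_transform_eventually)
qed


subsection \<open>Motion in the cone and on the sphere\<close>

text \<open>\<open>B\<close> pays for the change of norm and \<open>2 * L\<close> for the change of
  direction, since \<open>norm v * norm (x - y)\<close> is at most \<open>2 * norm (u - v)\<close>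
  for the directions \<open>x\<close>, \<open>y\<close> of \<open>u\<close>,
  \<open>v\<close>.\<close>

lemma conic_extension_lipschitz:
  fixes F :: "'a::euclidean_space \<Rightarrow> 'a"
  assumes B: "\<And>x. norm x = 1 \<Longrightarrow> norm (F x) \<le> B"
    and lip: "\<And>x y. norm x = 1 \<Longrightarrow> norm y = 1 \<Longrightarrow> norm (F x - F y) \<le> L * norm (x - y)"
    and nonneg: "0 \<le> B" "0 \<le> L"
  shows "norm (norm u *\<^sub>R F (u /\<^sub>R norm u) - norm v *\<^sub>R F (v /\<^sub>R norm v)) \<le> (B + 2 * L) * norm (u - v)"
proof -
  have one: "norm (norm u *\<^sub>R F (u /\<^sub>R norm u)) \<le> (B + 2 * L) * norm u" for u
  proof (cases "u = 0")
    case False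
    then have "norm u * norm (F (u /\<^sub>R norm u)) \<le> norm u * (B + 2 * L)"
      using B[of "u /\<^sub>R norm u"] nonneg by (intro mult_left_mono) auto
    then show ?thesis by (simp add: mult.commute)
  qed simp
  show ?thesis
  proof (cases "u = 0 \<or> v = 0")
    case True
    then show ?thesis using one[of u] one[of v] by auto
  next
    case False
    then have nz: "u \<noteq> 0" "v \<noteq> 0" by auto
    define x where "x = u /\<^sub>R norm u"
    define y where "y = v /\<^sub>R norm v"
    have n: "norm x = 1" "norm y = 1" using nz by (simp_all add: x_def y_def)
    have d: "\<bar>norm u - norm v\<bar> \<le> norm (u - v)" by (rule norm_triangle_ineq3)
    have "norm v *\<^sub>R (x - y) = (norm v - norm u) *\<^sub>R x + (u - v)"
      using nz by (simp add: x_def y_def algebra_simps)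
    then have "norm v * norm (x - y) = norm ((norm v - norm u) *\<^sub>R x + (u - v))"
      by (metis abs_norm_cancel norm_scaleR)
    also have "\<dots> \<le> \<bar>norm v - norm u\<bar> * norm x + norm (u - v)"
      by (metis norm_scaleR norm_triangle_ineq)
    also have "\<dots> \<le> 2 * norm (u - v)" using d n by simp
    finally have xy: "norm v * norm (x - y) \<le> 2 * norm (u - v)" .
    have "norm u *\<^sub>R F x - norm v *\<^sub>R F y = (norm u - norm v) *\<^sub>R F x + norm v *\<^sub>R (F x - F y)"
      by (simp add: algebra_simps)
    then have "norm (norm u *\<^sub>R F x - norm v *\<^sub>R F y) \<le> \<bar>norm u - norm v\<bar> * norm (F x) + norm v * norm (F x - F y)"
      by (metis abs_norm_cancel norm_scaleR norm_triangle_ineq)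
    also have "\<dots> \<le> norm (u - v) * B + norm v * (L * norm (x - y))"
      using d B[OF n(1)] lip[OF n] by (intro add_mono mult_mono) auto
    also have "\<dots> \<le> norm (u - v) * B + L * (2 * norm (u - v))"
      using mult_left_mono[OF xy nonneg(2)] by (simp add: mult_ac)
    finally show ?thesis by (simp add: x_def y_def algebra_simps)
  qed
qed

text \<open>The added multiple is the integral of \<open>w\<close>. Derivatives are required at
  interior times only, because the law may switch at an endpoint.\<close>

lemma directed_motion:
  fixes X :: "real \<Rightarrow> 'a::euclidean_space"
  assumes ab: "a < b" and X: "continuous_on {a..b} X"
    and der: "\<And>t. a < t \<Longrightarrow> t < b \<Longrightarrow> (X has_vector_derivative w t *\<^sub>R v) (at t)"
    and w: "continuous_on {a..b} w" "\<And>t. t \<in> {a..b} \<Longrightarrow> w t > 0"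
  obtains \<beta> where "\<beta> > 0" "X b = X a + \<beta> *\<^sub>R v"
proof
  have ne: "{a..b} \<noteq> {}" using ab by simp
  obtain t0 where t0: "t0 \<in> {a..b}" "\<And>t. t \<in> {a..b} \<Longrightarrow> w t0 \<le> w t"
    using continuous_attains_inf[OF compact_Icc ne w(1)] by blast
  have iw: "w integrable_on {a..b}" using w(1) by (rule integrable_continuous_real)
  have "((\<lambda>t. w t0) has_integral (b - a) *\<^sub>R w t0) {a..b}"
    using has_integral_const_real[of "w t0" a b] ab by simp
  from has_integral_le[OF this integrable_integral[OF iw] t0(2)]
  have "(b - a) * w t0 \<le> integral {a..b} w" by simp
  moreover have "(b - a) * w t0 > 0" using ab w(2)[OF t0(1)] by simp
  ultimately show "integral {a..b} w > 0" by simp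
  have "((\<lambda>t. w t *\<^sub>R v) has_integral (X b - X a)) {a..b}"
    using ab X der by (intro fundamental_theorem_of_calculus_interior) auto
  moreover have "((\<lambda>t. w t *\<^sub>R v) has_integral (integral {a..b} w *\<^sub>R v)) {a..b}"
    using iw by (intro has_integral_scaleR_left integrable_integral)
  ultimately have "X b - X a = integral {a..b} w *\<^sub>R v" by (rule has_integral_unique)
  then show "X b = X a + integral {a..b} w *\<^sub>R v" by (simp add: algebra_simps)
qed

lemma closed_sphere_minus_interior: "closed (sphere 0 1 - sphere_interior A)"
proof -
  have "openin (top_of_set (sphere 0 1)) (sphere_interior A)"
    unfolding sphere_interior_def by (rule openin_interior_of)
  then obtain T where T: "open T" "sphere_interior A = sphere 0 1 \<inter> T" by (auto simp: openin_open)
  then have "sphere 0 1 - sphere_interior A = sphere 0 1 \<inter> - T" by auto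
  then show ?thesis using T(1) by (auto intro!: closed_Int)
qed

text \<open>The times outside the interior form a compact set with maximum \<open>s\<close>. The
  values just after \<open>s\<close> lie in the closed set \<open>A\<close>, so \<open>y s\<close>
  is a boundary point.\<close>

lemma last_time_outside_interior:
  fixes y :: "real \<Rightarrow> 'a::euclidean_space"
  assumes A: "closed A" and y: "continuous_on {0..b} y" "\<And>t. t \<in> {0..b} \<Longrightarrow> norm (y t) = 1"
    and ends: "0 \<le> b" "y 0 \<notin> sphere_interior A" "y b \<in> sphere_interior A"
  obtains s where "0 \<le> s" "s < b" "y s \<in> A" "y s \<notin> sphere_interior A"
    "\<And>t. s < t \<Longrightarrow> t \<le> b \<Longrightarrow> y t \<in> sphere_interior A"
proof -
  define S where "S = {0..b} \<inter> y -` (sphere 0 1 - sphere_interior A)"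
  have "closed S" unfolding S_def
    by (rule continuous_closed_preimage[OF y(1) closed_atLeastAtMost closed_sphere_minus_interior])
  then have "compact S" unfolding compact_eq_bounded_closed by (simp add: S_def bounded_Int)
  moreover have "0 \<in> S" using ends y(2)[of 0] by (simp add: S_def)
  ultimately obtain s where s: "s \<in> S" "\<And>t. t \<in> S \<Longrightarrow> t \<le> s"
    using compact_attains_sup[of S] by blast
  have s0: "0 \<le> s" "s \<le> b" "y s \<notin> sphere_interior A" using s(1) by (auto simp: S_def)
  have inside: "y t \<in> sphere_interior A" if "s < t" "t \<le> b" for t
    using s(2)[of t] s0 that y(2)[of t] by (force simp: S_def)
  have sb: "s < b" using s0 ends(3) by (cases "s = b") auto
  have "y s \<in> A"
  proof (rule Lim_in_closed_set[OF A])
    show "(y \<longlongrightarrow> y s) (at s within {s..b})"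
    proof -
      have "continuous_on {s..b} y" by (rule continuous_on_subset[OF y(1)]) (use s0 in auto)
      then show ?thesis using sb by (simp add: continuous_on_def)
    qed
    show "\<forall>\<^sub>F t in at s within {s..b}. y t \<in> A"
      unfolding eventually_at_filter
      using inside sphere_interior_subset by (intro always_eventually) fastforce
    show "at s within {s..b} \<noteq> bot" using sb by (simp add: at_within_Icc_at_right)
  qed
  then show thesis using that[of s] s0 sb inside by blast
qed


subsection \<open>Shadows\<close>

lemma mem_shadow_iff:
  assumes "norm y = 1" "- y \<notin> dilation \<epsilon> A"
  shows "x \<in> shadow \<epsilon> A y \<longleftrightarrow> norm x = 1 \<and> (\<exists>z\<in>dilation \<epsilon> A. \<exists>\<alpha>\<ge>0. \<exists>\<beta>\<ge>0. x = \<alpha> *\<^sub>R z + \<beta> *\<^sub>R y)"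
proof -
  have "x \<in> geodesic z y \<longleftrightarrow> norm x = 1 \<and> (\<exists>\<alpha>\<ge>0. \<exists>\<beta>\<ge>0. x = \<alpha> *\<^sub>R z + \<beta> *\<^sub>R y)"
    if "z \<in> dilation \<epsilon> A" for z
    using that assms by (intro mem_geodesic_iff) (auto simp: dilation_def)
  then show ?thesis unfolding shadow_def by blast
qed

lemma compact_dilation:
  assumes "A \<noteq> {}" "A \<subseteq> unit_sphere"
  shows "compact (dilation p A)"
proof -
  have "dilation p A = sphere 0 1 \<inter> (\<lambda>x. set_sep x A) -` {..p}" by (auto simp: dilation_def)
  also have "compact \<dots>"
    unfolding compact_eq_bounded_closed
    using continuous_closed_preimage[OF continuous_on_set_sep[OF assms], of "sphere 0 1" "{..p}"]
    by (auto simp: bounded_Int)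
  finally show ?thesis .
qed

text \<open>The shadow is the image of a compact product under normalised chords; these avoid the
  origin because \<open>- y\<close> is not in the dilation.\<close>

lemma closed_shadow:
  assumes A: "A \<noteq> {}" "A \<subseteq> unit_sphere" and y: "norm y = 1" "- y \<notin> dilation \<epsilon> A"
  shows "closed (shadow \<epsilon> A y)"
proof -
  define h where "h = (\<lambda>(z, l::real). (1 - l) *\<^sub>R z + l *\<^sub>R y)"
  define D where "D = dilation \<epsilon> A \<times> {0..1::real}"
  have nz: "h (z, l) \<noteq> 0" if "(z, l) \<in> D" for z l
  proof
    assume "h (z, l) = 0"
    then have e: "(1 - l) *\<^sub>R z = - (l *\<^sub>R y)" by (simp add: h_def add_eq_0_iff2)
    have z: "norm z = 1" "0 \<le> l" "l \<le> 1" "z \<noteq> - y" using that y by (auto simp: D_def dilation_def)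
    have "norm ((1 - l) *\<^sub>R z) = norm (l *\<^sub>R y)" using e by simp
    then have l: "1 - l = l" "l \<noteq> 0" using z y by auto
    have "l *\<^sub>R z = l *\<^sub>R (- y)" using e unfolding l(1) by simp
    then show False using l(2) z(4) by (metis scaleR_cancel_left)
  qed
  have "compact D" unfolding D_def using compact_dilation[OF A] by (intro compact_Times) auto
  moreover have "continuous_on D (\<lambda>p. h p /\<^sub>R norm (h p))"
    unfolding h_def case_prod_beta using nz
    by (intro continuous_intros) (auto simp: h_def)
  ultimately have "compact ((\<lambda>p. h p /\<^sub>R norm (h p)) ` D)" by (rule compact_continuous_image[rotated])
  moreover have "(\<lambda>p. h p /\<^sub>R norm (h p)) ` D = shadow \<epsilon> A y"
  proof (intro set_eqI iffI)
    fix x assume "x \<in> (\<lambda>p. h p /\<^sub>R norm (h p)) ` D"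
    then obtain z l where zl: "(z, l) \<in> D" "x = h (z, l) /\<^sub>R norm (h (z, l))" by auto
    have "norm x = 1" using nz[OF zl(1)] zl(2) by simp
    moreover have "x = ((1 - l) / norm (h (z, l))) *\<^sub>R z + (l / norm (h (z, l))) *\<^sub>R y"
      unfolding zl(2) by (subst h_def) (simp add: scaleR_add_right divide_inverse mult.commute)
    moreover have "(1 - l) / norm (h (z, l)) \<ge> 0" "l / norm (h (z, l)) \<ge> 0" using zl(1) by (auto simp: D_def)
    moreover have "z \<in> dilation \<epsilon> A" using zl(1) by (simp add: D_def)
    ultimately show "x \<in> shadow \<epsilon> A y" unfolding mem_shadow_iff[OF y] by blast
  next
    fix x assume "x \<in> shadow \<epsilon> A y"
    then obtain z \<alpha> \<beta> where x: "norm x = 1" "z \<in> dilation \<epsilon> A" "\<alpha> \<ge> 0" "\<beta> \<ge> 0" "x = \<alpha> *\<^sub>R z + \<beta> *\<^sub>R y"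
      unfolding mem_shadow_iff[OF y] by auto
    have "\<alpha> \<noteq> 0 \<or> \<beta> \<noteq> 0" using x by auto
    then have s: "\<alpha> + \<beta> > 0" using x by linarith
    define l where "l = \<beta> / (\<alpha> + \<beta>)"
    have l: "(z, l) \<in> D" using x s by (simp add: D_def l_def)
    have e: "1 - l = \<alpha> / (\<alpha> + \<beta>)" using s by (simp add: l_def field_simps)
    have "h (z, l) = inverse (\<alpha> + \<beta>) *\<^sub>R x"
      unfolding h_def case_prod_conv e x(5) by (simp add: l_def scaleR_add_right divide_inverse mult.commute)
    then have "h (z, l) /\<^sub>R norm (h (z, l)) = x"
      using normalize_scale[of "inverse (\<alpha> + \<beta>)" x] s x(1) by (simp only: positive_imp_inverse_positive) simp
    then show "x \<in> (\<lambda>p. h p /\<^sub>R norm (h p)) ` D" using l by force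
  qed
  ultimately show ?thesis by (simp add: compact_imp_closed)
qed


subsection \<open>Uniform bounds for one obstacle\<close>

lemma open_normalized_set_sep:
  fixes A :: "'a::euclidean_space set"
  assumes "A \<noteq> {}" "A \<subseteq> unit_sphere"
  shows "open {z. z \<noteq> 0 \<and> q < set_sep (z /\<^sub>R norm z) A}"
proof -
  have "continuous_on (- {0}) (\<lambda>z. set_sep (z /\<^sub>R norm z) A)"
    by (rule continuous_on_compose2[OF continuous_on_set_sep[OF assms, of UNIV]])
      (auto intro!: continuous_intros)
  then have "open (- {0} \<inter> (\<lambda>z. set_sep (z /\<^sub>R norm z) A) -` {q<..})"
    by (intro continuous_open_preimage) auto
  moreover have "- {0} \<inter> (\<lambda>z. set_sep (z /\<^sub>R norm z) A) -` {q<..} = {z. z \<noteq> 0 \<and> q < set_sep (z /\<^sub>R norm z) A}"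
    by auto
  ultimately show ?thesis by simp
qed

text \<open>
  The arc from \<open>xd\<close> to \<open>- g\<close> misses \<open>A\<close>: a point \<open>a \<in> A\<close> on it would put \<open>xd\<close> on the geodesic from
  \<open>g\<close> to \<open>a\<close>, hence into \<open>A\<close>.
\<close>

lemma obstacle_bounds:
  fixes A :: "'a::euclidean_space set"
  assumes A: "compact A" "A \<subseteq> unit_sphere" and g: "g \<in> star_centers A"
    and xd: "norm xd = 1" "\<epsilon> < set_sep xd A" and \<epsilon>: "\<epsilon> > 0"
  shows "\<exists>\<eta>0>0. \<exists>\<rho>1>0. \<exists>\<rho>>0.
    (\<forall>l\<in>{0..1}. \<forall>z. norm (z - ((1 - l) *\<^sub>R xd - l *\<^sub>R g)) < \<rho>1 \<longrightarrow> \<eta>0 \<le> min 1 (set_sep (z /\<^sub>R norm z) A / \<epsilon>)) \<and>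
    (\<forall>z. norm (z - xd) < \<rho> \<longrightarrow> min 1 (set_sep (z /\<^sub>R norm z) A / \<epsilon>) = 1)"
proof -
  have gA: "g \<in> A" "- g \<notin> A" "\<And>a. a \<in> A \<Longrightarrow> geodesic g a \<subseteq> A" using g by (auto simp: star_centers_def)
  have ne: "A \<noteq> {}" and ng: "norm g = 1" using gA A by auto
  have xdA: "xd \<notin> A" using set_sep_eq_0_iff[OF A(1) ne A(2) xd(1)] xd \<epsilon> by auto
  \<comment> \<open>The chord from \<open>xd\<close> to \<open>- g\<close> stands in for the arc; by
    compactness the positive separation of its normalised points survives a small
    thickening.\<close>
  define w where "w l = (1 - l) *\<^sub>R xd - l *\<^sub>R g" for l :: real
  have wnz: "w l \<noteq> 0" if "l \<in> {0..1}" for l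
  proof
    assume "w l = 0"
    then have e: "(1 - l) *\<^sub>R xd = l *\<^sub>R g" by (simp add: w_def)
    have "norm ((1 - l) *\<^sub>R xd) = norm (l *\<^sub>R g)" using e by simp
    then have l: "1 - l = l" "l \<noteq> 0" using that xd ng by auto
    have "xd = g" using e l(2) unfolding l(1) by simp
    then show False using xdA gA by simp
  qed
  have miss: "w l /\<^sub>R norm (w l) \<notin> A" if l: "l \<in> {0..1}" for l
  proof
    define a where "a = w l /\<^sub>R norm (w l)"
    assume "w l /\<^sub>R norm (w l) \<in> A"
    then have a: "a \<in> A" by (simp add: a_def)
    then have na: "norm a = 1" and ga: "g \<noteq> - a" using A gA by auto
    have wa: "norm (w l) *\<^sub>R a = (1 - l) *\<^sub>R xd - l *\<^sub>R g" using wnz[OF l] by (simp add: a_def w_def)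
    show False
    proof (cases "l = 1")
      case True
      then have "a = - g" using ng by (simp add: a_def w_def)
      then show False using a gA by simp
    next
      case False
      then have l1: "1 - l > 0" using l by simp
      have "(1 - l) *\<^sub>R xd = l *\<^sub>R g + norm (w l) *\<^sub>R a" using wa by simp
      then have "inverse (1 - l) *\<^sub>R ((1 - l) *\<^sub>R xd) = (inverse (1 - l) * l) *\<^sub>R g + (inverse (1 - l) * norm (w l)) *\<^sub>R a"
        by (simp only: scaleR_add_right scaleR_scaleR)
      then have "xd = (inverse (1 - l) * l) *\<^sub>R g + (inverse (1 - l) * norm (w l)) *\<^sub>R a" using l1 by simp
      moreover have "inverse (1 - l) * l \<ge> 0" "inverse (1 - l) * norm (w l) \<ge> 0" using l l1 by simp_all
      ultimately have "xd \<in> geodesic g a"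
        unfolding mem_geodesic_iff[OF ng na ga] using xd(1) by blast
      then show False using gA(3)[OF a] xdA by blast
    qed
  qed
  define K where "K = w ` {0..1}"
  have cw: "continuous_on {0..1} w" unfolding w_def by (intro continuous_intros)
  then have K: "compact K" unfolding K_def by (intro compact_continuous_image) auto
  have "continuous_on {0..1} (\<lambda>l. set_sep (w l /\<^sub>R norm (w l)) A)"
    by (rule continuous_on_compose2[OF continuous_on_set_sep[OF ne A(2), of UNIV]])
      (use wnz in \<open>auto intro!: continuous_intros cw\<close>)
  then obtain l0 where l0: "l0 \<in> {0..1}"
      "\<And>l. l \<in> {0..1} \<Longrightarrow> set_sep (w l0 /\<^sub>R norm (w l0)) A \<le> set_sep (w l /\<^sub>R norm (w l)) A"
    using continuous_attains_inf[of "{0..1::real}" "\<lambda>l. set_sep (w l /\<^sub>R norm (w l)) A"] by auto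
  define d where "d = set_sep (w l0 /\<^sub>R norm (w l0)) A"
  have nw: "norm (w l0 /\<^sub>R norm (w l0)) = 1" using wnz[OF l0(1)] by simp
  have "d \<noteq> 0" unfolding d_def using set_sep_eq_0_iff[OF A(1) ne A(2) nw] miss[OF l0(1)] by simp
  moreover have "d \<ge> 0" unfolding d_def using set_sep_nonneg[OF ne A(2)] nw by simp
  ultimately have d: "d > 0" by simp
  have "K \<subseteq> {z. z \<noteq> 0 \<and> d / 2 < set_sep (z /\<^sub>R norm z) A}"
  proof
    fix z assume "z \<in> K"
    then obtain l where l: "l \<in> {0..1}" "z = w l" by (auto simp: K_def)
    show "z \<in> {z. z \<noteq> 0 \<and> d / 2 < set_sep (z /\<^sub>R norm z) A}"
      using l0(2)[OF l(1)] wnz[OF l(1)] d l(2) by (simp add: d_def)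
  qed
  then obtain \<rho>1 where \<rho>1: "\<rho>1 > 0" "(\<Union>x\<in>K. ball x \<rho>1) \<subseteq> {z. z \<noteq> 0 \<and> d / 2 < set_sep (z /\<^sub>R norm z) A}"
    by (rule compact_subset_open_imp_ball_epsilon_subset[OF K open_normalized_set_sep[OF ne A(2)]])
  \<comment> \<open>Half of the least separation along the arc, rescaled by \<epsilon> and capped at
    1 like the cut-off itself.\<close>
  define \<eta>0 where "\<eta>0 = min 1 (d / 2 / \<epsilon>)"
  have near: "\<eta>0 \<le> min 1 (set_sep (z /\<^sub>R norm z) A / \<epsilon>)"
    if "l \<in> {0..1}" "norm (z - w l) < \<rho>1" for l z
  proof -
    have "z \<in> ball (w l) \<rho>1" using that by (simp add: dist_norm norm_minus_commute)
    moreover have "w l \<in> K" using that(1) by (auto simp: K_def)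
    ultimately have "z \<in> {z. z \<noteq> 0 \<and> d / 2 < set_sep (z /\<^sub>R norm z) A}" using \<rho>1(2) by blast
    then have "d / 2 < set_sep (z /\<^sub>R norm z) A" by simp
    then have "d / 2 / \<epsilon> \<le> set_sep (z /\<^sub>R norm z) A / \<epsilon>" using \<epsilon> by (intro divide_right_mono) auto
    then show ?thesis unfolding \<eta>0_def by (intro min.mono) auto
  qed
  have "xd \<in> {z. z \<noteq> 0 \<and> \<epsilon> < set_sep (z /\<^sub>R norm z) A}" using xd by auto
  then obtain \<rho> where \<rho>: "\<rho> > 0" "ball xd \<rho> \<subseteq> {z. z \<noteq> 0 \<and> \<epsilon> < set_sep (z /\<^sub>R norm z) A}"
    using open_normalized_set_sep[OF ne A(2), of \<epsilon>] unfolding open_contains_ball by blast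
  have target: "min 1 (set_sep (z /\<^sub>R norm z) A / \<epsilon>) = 1" if "norm (z - xd) < \<rho>" for z
  proof -
    have "z \<in> ball xd \<rho>" using that by (simp add: dist_norm norm_minus_commute)
    then have "\<epsilon> < set_sep (z /\<^sub>R norm z) A" using \<rho>(2) by auto
    then show ?thesis using \<epsilon> by simp
  qed
  have "\<eta>0 > 0" using d \<epsilon> by (simp add: \<eta>0_def)
  then show ?thesis using \<rho>1(1) \<rho>(1) near target unfolding w_def by blast
qed


subsection \<open>The closed loop\<close>

text \<open>The hypotheses in the form in which they are consumed, for one fixed \<kappa>:
  \<open>A1\<close> and the choice of \<epsilon> appear as disjointness of the dilations.\<close>

locale star_navigation =
  fixes U :: "nat \<Rightarrow> 'a::euclidean_space set" and g :: "nat \<Rightarrow> 'a" and xd :: 'a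
    and m :: nat and k1 \<epsilon> \<kappa> :: real
  assumes compact_U: "\<And>i. i \<in> {1..m} \<Longrightarrow> compact (U i)"
    and U_sphere: "\<And>i. i \<in> {1..m} \<Longrightarrow> U i \<subseteq> unit_sphere"
    and g_center: "\<And>i. i \<in> {1..m} \<Longrightarrow> g i \<in> star_centers (U i)"
    and dilations: "\<And>i j. i \<in> {1..m} \<Longrightarrow> j \<in> {1..m} \<Longrightarrow> i \<noteq> j \<Longrightarrow> dilation \<epsilon> (U i) \<inter> dilation \<epsilon> (U j) = {}"
    and regions: "\<And>i j. i \<in> {1..m} \<Longrightarrow> j \<in> {1..m} \<Longrightarrow> i \<noteq> j \<Longrightarrow> region xd \<epsilon> (U i) \<inter> region xd \<epsilon> (U j) = {}"
    and xd_free: "xd \<in> free_set 0 (\<Union>i\<in>{1..m}. U i)"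
    and xd_far: "\<And>i. i \<in> {1..m} \<Longrightarrow> \<epsilon> < set_sep xd (U i)"
    and pos: "k1 > 0" "\<epsilon> > 0" "\<kappa> > 0"
begin

abbreviation "I \<equiv> {1..m}"
abbreviation "M \<equiv> free_set 0 (\<Union>i\<in>I. U i)"
abbreviation "u \<equiv> control m U xd g k1 \<kappa> \<epsilon>"

definition "\<eta> i x = min 1 (set_sep x (U i) / \<epsilon>)"

text \<open>The dilations being disjoint, at most one summand is nonzero at a point of the sphere.
  On \<open>U i\<close> the value stays at that of the collar law for separation 0 instead of
  jumping in the interior, which makes \<open>F\<close> Lipschitz.\<close>

definition "F x = k1 *\<^sub>R (xd - (\<Sum>i\<in>I. (1 - \<eta> i x) *\<^sub>R (xd + (1 / \<kappa>) *\<^sub>R g i)))"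

definition "H z = norm z *\<^sub>R F (z /\<^sub>R norm z)"

lemma norm_xd: "norm xd = 1"
  using xd_free by (auto simp: free_set_def)

lemma g_U: "i \<in> I \<Longrightarrow> g i \<in> U i"
  using g_center[of i] by (auto simp: star_centers_def)

lemma norm_g: "i \<in> I \<Longrightarrow> norm (g i) = 1"
  using g_U U_sphere by fastforce

lemma U_ne: "i \<in> I \<Longrightarrow> U i \<noteq> {}"
  using g_U by blast

lemma U_dilation: "i \<in> I \<Longrightarrow> U i \<subseteq> dilation \<epsilon> (U i)"
  using set_sep_eq_0_iff[OF compact_U U_ne U_sphere] U_sphere pos by (fastforce simp: dilation_def)

lemma U_disjoint: "i \<in> I \<Longrightarrow> j \<in> I \<Longrightarrow> i \<noteq> j \<Longrightarrow> U i \<inter> U j = {}"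
  using U_dilation dilations by blast

text \<open>Interior commutes with this union because the sets are closed and disjoint: near a point
  of \<open>U i\<close> the other sets are absent.\<close>

lemma M_iff: "x \<in> M \<longleftrightarrow> norm x = 1 \<and> (\<forall>i\<in>I. x \<notin> sphere_interior (U i))"
proof -
  have sep: "0 \<le> set_sep x (\<Union>i\<in>I. U i)" if "norm x = 1"
  proof (cases "I = {}")
    case True
    \<comment> \<open>Without obstacles \<open>set_sep\<close> is the infimum of the empty set, a
      value independent of the point; its sign is read off from \<open>xd_free\<close>.\<close>
    have "set_sep x ({} :: 'a set) = set_sep xd {}" by (simp add: set_sep_def)
    then show ?thesis using xd_free True by (simp add: free_set_def)
  next
    case False
    then have "(\<Union>i\<in>I. U i) \<noteq> {}" using U_ne by auto
    moreover have "(\<Union>i\<in>I. U i) \<subseteq> unit_sphere" using U_sphere by (intro UN_least)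
    ultimately show ?thesis by (rule set_sep_nonneg) (use that in simp)
  qed
  have int: "x \<in> sphere_interior (\<Union>i\<in>I. U i) \<longleftrightarrow> (\<exists>i\<in>I. x \<in> sphere_interior (U i))"
  proof
    assume "\<exists>i\<in>I. x \<in> sphere_interior (U i)"
    then obtain i where "i \<in> I" "x \<in> sphere_interior (U i)" by blast
    moreover from this have "sphere_interior (U i) \<subseteq> sphere_interior (\<Union>i\<in>I. U i)"
      unfolding sphere_interior_def by (intro interior_of_mono) blast
    ultimately show "x \<in> sphere_interior (\<Union>i\<in>I. U i)" by blast
  next
    assume x: "x \<in> sphere_interior (\<Union>i\<in>I. U i)"
    then obtain i where i: "i \<in> I" "x \<in> U i" using sphere_interior_subset by blast
    obtain e where e: "norm x = 1" "e > 0" "\<And>y. norm y = 1 \<Longrightarrow> dist y x < e \<Longrightarrow> y \<in> (\<Union>i\<in>I. U i)"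
      using x unfolding sphere_interior_iff by blast
    have "open (- (\<Union>j\<in>I - {i}. U j))"
      using compact_U by (intro open_Compl closed_UN ballI compact_imp_closed) auto
    moreover have "x \<in> - (\<Union>j\<in>I - {i}. U j)" using i U_disjoint by blast
    ultimately obtain d where d: "d > 0" "ball x d \<subseteq> - (\<Union>j\<in>I - {i}. U j)"
      unfolding open_contains_ball by blast
    have "y \<in> U i" if "norm y = 1" "dist y x < min d e" for y
    proof -
      have "y \<in> ball x d" using that by (simp add: dist_commute)
      then have "y \<notin> (\<Union>j\<in>I - {i}. U j)" using d(2) by blast
      then show ?thesis using e(3)[of y] that by auto
    qed
    then have "x \<in> sphere_interior (U i)"
      unfolding sphere_interior_iff using e(1,2) d(1) by (intro conjI exI[of _ "min d e"]) auto
    then show "\<exists>i\<in>I. x \<in> sphere_interior (U i)" using i(1) by blast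
  qed
  show ?thesis unfolding free_set_def mem_Collect_eq Diff_iff int using sep by auto
qed

lemma \<eta>_bounds: "i \<in> I \<Longrightarrow> norm x = 1 \<Longrightarrow> 0 \<le> \<eta> i x \<and> \<eta> i x \<le> 1"
  using set_sep_nonneg[OF U_ne U_sphere, of i x] pos by (simp add: \<eta>_def)

lemma \<eta>_lipschitz:
  assumes "i \<in> I"
  shows "\<bar>\<eta> i x - \<eta> i y\<bar> \<le> norm (x - y) / \<epsilon>"
proof -
  have "\<bar>\<eta> i x - \<eta> i y\<bar> \<le> \<bar>set_sep x (U i) / \<epsilon> - set_sep y (U i) / \<epsilon>\<bar>"
    by (simp add: \<eta>_def min_def)
  also have "\<dots> = \<bar>set_sep x (U i) - set_sep y (U i)\<bar> / \<epsilon>" using pos by (simp flip: diff_divide_distrib)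
  also have "\<dots> \<le> norm (x - y) / \<epsilon>"
    using set_sep_lipschitz[OF U_ne U_sphere] assms pos by (intro divide_right_mono) auto
  finally show ?thesis .
qed

lemma \<eta>_eq_1: "i \<in> I \<Longrightarrow> norm x = 1 \<Longrightarrow> x \<notin> dilation \<epsilon> (U i) \<Longrightarrow> \<eta> i x = 1"
  using pos by (simp add: \<eta>_def dilation_def)

lemma \<eta>_eq_0: "i \<in> I \<Longrightarrow> x \<in> U i \<Longrightarrow> \<eta> i x = 0"
  using set_sep_eq_0_iff[OF compact_U U_ne U_sphere, of i x] U_sphere[of i] by (auto simp: \<eta>_def)

lemma \<eta>_other: "i \<in> I \<Longrightarrow> j \<in> I \<Longrightarrow> j \<noteq> i \<Longrightarrow> x \<in> dilation \<epsilon> (U i) \<Longrightarrow> \<eta> j x = 1"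
  by (rule \<eta>_eq_1) (use dilations[of i j] in \<open>auto simp: dilation_def\<close>)

lemma F_single:
  assumes i: "i \<in> I" and other: "\<And>j. j \<in> I \<Longrightarrow> j \<noteq> i \<Longrightarrow> \<eta> j x = 1"
  shows "F x = k1 *\<^sub>R (\<eta> i x *\<^sub>R xd - (1 / \<kappa> * (1 - \<eta> i x)) *\<^sub>R g i)"
proof -
  have "(\<Sum>j\<in>I. (1 - \<eta> j x) *\<^sub>R (xd + (1 / \<kappa>) *\<^sub>R g j)) = (\<Sum>j\<in>{i}. (1 - \<eta> j x) *\<^sub>R (xd + (1 / \<kappa>) *\<^sub>R g j))"
    using i other by (intro sum.mono_neutral_right) auto
  then have "F x = k1 *\<^sub>R (xd - (1 - \<eta> i x) *\<^sub>R (xd + (1 / \<kappa>) *\<^sub>R g i))" by (simp add: F_def)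
  then show ?thesis by (simp add: algebra_simps)
qed

lemma F_free: "(\<And>j. j \<in> I \<Longrightarrow> \<eta> j x = 1) \<Longrightarrow> F x = k1 *\<^sub>R xd"
  by (simp add: F_def)

lemma control_eq_F:
  assumes "x \<in> M"
  shows "u x = F x"
proof -
  have x: "norm x = 1" "\<And>i. i \<in> I \<Longrightarrow> x \<notin> sphere_interior (U i)" using assms M_iff by auto
  show ?thesis
  proof (cases "\<exists>i\<in>I. x \<in> collar \<epsilon> (U i)")
    case True
    then obtain i where i: "i \<in> I" "x \<in> collar \<epsilon> (U i)" by blast
    then have xi: "x \<in> dilation \<epsilon> (U i)" by (simp add: collar_def)
    have "(THE i. i \<in> I \<and> x \<in> collar \<epsilon> (U i)) = i"
    proof (rule the_equality)
      fix j assume "j \<in> I \<and> x \<in> collar \<epsilon> (U j)"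
      then show "j = i" using dilations[of i j] xi i(1) by (auto simp: collar_def)
    qed (use i in simp)
    then have "u x = k1 *\<^sub>R local_control xd \<kappa> \<epsilon> (U i) (g i) x"
      using True by (simp add: control_def)
    moreover have "\<eta> i x = set_sep x (U i) / \<epsilon>"
      using xi pos by (simp add: \<eta>_def dilation_def)
    ultimately show ?thesis
      using F_single[OF i(1) \<eta>_other[OF i(1) _ _ xi]] by (simp add: local_control_def)
  next
    case False
    then have "x \<notin> dilation \<epsilon> (U i)" if "i \<in> I" for i using x(2) that by (auto simp: collar_def)
    then show ?thesis using False F_free[of x] \<eta>_eq_1 x(1) by (simp add: control_def)
  qed
qed

text \<open>The interior of \<open>U i\<close> meets no collar, so the law takes its default branch,
  whereas \<open>F\<close> is \<open>- (k1 / \<kappa>) *\<^sub>R g i\<close> there. Uniqueness for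
  \<open>F\<close> thus says nothing about a curve entering the interior.\<close>

lemma control_interior:
  assumes i: "i \<in> I" and x: "x \<in> sphere_interior (U i)"
  shows "u x = k1 *\<^sub>R xd"
proof -
  have xi: "x \<in> dilation \<epsilon> (U i)" using x sphere_interior_subset U_dilation[OF i] by blast
  have "x \<notin> collar \<epsilon> (U j)" if "j \<in> I" for j
    using that dilations[OF i that] x xi by (cases "j = i") (auto simp: collar_def)
  then show ?thesis by (auto simp: control_def)
qed

lemma H_lipschitz: "\<exists>L>0. \<forall>v w. norm (H v - H w) \<le> L * norm (v - w)"
proof -
  define c where "c i = norm (xd + (1 / \<kappa>) *\<^sub>R g i)" for i
  define B where "B = k1 * (1 + (\<Sum>i\<in>I. c i))"
  define L where "L = k1 * (\<Sum>i\<in>I. c i / \<epsilon>)"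
  have BL: "B > 0" "L \<ge> 0"
    unfolding B_def L_def using pos
    by (auto intro!: mult_pos_pos mult_nonneg_nonneg sum_nonneg add_pos_nonneg simp: c_def)
  have "norm (F x) \<le> B" if x: "norm x = 1" for x
  proof -
    have "norm (\<Sum>i\<in>I. (1 - \<eta> i x) *\<^sub>R (xd + (1 / \<kappa>) *\<^sub>R g i)) \<le> (\<Sum>i\<in>I. c i)"
      using \<eta>_bounds[OF _ x] by (intro sum_norm_le) (auto simp: c_def intro!: mult_left_le_one_le)
    then have "norm (xd - (\<Sum>i\<in>I. (1 - \<eta> i x) *\<^sub>R (xd + (1 / \<kappa>) *\<^sub>R g i))) \<le> 1 + (\<Sum>i\<in>I. c i)"
      using norm_triangle_ineq4[of xd "\<Sum>i\<in>I. (1 - \<eta> i x) *\<^sub>R (xd + (1 / \<kappa>) *\<^sub>R g i)"] norm_xd by linarith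
    then show ?thesis using pos by (simp add: F_def B_def)
  qed
  moreover have "norm (F x - F y) \<le> L * norm (x - y)" for x y
  proof -
    have "F x - F y = k1 *\<^sub>R (\<Sum>i\<in>I. (\<eta> i x - \<eta> i y) *\<^sub>R (xd + (1 / \<kappa>) *\<^sub>R g i))"
      unfolding F_def
      by (simp add: sum_subtractf scaleR_left_diff_distrib scaleR_right_diff_distrib)
    moreover have "norm (\<Sum>i\<in>I. (\<eta> i x - \<eta> i y) *\<^sub>R (xd + (1 / \<kappa>) *\<^sub>R g i)) \<le> (\<Sum>i\<in>I. c i / \<epsilon> * norm (x - y))"
    proof (rule sum_norm_le)
      fix i assume i: "i \<in> I"
      have "\<bar>\<eta> i x - \<eta> i y\<bar> * c i \<le> norm (x - y) / \<epsilon> * c i"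
        by (rule mult_right_mono[OF \<eta>_lipschitz[OF i]]) (simp add: c_def)
      then show "norm ((\<eta> i x - \<eta> i y) *\<^sub>R (xd + (1 / \<kappa>) *\<^sub>R g i)) \<le> c i / \<epsilon> * norm (x - y)"
        by (simp add: c_def mult.commute)
    qed
    ultimately show ?thesis using pos by (simp add: L_def sum_distrib_right mult.assoc)
  qed
  ultimately have "norm (H v - H w) \<le> (B + 2 * L) * norm (v - w)" for v w
    unfolding H_def using BL by (intro conic_extension_lipschitz) auto
  moreover have "B + 2 * L > 0" using BL by simp
  ultimately show ?thesis by blast
qed

definition "L = (SOME L. L > 0 \<and> (\<forall>v w. norm (H v - H w) \<le> L * norm (v - w)))"

lemma L: "L > 0" "norm (H v - H w) \<le> L * norm (v - w)"
  using someI_ex[OF H_lipschitz] unfolding L_def by blast+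

definition "\<Phi> z = (SOME x. x 0 = z \<and> (\<forall>t\<ge>0. (x has_vector_derivative H (x t)) (at t within {0..})))"

lemma \<Phi>: "\<Phi> z 0 = z" "t \<ge> 0 \<Longrightarrow> (\<Phi> z has_vector_derivative H (\<Phi> z t)) (at t within {0..})"
proof -
  have "H 0 = 0" by (simp add: H_def)
  from someI_ex[OF lipschitz_ode_exists[OF L this, of z]]
  show "\<Phi> z 0 = z" "t \<ge> 0 \<Longrightarrow> (\<Phi> z has_vector_derivative H (\<Phi> z t)) (at t within {0..})"
    unfolding \<Phi>_def by blast+
qed

sublocale conic_flow H L \<Phi>
proof
  show "H (c *\<^sub>R z) = c *\<^sub>R H z" if "c > 0" for c z
    using normalize_scale[OF that, of z] that unfolding H_def by (simp only: norm_scaleR) simp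
qed (use L \<Phi> in auto)

definition "traj x0 t = \<Phi> x0 t /\<^sub>R norm (\<Phi> x0 t)"

lemma norm_flow_pos: "norm x0 = 1 \<Longrightarrow> 0 \<le> t \<Longrightarrow> norm (\<Phi> x0 t) > 0"
  using flow_nonzero[of t x0] by force

lemma norm_traj: "norm x0 = 1 \<Longrightarrow> 0 \<le> t \<Longrightarrow> norm (traj x0 t) = 1"
  using norm_flow_pos[of x0 t] by (simp add: traj_def)

lemma traj_0: "norm x0 = 1 \<Longrightarrow> traj x0 0 = x0"
  by (simp add: traj_def flow_0)

lemma flow_eq_traj: "norm x0 = 1 \<Longrightarrow> 0 \<le> t \<Longrightarrow> \<Phi> x0 t = norm (\<Phi> x0 t) *\<^sub>R traj x0 t"
  using norm_flow_pos[of x0 t] by (simp add: traj_def)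

lemma flow_time_continuous: "continuous_on {0..} (\<Phi> x0)"
  by (rule continuous_on_vector_derivative[OF flow_atLeast]) auto

lemma traj_continuous: "norm x0 = 1 \<Longrightarrow> continuous_on {0..} (traj x0)"
  unfolding traj_def[abs_def]
  by (intro continuous_intros flow_time_continuous) (use norm_flow_pos[of x0] in force)

lemma traj_derivative:
  assumes "norm x0 = 1" "0 \<le> t"
  shows "(traj x0 has_vector_derivative tangent_proj (traj x0 t) (F (traj x0 t))) (at t within {0..})"
  using radial_projection_has_vector_derivative[of "\<Phi> x0" t "F (traj x0 t)" "{0..}"]
    flow_atLeast[OF assms(2), of x0] norm_flow_pos[OF assms]
  unfolding traj_def[abs_def] H_def by simp

lemma flow_directed:
  assumes x0: "norm x0 = 1" and st: "0 \<le> s" "s < t" and c: "c > 0"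
    and v: "\<And>r. s < r \<Longrightarrow> r < t \<Longrightarrow> F (traj x0 r) = c *\<^sub>R v"
  obtains \<beta> where "\<beta> > 0" "\<Phi> x0 t = \<Phi> x0 s + \<beta> *\<^sub>R v"
proof (rule directed_motion[OF st(2)])
  show cont: "continuous_on {s..t} (\<Phi> x0)"
    by (rule continuous_on_subset[OF flow_time_continuous]) (use st in auto)
  show "continuous_on {s..t} (\<lambda>r. c * norm (\<Phi> x0 r))" by (intro continuous_intros cont)
  show "c * norm (\<Phi> x0 r) > 0" if "r \<in> {s..t}" for r
    by (rule mult_pos_pos[OF c norm_flow_pos[OF x0]]) (use that st in auto)
  fix r assume r: "s < r" "r < t"
  have "at r within {0..} = at r" using r st by (intro at_within_interior) (simp add: interior_real_atLeast)
  then show "(\<Phi> x0 has_vector_derivative (c * norm (\<Phi> x0 r)) *\<^sub>R v) (at r)"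
    using flow_atLeast[of r x0] r st v[OF r] by (simp add: H_def traj_def mult.commute)
qed (use that in blast)

text \<open>Inside \<open>U i\<close> the field is a positive multiple of \<open>- g i\<close>. Read
  backwards the motion goes towards the star centre, and \<open>star_center_interior\<close> puts
  the boundary point at time \<open>s\<close> into the interior.\<close>

lemma traj_in_M:
  assumes x0: "x0 \<in> M" and t: "0 \<le> t"
  shows "traj x0 t \<in> M"
proof (rule ccontr)
  assume "traj x0 t \<notin> M"
  have n0: "norm x0 = 1" using x0 M_iff by auto
  then obtain i where i: "i \<in> I" "traj x0 t \<in> sphere_interior (U i)"
    using \<open>traj x0 t \<notin> M\<close> M_iff norm_traj[OF n0 t] by auto
  have "closed (U i)" using compact_U[OF i(1)] by (rule compact_imp_closed)
  moreover have "continuous_on {0..t} (traj x0)"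
    by (rule continuous_on_subset[OF traj_continuous[OF n0]]) auto
  moreover have "traj x0 0 \<notin> sphere_interior (U i)" using x0 i(1) M_iff traj_0[OF n0] by auto
  ultimately obtain s where s: "0 \<le> s" "s < t" "traj x0 s \<in> U i" "traj x0 s \<notin> sphere_interior (U i)"
      "\<And>r. s < r \<Longrightarrow> r \<le> t \<Longrightarrow> traj x0 r \<in> sphere_interior (U i)"
    using last_time_outside_interior[of "U i" t "traj x0"] norm_traj[OF n0] t i(2) atLeastAtMost_iff by metis
  have F: "F (traj x0 r) = (k1 / \<kappa>) *\<^sub>R (- g i)" if "s < r" "r < t" for r
  proof -
    have "traj x0 r \<in> U i" using s(5)[of r] that sphere_interior_subset by auto
    then have "traj x0 r \<in> dilation \<epsilon> (U i)" "\<eta> i (traj x0 r) = 0" using U_dilation \<eta>_eq_0 i by auto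
    then show ?thesis using F_single[OF i(1) \<eta>_other[OF i(1)]] by simp
  qed
  obtain \<beta> where \<beta>: "\<beta> > 0" "\<Phi> x0 t = \<Phi> x0 s + \<beta> *\<^sub>R (- g i)"
    by (rule flow_directed[OF n0 s(1,2) _ F]) (use pos in auto)
  have ns: "norm (\<Phi> x0 s) > 0" "norm (\<Phi> x0 t) > 0" using norm_flow_pos[OF n0] s t by auto
  have "\<Phi> x0 s = norm (\<Phi> x0 t) *\<^sub>R traj x0 t + \<beta> *\<^sub>R g i"
    using \<beta>(2) flow_eq_traj[OF n0 t] by (simp add: algebra_simps)
  then have "traj x0 s = (norm (\<Phi> x0 t) / norm (\<Phi> x0 s)) *\<^sub>R traj x0 t + (\<beta> / norm (\<Phi> x0 s)) *\<^sub>R g i"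
    unfolding traj_def[of x0 s] by (simp add: scaleR_add_right divide_inverse mult.commute)
  then have "traj x0 s \<in> sphere_interior (U i)"
    using star_center_interior[OF U_sphere[OF i(1)] g_center[OF i(1)] i(2)] norm_traj[OF n0 s(1)] ns \<beta>(1)
    by auto
  then show False using s(4) by simp
qed

text \<open>
  In the interior of \<open>U i\<close> the law switches to \<open>k1 xd\<close>.  At the last time \<open>s\<close> outside, the right
  derivative is both the value of the law at \<open>x s\<close> and the limit of its values inside, so
  \<open>xd + g i / \<kappa>\<close> is parallel to \<open>x s\<close> and the motion after \<open>s\<close> still points away from \<open>g i\<close>.
\<close>

lemma solution_in_M:
  assumes sol: "closed_loop_solution u {0..T} x" and x0: "x 0 \<in> M" and t: "t \<in> {0..T}"
  shows "x t \<in> M"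
proof (rule ccontr)
  assume "x t \<notin> M"
  have nx: "norm (x r) = 1"
    and dx: "(x has_vector_derivative tangent_proj (x r) (u (x r))) (at r within {0..T})" if "r \<in> {0..T}" for r
    using sol that by (auto simp: closed_loop_solution_def)
  obtain i where i: "i \<in> I" "x t \<in> sphere_interior (U i)"
    using \<open>x t \<notin> M\<close> M_iff nx[OF t] by auto
  have contx: "continuous_on {0..T} x" by (rule continuous_on_vector_derivative[OF dx])
  then have "continuous_on {0..t} x" by (rule continuous_on_subset) (use t in auto)
  have "closed (U i)" using compact_U[OF i(1)] by (rule compact_imp_closed)
  have "x 0 \<notin> sphere_interior (U i)" using x0 i(1) M_iff by auto
  obtain s where s: "0 \<le> s" "s < t" "x s \<in> U i" "x s \<notin> sphere_interior (U i)"
      "\<And>r. s < r \<Longrightarrow> r \<le> t \<Longrightarrow> x r \<in> sphere_interior (U i)"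
  proof -
    have "norm (x r) = 1" if "r \<in> {0..t}" for r using nx[of r] that t by simp
    moreover have "0 \<le> t" using t by simp
    ultimately show thesis
      using last_time_outside_interior[of "U i" t x] that i(2)
        \<open>continuous_on {0..t} x\<close> \<open>closed (U i)\<close> \<open>x 0 \<notin> sphere_interior (U i)\<close> by blast
  qed
  have sub: "{s..t} \<subseteq> {0..T}" using s t by auto
  have conts: "continuous_on {s..t} x" by (rule continuous_on_subset[OF contx sub])
  have ds: "(x has_vector_derivative tangent_proj (x r) (u (x r))) (at r within {s..t})" if "r \<in> {s..t}" for r
    by (rule has_vector_derivative_within_subset[OF dx sub]) (use that sub in auto)
  define v where "v r = tangent_proj (x r) (k1 *\<^sub>R xd)" for r
  have contv: "continuous_on {s..t} v"
    unfolding v_def tangent_proj_def by (intro continuous_intros conts)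
  have dv: "(x has_vector_derivative v r) (at r within {s..t})" if "r \<in> {s..t}" "r \<noteq> s" for r
    using ds[OF that(1)] control_interior[OF i(1) s(5)[of r]] that by (simp add: v_def)
  \<comment> \<open>The single time \<open>s\<close> does not affect the integral; differentiating
    the integral at \<open>s\<close> then gives the derivative \<open>v s\<close> there.\<close>
  have int: "x r = x s + integral {s..r} v" if r: "r \<in> {s..t}" for r
  proof -
    have "(v has_integral (x r - x s)) {s..r}"
    proof (rule fundamental_theorem_of_calculus_interior)
      show "continuous_on {s..r} x" by (rule continuous_on_subset[OF conts]) (use r in auto)
      fix q assume q: "q \<in> {s<..<r}"
      have "at q within {s..t} = at q" using q r by (intro at_within_interior) simp
      then show "(x has_vector_derivative v q) (at q)" using dv[of q] q r by simp
    qed (use r in simp)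
    then show ?thesis by (simp add: integral_unique)
  qed
  have "((\<lambda>r. x s + integral {s..r} v) has_vector_derivative v s) (at s within {s..t})"
    using integral_has_vector_derivative[OF contv, of s] s by (auto intro!: derivative_eq_intros)
  from has_vector_derivative_transform[OF _ int this]
  have dvs: "(x has_vector_derivative v s) (at s within {s..t})" using s(2) by simp
  have "x s \<in> M"
  proof -
    have "x s \<notin> sphere_interior (U j)" if "j \<in> I" for j
      using s(3,4) U_disjoint[OF i(1) that] sphere_interior_subset[of "U j"] by (cases "j = i") auto
    then show ?thesis using M_iff nx[of s] s t by auto
  qed
  moreover have "x s \<in> dilation \<epsilon> (U i)" using s(3) U_dilation i(1) by blast
  ultimately have us: "u (x s) = - (k1 / \<kappa>) *\<^sub>R g i"
    using control_eq_F F_single[OF i(1) \<eta>_other[OF i(1)]] \<eta>_eq_0[OF i(1) s(3)] by simp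
  have "tangent_proj (x s) (- (k1 / \<kappa>) *\<^sub>R g i) = v s"
    unfolding us[symmetric] using vector_derivative_unique_within_closed_interval[of s t s x] ds[of s] dvs s by auto
  then have "k1 *\<^sub>R tangent_proj (x s) (xd + (1 / \<kappa>) *\<^sub>R g i) = 0"
    unfolding v_def tangent_proj_def by (simp add: algebra_simps)
  then have "tangent_proj (x s) (xd + (1 / \<kappa>) *\<^sub>R g i) = 0" using pos by simp
  then have par: "xd + (1 / \<kappa>) *\<^sub>R g i = (x s \<bullet> (xd + (1 / \<kappa>) *\<^sub>R g i)) *\<^sub>R x s"
    unfolding tangent_proj_def by (simp only: right_minus_eq)
  define \<mu> where "\<mu> = x s \<bullet> (xd + (1 / \<kappa>) *\<^sub>R g i)"
  have xd: "xd = \<mu> *\<^sub>R x s - (1 / \<kappa>) *\<^sub>R g i" using par unfolding \<mu>_def by (rule eq_diff_eq[THEN iffD2])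
  have dall: "(x has_vector_derivative tangent_proj (x r) (k1 *\<^sub>R xd)) (at r within {s..t})" if "r \<in> {s..t}" for r
    using dv[OF that] dvs by (cases "r = s") (auto simp: v_def)
  obtain E where E: "E s = 1" "\<And>r. E r > 0" "continuous_on {s..t} E"
      "\<And>r. r \<in> {s..t} \<Longrightarrow> ((\<lambda>r. E r *\<^sub>R x r) has_vector_derivative E r *\<^sub>R (k1 *\<^sub>R xd)) (at r within {s..t})"
    by (rule sphere_solution_lift[OF dall continuous_on_const]) (assumption, rule that, simp_all)
  have contEx: "continuous_on {s..t} (\<lambda>r. E r *\<^sub>R x r)" by (intro continuous_intros E(3) conts)
  \<comment> \<open>This tolerance forces \<open>\<beta> < 1 / (1 + \<bar>\<mu>\<bar>)\<close>,
    hence \<open>1 + \<beta> * \<mu> > 0\<close>, the sign needed when solving for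
    \<open>x s\<close>.\<close>
  have "1 / (1 + \<bar>\<mu>\<bar>) > 0" by (simp add: add_pos_nonneg)
  then obtain d where d: "d > 0" "\<And>r. r \<in> {s..t} \<Longrightarrow> dist r s < d \<Longrightarrow> dist (E r *\<^sub>R x r) (E s *\<^sub>R x s) < 1 / (1 + \<bar>\<mu>\<bar>)"
    using contEx[unfolded continuous_on_iff, rule_format, of s "1 / (1 + \<bar>\<mu>\<bar>)"] s by auto
  define r where "r = min t (s + d / 2)"
  have r: "s < r" "r \<le> t" "dist r s < d" using s d(1) by (auto simp: r_def dist_real_def)
  obtain \<beta> where \<beta>: "\<beta> > 0" "E r *\<^sub>R x r = E s *\<^sub>R x s + \<beta> *\<^sub>R xd"
  proof (rule directed_motion[OF r(1)])
    show "continuous_on {s..r} (\<lambda>r. E r *\<^sub>R x r)" by (rule continuous_on_subset[OF contEx]) (use r in auto)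
    show "continuous_on {s..r} (\<lambda>r. E r * k1)"
      by (intro continuous_intros continuous_on_subset[OF E(3)]) (use r in auto)
    show "E q * k1 > 0" for q using E(2) pos by simp
    fix q assume q: "s < q" "q < r"
    have "at q within {s..t} = at q" using q r by (intro at_within_interior) simp
    then show "((\<lambda>r. E r *\<^sub>R x r) has_vector_derivative (E q * k1) *\<^sub>R xd) (at q)" using E(4)[of q] q r by simp
  qed (use that in blast)
  have "\<beta> = norm (E r *\<^sub>R x r - E s *\<^sub>R x s)" using \<beta> norm_xd by simp
  then have "\<beta> < 1 / (1 + \<bar>\<mu>\<bar>)" using d(2)[of r] r by (simp add: dist_norm)
  then have "\<beta> * (1 + \<bar>\<mu>\<bar>) < 1" by (simp add: pos_less_divide_eq add_pos_nonneg)
  moreover have "\<bar>\<beta> * \<mu>\<bar> \<le> \<beta> * (1 + \<bar>\<mu>\<bar>)" using \<beta>(1) by (simp add: abs_mult)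
  ultimately have a: "1 + \<beta> * \<mu> > 0" by linarith
  \<comment> \<open>Substituting the expression for \<open>xd\<close> turns the added multiple of
    \<open>xd\<close> into a rescaling of \<open>x s\<close> and a multiple of
    \<open>- g i\<close>.\<close>
  have "(1 + \<beta> * \<mu>) *\<^sub>R x s = E r *\<^sub>R x r + (\<beta> / \<kappa>) *\<^sub>R g i"
    unfolding \<beta>(2) E(1) by (subst xd) (simp add: algebra_simps)
  then have "inverse (1 + \<beta> * \<mu>) *\<^sub>R ((1 + \<beta> * \<mu>) *\<^sub>R x s)
      = (inverse (1 + \<beta> * \<mu>) * E r) *\<^sub>R x r + (inverse (1 + \<beta> * \<mu>) * (\<beta> / \<kappa>)) *\<^sub>R g i"
    by (simp only: scaleR_add_right scaleR_scaleR)
  then have "x s = (inverse (1 + \<beta> * \<mu>) * E r) *\<^sub>R x r + (inverse (1 + \<beta> * \<mu>) * (\<beta> / \<kappa>)) *\<^sub>R g i"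
    using a by simp
  moreover have "inverse (1 + \<beta> * \<mu>) * E r > 0" "inverse (1 + \<beta> * \<mu>) * (\<beta> / \<kappa>) \<ge> 0" using a E(2) \<beta>(1) pos by simp_all
  ultimately have "x s \<in> sphere_interior (U i)"
    using star_center_interior[OF U_sphere[OF i(1)] g_center[OF i(1)] s(5)[OF r(1,2)]] nx[of s] s t by auto
  then show False using s(4) by simp
qed

lemma forward_invariant: "forward_invariant u M"
  unfolding forward_invariant_def
proof (intro conjI allI ballI impI)
  fix x0 assume x0: "x0 \<in> M"
  then have n0: "norm x0 = 1" using M_iff by auto
  have "closed_loop_solution u {0..} (traj x0)"
    unfolding closed_loop_solution_def
    using norm_traj[OF n0] traj_derivative[OF n0] control_eq_F[OF traj_in_M[OF x0]] by auto
  then show "\<exists>x. closed_loop_solution u {0..} x \<and> x 0 = x0" using traj_0[OF n0] by blast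
next
  fix T :: real and x t assume "closed_loop_solution u {0..T} x \<and> x 0 \<in> M" "t \<in> {0..T}"
  then show "x t \<in> M" using solution_in_M by blast
qed

text \<open>A solution starting in \<open>M\<close> stays there, where the law is \<open>F\<close>;
  its lift solves the cone equation, and uniqueness applies.\<close>

lemma solution_eq_traj:
  assumes sol: "closed_loop_solution u {0..} x" and x0: "x 0 \<in> M" and t: "0 \<le> t"
  shows "x t = traj (x 0) t"
proof -
  have solt: "closed_loop_solution u {0..t} x"
    unfolding closed_loop_solution_def
  proof
    fix r assume "r \<in> {0..t}"
    then have "x r \<in> unit_sphere" "(x has_vector_derivative tangent_proj (x r) (u (x r))) (at r within {0..})"
      using sol by (auto simp: closed_loop_solution_def)
    then show "x r \<in> unit_sphere \<and> (x has_vector_derivative tangent_proj (x r) (u (x r))) (at r within {0..t})"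
      using has_vector_derivative_within_subset[of x _ r "{0..}" "{0..t}"] by auto
  qed
  have nx: "norm (x r) = 1" if "r \<in> {0..t}" for r using solt that by (auto simp: closed_loop_solution_def)
  have dx: "(x has_vector_derivative tangent_proj (x r) (F (x r))) (at r within {0..t})" if "r \<in> {0..t}" for r
    using solt that unfolding closed_loop_solution_def control_eq_F[OF solution_in_M[OF solt x0 that], symmetric] by blast
  have "continuous_on {0..t} x" by (rule continuous_on_vector_derivative[OF dx])
  then have contF: "continuous_on {0..t} (\<lambda>r. F (x r))"
    unfolding F_def \<eta>_def using pos
    by (intro continuous_intros continuous_on_min continuous_on_compose2[OF continuous_on_set_sep[OF U_ne U_sphere, of _ UNIV]]) auto
  obtain E where E: "E 0 = 1" "\<And>r. E r > 0" "continuous_on {0..t} E"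
      "\<And>r. r \<in> {0..t} \<Longrightarrow> ((\<lambda>r. E r *\<^sub>R x r) has_vector_derivative E r *\<^sub>R F (x r)) (at r within {0..t})"
    by (rule sphere_solution_lift[OF dx contF]) (assumption, rule that, simp_all)
  have "E t *\<^sub>R x t = \<Phi> (E 0 *\<^sub>R x 0) t"
  proof (rule flow_unique[OF t])
    fix r assume r: "r \<in> {0..t}"
    have "H (E r *\<^sub>R x r) = E r *\<^sub>R F (x r)" using E(2)[of r] nx[OF r] by (simp add: H_def)
    then show "((\<lambda>r. E r *\<^sub>R x r) has_vector_derivative H (E r *\<^sub>R x r)) (at r within {0..t})" using E(4)[OF r] by simp
  qed
  then have \<Phi>x: "\<Phi> (x 0) t = E t *\<^sub>R x t" by (simp add: E(1))
  show ?thesis unfolding traj_def \<Phi>x using E(2)[of t] nx[of t] t by simp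
qed

end


subsection \<open>The itinerary of a trajectory\<close>

text \<open>\<open>p / sqrt (p\<^sup>2 + c)\<close> is the cosine of the angle to an axis, for a
  vector with axial part \<open>p\<close> and orthogonal part of squared length
  \<open>c\<close>.\<close>

lemma cone_level_mono:
  fixes p q c :: real
  assumes "c \<ge> 0" "p \<le> q" "p\<^sup>2 + c > 0" "q\<^sup>2 + c > 0"
  shows "p / sqrt (p\<^sup>2 + c) \<le> q / sqrt (q\<^sup>2 + c)"
    and "c > 0 \<Longrightarrow> p < q \<Longrightarrow> p / sqrt (p\<^sup>2 + c) < q / sqrt (q\<^sup>2 + c)"
proof -
  have s: "sqrt (p\<^sup>2 + c) > 0" "sqrt (q\<^sup>2 + c) > 0" using assms by simp_all
  have sq: "(x * sqrt (y\<^sup>2 + c))\<^sup>2 = x\<^sup>2 * y\<^sup>2 + x\<^sup>2 * c" for x y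
    using assms(1) by (simp add: power_mult_distrib algebra_simps)
  show "p / sqrt (p\<^sup>2 + c) \<le> q / sqrt (q\<^sup>2 + c)"
  proof -
    have "p * sqrt (q\<^sup>2 + c) \<le> q * sqrt (p\<^sup>2 + c)"
    proof (cases "0 \<le> p")
      case True
      then have "p\<^sup>2 \<le> q\<^sup>2" using assms by (intro power_mono) auto
      then have "(p * sqrt (q\<^sup>2 + c))\<^sup>2 \<le> (q * sqrt (p\<^sup>2 + c))\<^sup>2"
        unfolding sq using assms(1) by (simp add: mult_right_mono)
      then show ?thesis by (rule power2_le_imp_le) (use True assms(2) s in simp)
    next
      case p: False
      show ?thesis
      proof (cases "0 \<le> q")
        case True
        have "p * sqrt (q\<^sup>2 + c) \<le> 0" by (rule mult_nonpos_nonneg) (use p assms(4) in auto)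
        moreover have "0 \<le> q * sqrt (p\<^sup>2 + c)" by (rule mult_nonneg_nonneg) (use True assms(3) in auto)
        ultimately show ?thesis by linarith
      next
        case False
        then have "(-q)\<^sup>2 \<le> (-p)\<^sup>2" using assms by (intro power_mono) auto
        then have "((-q) * sqrt (p\<^sup>2 + c))\<^sup>2 \<le> ((-p) * sqrt (q\<^sup>2 + c))\<^sup>2"
          unfolding sq using assms(1) by (simp add: mult_right_mono)
        then have "(-q) * sqrt (p\<^sup>2 + c) \<le> (-p) * sqrt (q\<^sup>2 + c)"
          by (rule power2_le_imp_le) (rule mult_nonneg_nonneg, use p assms(4) in auto)
        then show ?thesis by simp
      qed
    qed
    then show ?thesis using s by (simp add: divide_simps)
  qed
  assume c: "c > 0" and pq: "p < q"
  show "p / sqrt (p\<^sup>2 + c) < q / sqrt (q\<^sup>2 + c)"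
  proof -
    have "p * sqrt (q\<^sup>2 + c) < q * sqrt (p\<^sup>2 + c)"
    proof (cases "0 \<le> p")
      case True
      then have "p\<^sup>2 < q\<^sup>2" using pq by (intro power_strict_mono) auto
      then have "(p * sqrt (q\<^sup>2 + c))\<^sup>2 < (q * sqrt (p\<^sup>2 + c))\<^sup>2"
        unfolding sq using c by simp
      then show ?thesis by (rule power2_less_imp_less) (use True pq s in simp)
    next
      case p: False
      show ?thesis
      proof (cases "0 \<le> q")
        case True
        have "p * sqrt (q\<^sup>2 + c) < 0" by (rule mult_neg_pos) (use p s in auto)
        moreover have "0 \<le> q * sqrt (p\<^sup>2 + c)" by (rule mult_nonneg_nonneg) (use True assms(3) in auto)
        ultimately show ?thesis by linarith
      next
        case False
        then have "(-q)\<^sup>2 < (-p)\<^sup>2" using pq by (intro power_strict_mono) auto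
        then have "((-q) * sqrt (p\<^sup>2 + c))\<^sup>2 < ((-p) * sqrt (q\<^sup>2 + c))\<^sup>2"
          unfolding sq using c by simp
        then have "(-q) * sqrt (p\<^sup>2 + c) < (-p) * sqrt (q\<^sup>2 + c)"
          by (rule power2_less_imp_less) (rule mult_nonneg_nonneg, use p assms(4) in auto)
        then show ?thesis by simp
      qed
    qed
    then show ?thesis using s by (simp add: divide_simps)
  qed
qed

text \<open>Adding a positive multiple of \<open>v\<close> raises the axial part and leaves the
  orthogonal part alone; the latter is nonzero when the direction is neither \<open>v\<close> nor
  \<open>- v\<close>, which gives strictness.\<close>

lemma cone_sep_le:
  fixes X v :: "'a::euclidean_space"
  assumes v: "norm v = 1" and \<beta>: "\<beta> > 0" and nz: "X \<noteq> 0" "X + \<beta> *\<^sub>R v \<noteq> 0"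
  shows "sep ((X + \<beta> *\<^sub>R v) /\<^sub>R norm (X + \<beta> *\<^sub>R v)) v \<le> sep (X /\<^sub>R norm X) v"
    and "X /\<^sub>R norm X \<noteq> v \<Longrightarrow> X /\<^sub>R norm X \<noteq> - v \<Longrightarrow>
      sep ((X + \<beta> *\<^sub>R v) /\<^sub>R norm (X + \<beta> *\<^sub>R v)) v < sep (X /\<^sub>R norm X) v"
proof -
  define p where "p = X \<bullet> v"
  define c where "c = (norm (X - p *\<^sub>R v))\<^sup>2"
  have vv: "v \<bullet> v = 1" using v by (simp add: dot_square_norm)
  have n: "(norm (X + b *\<^sub>R v))\<^sup>2 = (p + b)\<^sup>2 + c" for b
    unfolding c_def power2_norm_eq_inner inner_add_left inner_add_right inner_diff_left inner_diff_right
    by (simp add: vv p_def[symmetric] inner_commute[of v X] power2_eq_square algebra_simps)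
  have n0: "(norm X)\<^sup>2 = p\<^sup>2 + c" using n[of 0] by simp
  have pos: "p\<^sup>2 + c > 0" "(p + \<beta>)\<^sup>2 + c > 0"
    unfolding n0[symmetric] n[symmetric] using nz by simp_all
  have s0: "norm X = sqrt (p\<^sup>2 + c)" using n0 by (metis norm_ge_zero real_sqrt_abs abs_of_nonneg)
  have s1: "norm (X + \<beta> *\<^sub>R v) = sqrt ((p + \<beta>)\<^sup>2 + c)" using n[of \<beta>] by (metis norm_ge_zero real_sqrt_abs abs_of_nonneg)
  have e0: "sep (X /\<^sub>R norm X) v = 1 - p / sqrt (p\<^sup>2 + c)"
    unfolding sep_def s0 by (simp add: p_def divide_inverse mult.commute)
  have e1: "sep ((X + \<beta> *\<^sub>R v) /\<^sub>R norm (X + \<beta> *\<^sub>R v)) v = 1 - (p + \<beta>) / sqrt ((p + \<beta>)\<^sup>2 + c)"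
    unfolding sep_def s1 by (simp add: p_def inner_add_left vv divide_inverse mult.commute)
  have c0: "c \<ge> 0" by (simp add: c_def)
  show "sep ((X + \<beta> *\<^sub>R v) /\<^sub>R norm (X + \<beta> *\<^sub>R v)) v \<le> sep (X /\<^sub>R norm X) v"
    unfolding e0 e1 using cone_level_mono(1)[OF c0 _ pos] \<beta> by simp
  assume ne: "X /\<^sub>R norm X \<noteq> v" "X /\<^sub>R norm X \<noteq> - v"
  have "c \<noteq> 0"
  proof
    assume "c = 0"
    then have X: "X = p *\<^sub>R v" by (simp add: c_def)
    then have nX: "norm X = \<bar>p\<bar>" using v by (metis norm_scaleR mult.right_neutral)
    have "p \<noteq> 0" using X nz by auto
    then have "X /\<^sub>R norm X = v \<or> X /\<^sub>R norm X = - v" unfolding nX by (subst (1 2) X) (simp add: abs_if)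
    then show False using ne by blast
  qed
  then show "sep ((X + \<beta> *\<^sub>R v) /\<^sub>R norm (X + \<beta> *\<^sub>R v)) v < sep (X /\<^sub>R norm X) v"
    unfolding e0 e1 using cone_level_mono(2)[OF c0 _ pos] c0 \<beta> by simp
qed

section \<open>Regions as an itinerary, and convergence of generic trajectories\<close>

context star_navigation
begin

abbreviation "R i \<equiv> region xd \<epsilon> (U i)"

lemma xd_not_dilation: "i \<in> I \<Longrightarrow> xd \<notin> dilation \<epsilon> (U i)"
  using xd_far[of i] by (simp add: dilation_def)

lemma dilation_region:
  assumes i: "i \<in> I" and x: "x \<in> dilation \<epsilon> (U i)" "x \<notin> sphere_interior (U i)"
  shows "x \<in> R i"
proof -
  have nx: "norm x = 1" using x by (simp add: dilation_def)
  have self: "x \<in> shadow \<epsilon> (U i) y" if y: "norm y = 1" "- y \<notin> dilation \<epsilon> (U i)" for y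
    unfolding mem_shadow_iff[OF y]
    by (intro conjI nx bexI[OF _ x(1)], rule exI[of _ 1], simp, rule exI[of _ 0], simp)
  have "set_sep xd (dilation \<epsilon> (U i)) \<le> sep xd x"
    by (rule set_sep_le[OF _ x(1)]) (auto simp: dilation_def)
  then show ?thesis
    unfolding region_def using self[of xd] self[of "- xd"] xd_not_dilation[OF i] norm_xd x(2)
    by (auto simp: sep_commute)
qed

lemma closed_region:
  assumes i: "i \<in> I"
  shows "closed (R i)"
proof -
  have sub: "shadow \<epsilon> (U i) y \<subseteq> sphere 0 1" if "norm y = 1" "- y \<notin> dilation \<epsilon> (U i)" for y
    using mem_shadow_iff[OF that] by auto
  have cl: "closed (shadow \<epsilon> (U i) y - sphere_interior (U i))"
    if "norm y = 1" "- y \<notin> dilation \<epsilon> (U i)" for y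
  proof -
    have "shadow \<epsilon> (U i) y - sphere_interior (U i) = shadow \<epsilon> (U i) y \<inter> (sphere 0 1 - sphere_interior (U i))"
      using sub[OF that] by blast
    then show ?thesis
      using closed_Int[OF closed_shadow[OF U_ne[OF i] U_sphere[OF i] that] closed_sphere_minus_interior] by simp
  qed
  have "closed {x. set_sep xd (dilation \<epsilon> (U i)) \<le> sep x xd}"
    unfolding sep_def by (intro closed_Collect_le continuous_intros)
  moreover have region: "R i = (if - xd \<notin> dilation \<epsilon> (U i)
      then (shadow \<epsilon> (U i) xd - sphere_interior (U i)) \<inter> {x. set_sep xd (dilation \<epsilon> (U i)) \<le> sep x xd}
      else shadow \<epsilon> (U i) (- xd) - sphere_interior (U i))"
    by (auto simp: region_def)
  ultimately show ?thesis
    unfolding region using cl[of xd] cl[of "- xd"] xd_not_dilation[OF i] norm_xd by (simp add: closed_Int)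
qed

text \<open>Separations on the sphere are at most 2, so 3 makes \<open>exit\<close> automatic for a
  region whose dilation contains \<open>- xd\<close>.\<close>

definition "level i = (if - xd \<notin> dilation \<epsilon> (U i) then set_sep xd (dilation \<epsilon> (U i)) else 3)"

lemma free_F:
  assumes "x \<in> M" "\<And>i. i \<in> I \<Longrightarrow> x \<notin> R i"
  shows "F x = k1 *\<^sub>R xd"
proof (intro F_free \<eta>_eq_1)
  fix i assume i: "i \<in> I"
  then have "x \<notin> sphere_interior (U i)" using assms(1) M_iff by blast
  then show "x \<notin> dilation \<epsilon> (U i)" using dilation_region[OF i, of x] assms(2)[OF i] by blast
  show "norm x = 1" using assms(1) M_iff by blast
qed

lemma traj_towards:
  assumes n0: "norm x0 = 1" and st: "0 \<le> s" "s < t"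
    and free: "\<And>r. s < r \<Longrightarrow> r < t \<Longrightarrow> F (traj x0 r) = k1 *\<^sub>R xd"
  obtains \<beta> where "\<beta> > 0" "\<Phi> x0 t = \<Phi> x0 s + \<beta> *\<^sub>R xd"
    "sep (traj x0 t) xd \<le> sep (traj x0 s) xd"
    "traj x0 s \<noteq> xd \<Longrightarrow> traj x0 s \<noteq> - xd \<Longrightarrow> sep (traj x0 t) xd < sep (traj x0 s) xd"
proof -
  obtain \<beta> where \<beta>: "\<beta> > 0" "\<Phi> x0 t = \<Phi> x0 s + \<beta> *\<^sub>R xd"
    using flow_directed[OF n0 st pos(1) free] by blast
  have nz: "\<Phi> x0 s \<noteq> 0" "\<Phi> x0 s + \<beta> *\<^sub>R xd \<noteq> 0"
    using norm_flow_pos[OF n0 st(1)] norm_flow_pos[OF n0, of t] st \<beta>(2) by auto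
  show thesis
    using that[OF \<beta>] cone_sep_le[OF norm_xd \<beta>(1) nz] unfolding traj_def \<beta>(2) by blast
qed

text \<open>Exits and entries are decided by the cones behind \<open>shadow\<close>: adding
  multiples of \<open>xd\<close> preserves membership in the shadow with target \<open>xd\<close>,
  and undoing such a motion preserves membership in the shadow with target
  \<open>- xd\<close>.\<close>

lemma traj_itinerary:
  assumes x0: "x0 \<in> M"
  shows "itinerary I (\<lambda>i. {t. 0 \<le> t \<and> traj x0 t \<in> R i}) level (\<lambda>t. sep (traj x0 t) xd)"
proof -
  define T where "T i = {t. 0 \<le> t \<and> traj x0 t \<in> R i}" for i
  define f where "f t = sep (traj x0 t) xd" for t
  have n0: "norm x0 = 1" using x0 M_iff by auto
  have nt: "norm (traj x0 t) = 1" if "0 \<le> t" for t using norm_traj[OF n0 that] .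
  have notint: "traj x0 t \<notin> sphere_interior (U i)" if "0 \<le> t" "i \<in> I" for t i
    using traj_in_M[OF x0 that(1)] that(2) M_iff by blast
  have freeF: "F (traj x0 t) = k1 *\<^sub>R xd" if "0 \<le> t" "\<And>i. i \<in> I \<Longrightarrow> t \<notin> T i" for t
    by (rule free_F[OF traj_in_M[OF x0 that(1)]]) (use that in \<open>auto simp: T_def\<close>)
  have freeS: "F (traj x0 r) = k1 *\<^sub>R xd" if "S \<inter> (\<Union>i\<in>I. T i) = {}" "0 \<le> r" "r \<in> S" for r S
    by (rule freeF[OF that(2)]) (use that in blast)
  have Xeq: "\<Phi> x0 t = norm (\<Phi> x0 t) *\<^sub>R traj x0 t" if "0 \<le> t" for t by (rule flow_eq_traj[OF n0 that])
  have npos: "norm (\<Phi> x0 t) > 0" if "0 \<le> t" for t by (rule norm_flow_pos[OF n0 that])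
  have traj_div: "traj x0 t = inverse (norm (\<Phi> x0 t)) *\<^sub>R \<Phi> x0 t" for t by (simp add: traj_def)
  have contf: "continuous_on {0..} f"
    unfolding f_def sep_def by (intro continuous_intros traj_continuous[OF n0])
  have exit: "f t < level i" if i: "i \<in> I" and s: "s \<in> T i" and st: "s < t"
    and free: "{s<..t} \<inter> (\<Union>i\<in>I. T i) = {}" for i s t
  proof (cases "- xd \<in> dilation \<epsilon> (U i)")
    case True
    have "0 \<le> t" using s st by (simp add: T_def)
    have "\<bar>traj x0 t \<bullet> xd\<bar> \<le> norm (traj x0 t) * norm xd" by (rule Cauchy_Schwarz_ineq2)
    then have "f t \<le> 2" unfolding f_def sep_def using nt[OF \<open>0 \<le> t\<close>] norm_xd by simp
    then show ?thesis using True by (simp add: level_def)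
  next
    case False
    have s0: "0 \<le> s" using s by (simp add: T_def)
    have D: "compact (dilation \<epsilon> (U i))" "dilation \<epsilon> (U i) \<subseteq> unit_sphere"
      using compact_dilation[OF U_ne[OF i] U_sphere[OF i]] by (auto simp: dilation_def)
    have Dne: "dilation \<epsilon> (U i) \<noteq> {}" using U_dilation[OF i] U_ne[OF i] by blast
    have lev: "level i = set_sep xd (dilation \<epsilon> (U i))" using False by (simp add: level_def)
    have lpos: "level i > 0"
      using set_sep_eq_0_iff[OF D(1) Dne D(2) norm_xd] set_sep_nonneg[OF Dne D(2), of xd] xd_not_dilation[OF i] norm_xd
      unfolding lev by force
    have sR: "traj x0 s \<in> R i" using s by (simp add: T_def)
    then have "traj x0 s \<in> shadow \<epsilon> (U i) xd" and ge: "level i \<le> f s"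
      using False by (auto simp: region_def lev f_def)
    then obtain z a b where z: "z \<in> dilation \<epsilon> (U i)" "a \<ge> 0" "b \<ge> 0" "traj x0 s = a *\<^sub>R z + b *\<^sub>R xd"
      using mem_shadow_iff[OF norm_xd False] by blast
    have F: "F (traj x0 r) = k1 *\<^sub>R xd" if "s < r" "r \<le> t" for r
      by (rule freeS[OF free]) (use that s0 in auto)
    have ne1: "traj x0 s \<noteq> xd"
      using ge lpos norm_xd by (auto simp: f_def sep_def dot_square_norm)
    \<comment> \<open>Otherwise a nonnegative combination of \<open>z\<close> and \<open>xd\<close>
      equals \<open>- xd\<close>, which forces \<open>z = - xd\<close>.\<close>
    have ne2: "traj x0 s \<noteq> - xd"
    proof
      assume e: "traj x0 s = - xd"
      then have az: "a *\<^sub>R z = - ((1 + b) *\<^sub>R xd)" using z(4) by (simp add: algebra_simps)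
      have nz: "norm z = 1" using z(1) D(2) by auto
      have "norm (a *\<^sub>R z) = norm ((1 + b) *\<^sub>R xd)" unfolding az by simp
      then have "a = 1 + b" using z nz norm_xd by simp
      then have "(1 + b) *\<^sub>R z = (1 + b) *\<^sub>R (- xd)" using az by simp
      then have "z = - xd" using z(3) by (metis add_nonneg_eq_0_iff scaleR_cancel_left zero_le_one zero_neq_one)
      then show False using z(1) False by simp
    qed
    \<comment> \<open>Strictly above the level the trajectory would remain in the shadow, hence in
      the region, a little longer, against \<open>free\<close>. So it leaves at the level, and then
      \<open>f\<close> drops strictly.\<close>
    have le: "f s \<le> level i"
    proof (rule ccontr)
      assume "\<not> f s \<le> level i"
      then have gt: "f s > level i" by simp
      obtain d where d: "d > 0" "\<And>r. r \<in> {0..} \<Longrightarrow> dist r s < d \<Longrightarrow> dist (f r) (f s) < f s - level i"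
        using contf[unfolded continuous_on_iff, rule_format, of s "f s - level i"] gt s0 by auto
      define r where "r = min t (s + d / 2)"
      have r: "s < r" "r \<le> t" "dist r s < d" using st d(1) by (auto simp: r_def dist_real_def)
      have r0: "0 \<le> r" using r s0 by simp
      have fr: "f r > level i" using d(2)[of r] r r0 by (auto simp: dist_real_def)
      obtain \<beta> where \<beta>: "\<beta> > 0" "\<Phi> x0 r = \<Phi> x0 s + \<beta> *\<^sub>R xd"
        using traj_towards[OF n0 s0 r(1)] F r(2) by (metis less_imp_le order_trans)
      have "traj x0 r = inverse (norm (\<Phi> x0 r)) *\<^sub>R (norm (\<Phi> x0 s) *\<^sub>R (a *\<^sub>R z + b *\<^sub>R xd) + \<beta> *\<^sub>R xd)"
        unfolding traj_div[of r] \<beta>(2) z(4)[symmetric] using Xeq[OF s0] by simp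
      also have "\<dots> = (inverse (norm (\<Phi> x0 r)) * norm (\<Phi> x0 s) * a) *\<^sub>R z
          + (inverse (norm (\<Phi> x0 r)) * (norm (\<Phi> x0 s) * b + \<beta>)) *\<^sub>R xd"
        by (simp add: algebra_simps)
      finally have "traj x0 r = (inverse (norm (\<Phi> x0 r)) * norm (\<Phi> x0 s) * a) *\<^sub>R z
          + (inverse (norm (\<Phi> x0 r)) * (norm (\<Phi> x0 s) * b + \<beta>)) *\<^sub>R xd" .
      moreover have "inverse (norm (\<Phi> x0 r)) * norm (\<Phi> x0 s) * a \<ge> 0"
        "inverse (norm (\<Phi> x0 r)) * (norm (\<Phi> x0 s) * b + \<beta>) \<ge> 0"
        using z(2,3) \<beta>(1) by simp_all
      ultimately have "traj x0 r \<in> shadow \<epsilon> (U i) xd"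
        unfolding mem_shadow_iff[OF norm_xd False] using nt[OF r0] z(1) by blast
      then have "traj x0 r \<in> R i"
        using False fr notint[OF r0 i] by (simp add: region_def lev f_def)
      then have "r \<in> T i" using r0 by (simp add: T_def)
      moreover have "r \<in> {s<..t}" using r by simp
      ultimately show False using free i by blast
    qed
    have "f t < f s"
      using traj_towards[OF n0 s0 st] F ne1 ne2 unfolding f_def by (metis less_imp_le)
    then show ?thesis using le by simp
  qed
  have enter: "level i \<le> f t" if i: "i \<in> I" and t: "t \<in> T i" and s0: "0 \<le> s" and st: "s < t"
    and free: "{s..<t} \<inter> (\<Union>i\<in>I. T i) = {}" for i s t
  proof (cases "- xd \<in> dilation \<epsilon> (U i)")
    case False
    then show ?thesis using t by (simp add: T_def region_def level_def f_def)
  next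
    \<comment> \<open>Contradictory case: running backwards from \<open>t\<close>, the time
      \<open>s\<close> already belongs to the region, so it is never entered through free
      times.\<close>
    case True
    have t0: "0 \<le> t" using s0 st by simp
    have y: "norm (- xd) = 1" "- (- xd) \<notin> dilation \<epsilon> (U i)" using norm_xd xd_not_dilation[OF i] by auto
    have "traj x0 t \<in> shadow \<epsilon> (U i) (- xd)" using t True by (simp add: T_def region_def)
    then obtain z a b where z: "z \<in> dilation \<epsilon> (U i)" "a \<ge> 0" "b \<ge> 0" "traj x0 t = a *\<^sub>R z + b *\<^sub>R (- xd)"
      unfolding mem_shadow_iff[OF y] by blast
    have "F (traj x0 r) = k1 *\<^sub>R xd" if "s < r" "r < t" for r
      by (rule freeS[OF free]) (use that s0 in auto)
    then obtain \<beta> where \<beta>: "\<beta> > 0" "\<Phi> x0 t = \<Phi> x0 s + \<beta> *\<^sub>R xd"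
      using traj_towards[OF n0 s0 st] by blast
    have "\<Phi> x0 s = norm (\<Phi> x0 t) *\<^sub>R traj x0 t - \<beta> *\<^sub>R xd" using \<beta>(2) Xeq[OF t0] by simp
    then have "traj x0 s = inverse (norm (\<Phi> x0 s)) *\<^sub>R (norm (\<Phi> x0 t) *\<^sub>R (a *\<^sub>R z + b *\<^sub>R (- xd)) - \<beta> *\<^sub>R xd)"
      unfolding traj_div[of s] z(4) by simp
    also have "\<dots> = (inverse (norm (\<Phi> x0 s)) * norm (\<Phi> x0 t) * a) *\<^sub>R z
        + (inverse (norm (\<Phi> x0 s)) * (norm (\<Phi> x0 t) * b + \<beta>)) *\<^sub>R (- xd)"
      by (simp add: algebra_simps)
    finally have "traj x0 s = (inverse (norm (\<Phi> x0 s)) * norm (\<Phi> x0 t) * a) *\<^sub>R z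
        + (inverse (norm (\<Phi> x0 s)) * (norm (\<Phi> x0 t) * b + \<beta>)) *\<^sub>R (- xd)" .
    moreover have "inverse (norm (\<Phi> x0 s)) * norm (\<Phi> x0 t) * a \<ge> 0"
      "inverse (norm (\<Phi> x0 s)) * (norm (\<Phi> x0 t) * b + \<beta>) \<ge> 0"
      using z(2,3) \<beta>(1) by simp_all
    ultimately have "traj x0 s \<in> shadow \<epsilon> (U i) (- xd)"
      unfolding mem_shadow_iff[OF y] using nt[OF s0] z(1) by blast
    then have "s \<in> T i" using True notint[OF s0 i] s0 by (simp add: T_def region_def)
    moreover have "s \<in> {s..<t}" using st by simp
    ultimately show ?thesis using free i by blast
  qed
  have "itinerary I T level f"
  proof
    show "closed (T i)" if "i \<in> I" for i
    proof -
      have "T i = {0..} \<inter> traj x0 -` R i" by (auto simp: T_def)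
      then show ?thesis
        using continuous_closed_preimage[OF traj_continuous[OF n0] closed_atLeast closed_region[OF that]] by simp
    qed
    show "T i \<inter> T j = {}" if "i \<in> I" "j \<in> I" "i \<noteq> j" for i j
      using regions[OF that] by (auto simp: T_def)
    show "f t \<le> f s" if "0 \<le> s" "s < t" "{s<..<t} \<inter> (\<Union>i\<in>I. T i) = {}" for s t
    proof -
      have "F (traj x0 r) = k1 *\<^sub>R xd" if "s < r" "r < t" for r
        by (rule freeS[OF \<open>{s<..<t} \<inter> (\<Union>i\<in>I. T i) = {}\<close>]) (use that \<open>0 \<le> s\<close> in auto)
      then show ?thesis using traj_towards[OF n0 that(1,2)] unfolding f_def by blast
    qed
  qed (use exit enter in \<open>auto simp: T_def\<close>)
  then show ?thesis unfolding T_def[abs_def] f_def[abs_def] .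
qed

lemma traj_converges:
  assumes x0: "x0 \<in> M"
    and small: "\<And>i. i \<in> I \<Longrightarrow> 1 / \<kappa> / \<eta>0 i < \<rho> i"
    and bounds: "\<And>i. i \<in> I \<Longrightarrow> \<eta>0 i > 0" "\<And>i. i \<in> I \<Longrightarrow> \<rho>1 i > 0"
      "\<And>i l z. i \<in> I \<Longrightarrow> l \<in> {0..1} \<Longrightarrow> norm (z - ((1 - l) *\<^sub>R xd - l *\<^sub>R g i)) < \<rho>1 i \<Longrightarrow>
        \<eta>0 i \<le> min 1 (set_sep (z /\<^sub>R norm z) (U i) / \<epsilon>)"
      "\<And>i z. i \<in> I \<Longrightarrow> norm (z - xd) < \<rho> i \<Longrightarrow> min 1 (set_sep (z /\<^sub>R norm z) (U i) / \<epsilon>) = 1"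
    and generic: "\<And>n::nat. \<And>v. v \<in> insert xd (g ` I) \<Longrightarrow> \<Phi> x0 (real n) \<notin> span {xd, v}"
  shows "(traj x0 \<longlongrightarrow> xd) at_top"
proof -
  have n0: "norm x0 = 1" using x0 M_iff by auto
  have conv: "(traj x0 \<longlongrightarrow> xd) at_top"
    if a: "0 \<le> (a::real)" and g': "norm g' = 1" and c: "c > 0"
      and F: "\<And>t. t \<ge> a \<Longrightarrow> F (traj x0 t) = k1 *\<^sub>R (\<zeta> (traj x0 t) *\<^sub>R xd - (c * (1 - \<zeta> (traj x0 t))) *\<^sub>R g')"
      and \<zeta>: "\<And>x. norm x = 1 \<Longrightarrow> 0 \<le> \<zeta> x \<and> \<zeta> x \<le> 1" "continuous_on (sphere 0 1) \<zeta>"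
      and q: "q0 > 0" "q1 > 0"
      and near: "\<And>l z. l \<in> {0..1} \<Longrightarrow> norm (z - ((1 - l) *\<^sub>R xd - l *\<^sub>R g')) < q1 \<Longrightarrow> q0 \<le> \<zeta> (z /\<^sub>R norm z)"
      and target: "\<And>z. norm (z - xd) < q2 \<Longrightarrow> \<zeta> (z /\<^sub>R norm z) = 1"
      and "c / q0 < q2" and "\<Phi> x0 a \<notin> span {xd, g'}"
    for a g' c \<zeta> q0 q1 q2
  proof -
    have "((\<lambda>t. \<Phi> x0 t /\<^sub>R norm (\<Phi> x0 t)) \<longlongrightarrow> xd) at_top"
    proof (rule single_obstacle_convergence[where \<eta> = \<zeta> and X = "\<Phi> x0" and a = a, OF norm_xd g' pos(1) c _ _ \<zeta> q near target that(11,12)])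
      fix t assume t: "t \<ge> a"
      then have t0: "0 \<le> t" using a by simp
      have "(\<Phi> x0 has_vector_derivative H (\<Phi> x0 t)) (at t within {a..})"
        by (rule has_vector_derivative_within_subset[OF flow_atLeast[OF t0]]) (use a in auto)
      then show "(\<Phi> x0 has_vector_derivative norm (\<Phi> x0 t) *\<^sub>R (k1 *\<^sub>R
          (\<zeta> (\<Phi> x0 t /\<^sub>R norm (\<Phi> x0 t)) *\<^sub>R xd - (c * (1 - \<zeta> (\<Phi> x0 t /\<^sub>R norm (\<Phi> x0 t)))) *\<^sub>R g'))) (at t within {a..})"
        using F[OF t] unfolding H_def traj_def by simp
      show "\<Phi> x0 t \<noteq> 0" using norm_flow_pos[OF n0 t0] by auto
    qed
    then show ?thesis by (simp add: traj_def[abs_def])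
  qed
  show ?thesis
  proof (cases "I = {}")
    case True
    show ?thesis
    \<comment> \<open>A dummy obstacle covers the case without obstacles: with \<zeta> constantly 1
      the \<open>g'\<close> term vanishes, and \<open>c / q0 < q2\<close> reads
      \<open>1 < 2\<close>. Its span is the reason for \<open>insert xd\<close> in
      \<open>generic\<close>.\<close>
    proof (rule conv[where a = 0 and g' = xd and c = 1 and \<zeta> = "\<lambda>_. 1" and ?q0.0 = 1 and ?q1.0 = 1 and ?q2.0 = 2])
      show "F (traj x0 t) = k1 *\<^sub>R (1 *\<^sub>R xd - (1 * (1 - 1)) *\<^sub>R xd)" for t
        unfolding F_def True by simp
      show "\<Phi> x0 0 \<notin> span {xd, xd}" using generic[of xd 0] by simp
    qed (use norm_xd in auto)
  next
    case False
    interpret itinerary I "\<lambda>i. {t. 0 \<le> t \<and> traj x0 t \<in> R i}" level "\<lambda>t. sep (traj x0 t) xd"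
      by (rule traj_itinerary[OF x0])
    obtain i \<tau> where i: "i \<in> I" "\<tau> \<ge> 0"
        "\<And>j s. j \<in> I \<Longrightarrow> j \<noteq> i \<Longrightarrow> \<tau> \<le> s \<Longrightarrow> s \<notin> {t. 0 \<le> t \<and> traj x0 t \<in> R j}"
      using eventually_single[OF False] by blast
    \<comment> \<open>Rounding up to an integer time lets countably many genericity conditions
      suffice.\<close>
    define n where "n = nat \<lceil>\<tau>\<rceil>"
    have n: "\<tau> \<le> real n" unfolding n_def by (rule real_nat_ceiling_ge)
    have other: "\<eta> j (traj x0 t) = 1" if "j \<in> I" "j \<noteq> i" "real n \<le> t" for j t
    proof -
      have t: "0 \<le> t" "\<tau> \<le> t" using that n i(2) by auto
      have "traj x0 t \<notin> R j" using i(3)[OF that(1,2) t(2)] t(1) by simp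
      then have "traj x0 t \<notin> dilation \<epsilon> (U j)"
        using dilation_region[OF that(1)] traj_in_M[OF x0 t(1)] that(1) M_iff by blast
      then show ?thesis by (rule \<eta>_eq_1[OF that(1) norm_traj[OF n0 t(1)]])
    qed
    show ?thesis
    proof (rule conv[where a = "real n" and g' = "g i" and c = "1 / \<kappa>" and \<zeta> = "\<eta> i"
          and ?q0.0 = "\<eta>0 i" and ?q1.0 = "\<rho>1 i" and ?q2.0 = "\<rho> i"])
      show "F (traj x0 t) = k1 *\<^sub>R (\<eta> i (traj x0 t) *\<^sub>R xd - (1 / \<kappa> * (1 - \<eta> i (traj x0 t))) *\<^sub>R g i)"
        if "real n \<le> t" for t
        by (rule F_single[OF i(1) other]) (use that in auto)
      show "continuous_on (sphere 0 1) (\<eta> i)"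
        unfolding \<eta>_def[abs_def] using pos
        by (intro continuous_intros continuous_on_min continuous_on_set_sep U_ne U_sphere i(1)) auto
      show "\<Phi> x0 (real n) \<notin> span {xd, g i}" using generic i(1) by blast
      show "\<eta>0 i \<le> \<eta> i (z /\<^sub>R norm z)" if "l \<in> {0..1}" "norm (z - ((1 - l) *\<^sub>R xd - l *\<^sub>R g i)) < \<rho>1 i" for l z
        unfolding \<eta>_def using bounds(3)[OF i(1) that] .
      show "\<eta> i (z /\<^sub>R norm z) = 1" if "norm (z - xd) < \<rho> i" for z
        unfolding \<eta>_def using bounds(4)[OF i(1) that] .
    qed (use norm_g small bounds(1,2) \<eta>_bounds i pos in auto)
  qed
qed

section \<open>Stability of the target and the exceptional null set\<close>

lemma xd_equilibrium: "equilibrium u xd"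
proof -
  have "\<eta> i xd = 1" if "i \<in> I" for i using that xd_not_dilation norm_xd by (intro \<eta>_eq_1)
  then have "u xd = k1 *\<^sub>R xd" using control_eq_F[OF xd_free] F_free by simp
  then show ?thesis using norm_xd by (simp add: equilibrium_def tangent_proj_def dot_square_norm)
qed

text \<open>In a small ball around \<open>xd\<close> all cut-offs are 1 and the motion goes straight
  towards \<open>xd\<close>; at a first exit time the separation would have increased.\<close>

lemma xd_stable: "stable_over u M xd"
  unfolding stable_over_def
proof (intro allI impI)
  fix e :: real assume e: "e > 0"
  have "\<exists>\<rho>>0. \<forall>x. norm (x - xd) < \<rho> \<longrightarrow> \<eta> i x = 1" if i: "i \<in> I" for i
  proof -
    have "set_sep xd (U i) - \<epsilon> > 0" using xd_far[OF i] by simp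
    moreover have "\<eta> i x = 1" if "norm (x - xd) < set_sep xd (U i) - \<epsilon>" for x
      using set_sep_lipschitz[OF U_ne[OF i] U_sphere[OF i], of x xd] that pos by (simp add: \<eta>_def)
    ultimately show ?thesis by blast
  qed
  then obtain \<rho> where \<rho>: "\<And>i. i \<in> I \<Longrightarrow> \<rho> i > 0" "\<And>i x. i \<in> I \<Longrightarrow> norm (x - xd) < \<rho> i \<Longrightarrow> \<eta> i x = 1" by metis
  define r where "r = Min (insert e (\<rho> ` I))"
  have fin: "finite (insert e (\<rho> ` I))" by simp
  have r: "r \<le> e" "\<And>i. i \<in> I \<Longrightarrow> r \<le> \<rho> i" unfolding r_def by (rule Min_le[OF fin], blast)+
  have "r > 0" unfolding r_def using e \<rho>(1) by (subst Min_gr_iff[OF fin]) auto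
  note r = this r
  have "dist (x t) xd < r" if x: "closed_loop_solution u {0..} x" "x 0 \<in> M" "dist (x 0) xd < r" and t: "0 \<le> t" for x t
  proof -
    define x0 where "x0 = x 0"
    have x0: "x0 \<in> M" "norm x0 = 1" using x(2) M_iff by (auto simp: x0_def)
    have tr: "x s = traj x0 s" if "0 \<le> s" for s unfolding x0_def by (rule solution_eq_traj[OF x(1,2) that])
    define S where "S = {0..t} \<inter> (\<lambda>s. dist (traj x0 s) xd) -` {r..}"
    have "dist (traj x0 t) xd < r"
    proof (rule ccontr)
      assume "\<not> dist (traj x0 t) xd < r"
      then have tS: "t \<in> S" using t by (simp add: S_def)
      have "continuous_on {0..t} (\<lambda>s. dist (traj x0 s) xd)"
        by (intro continuous_intros continuous_on_subset[OF traj_continuous[OF x0(2)]]) auto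
      then have "closed S" unfolding S_def by (intro continuous_closed_preimage) auto
      then have "compact S" unfolding compact_eq_bounded_closed by (simp add: S_def bounded_Int)
      then obtain s where s: "s \<in> S" "\<And>q. q \<in> S \<Longrightarrow> s \<le> q" using compact_attains_inf[of S] tS by blast
      have s0: "0 \<le> s" "s \<le> t" "r \<le> dist (traj x0 s) xd" using s(1) by (auto simp: S_def)
      have d0: "dist (traj x0 0) xd < r" using x(3) traj_0[OF x0(2)] by (simp add: x0_def[symmetric])
      have "s \<noteq> 0" using s0(3) d0 by auto
      then have s1: "0 < s" using s0 by simp
      have "dist (traj x0 q) xd < r" if "0 < q" "q < s" for q
        using s(2)[of q] that s0 by (force simp: S_def)
      then have "norm (traj x0 q - xd) < \<rho> i" if "0 < q" "q < s" "i \<in> I" for q i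
        using r(3)[OF that(3)] that(1,2) by (metis dist_norm less_le_trans)
      then have "F (traj x0 q) = k1 *\<^sub>R xd" if "0 < q" "q < s" for q
        using that by (intro F_free \<rho>(2))
      then have "sep (traj x0 s) xd \<le> sep (traj x0 0) xd"
        using traj_towards[OF x0(2) order_refl s1] by blast
      then have "(dist (traj x0 s) xd)\<^sup>2 \<le> (dist (traj x0 0) xd)\<^sup>2"
        using norm_traj[OF x0(2)] s0 norm_xd by (simp add: sep_eq_norm dist_norm)
      then have "dist (traj x0 s) xd \<le> dist (traj x0 0) xd" by (rule power2_le_imp_le) simp
      then show False using s0(3) d0 by simp
    qed
    then show ?thesis using tr[OF t] by simp
  qed
  then show "\<exists>\<rho>>0. \<forall>x. closed_loop_solution u {0..} x \<and> x 0 \<in> M \<and> dist (x 0) xd < \<rho> \<longrightarrow>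
      (\<forall>t\<ge>0. dist (x t) xd < e)"
    using r(1,2) by (intro exI[of _ r]) (auto intro: less_le_trans)
qed

text \<open>The exceptional set is a union over integer times and finitely many spans of dimension
  at most 2, which is below \<open>DIM('a)\<close>.\<close>

lemma almost_globally_stable:
  assumes dim: "DIM('a) \<ge> 3"
    and small: "\<And>i. i \<in> I \<Longrightarrow> 1 / \<kappa> / \<eta>0 i < \<rho> i"
    and bounds: "\<And>i. i \<in> I \<Longrightarrow> \<eta>0 i > 0" "\<And>i. i \<in> I \<Longrightarrow> \<rho>1 i > 0"
      "\<And>i l z. i \<in> I \<Longrightarrow> l \<in> {0..1} \<Longrightarrow> norm (z - ((1 - l) *\<^sub>R xd - l *\<^sub>R g i)) < \<rho>1 i \<Longrightarrow>
        \<eta>0 i \<le> min 1 (set_sep (z /\<^sub>R norm z) (U i) / \<epsilon>)"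
      "\<And>i z. i \<in> I \<Longrightarrow> norm (z - xd) < \<rho> i \<Longrightarrow> min 1 (set_sep (z /\<^sub>R norm z) (U i) / \<epsilon>) = 1"
  shows "almost_globally_asymptotically_stable u M xd"
proof -
  define N where "N = (\<Union>n::nat. \<Union>v\<in>insert xd (g ` I). {x \<in> unit_sphere. \<Phi> x (real n) \<in> span {xd, v}})"
  have "{x \<in> unit_sphere. \<Phi> x (real n) \<in> span {xd, v}} \<in> null_sets sphere_measure" for n :: nat and v
  proof (rule null_set_flow_preimage)
    have "dim {xd, v} \<le> card {xd, v}" by (rule dim_le_card') simp
    also have "\<dots> \<le> 2" by (simp add: card_insert_if)
    finally show "dim (span {xd, v}) < DIM('a)" using dim by simp
  qed auto
  then have "N \<in> null_sets sphere_measure"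
    unfolding N_def by (intro null_sets_UN null_sets_UN') (auto intro: countable_finite)
  then have "AE x0 in sphere_measure. x0 \<notin> N" by (rule AE_not_in)
  then have "AE x0 in sphere_measure. x0 \<in> M \<longrightarrow> attracted u xd x0"
  proof (rule AE_mp, intro AE_I2 impI)
    fix x0 assume nN: "x0 \<notin> N" and x0: "x0 \<in> M"
    have "x0 \<in> unit_sphere" using x0 M_iff by auto
    then have "(traj x0 \<longlongrightarrow> xd) at_top"
      using nN by (intro traj_converges[OF x0 small bounds]) (auto simp: N_def)
    then show "attracted u xd x0"
      unfolding attracted_def
    proof (intro allI impI)
      fix x assume x: "closed_loop_solution u {0..} x \<and> x 0 = x0"
      have "\<forall>\<^sub>F t in at_top. traj x0 t = x t"
        using eventually_ge_at_top[of 0] by eventually_elim (use x x0 solution_eq_traj[of x] in auto)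
      with \<open>(traj x0 \<longlongrightarrow> xd) at_top\<close> show "(x \<longlongrightarrow> xd) at_top" by (rule Lim_transform_eventually)
    qed
  qed
  then show ?thesis
    unfolding almost_globally_asymptotically_stable_def using xd_free xd_equilibrium xd_stable by blast
qed

end


theorem theorem2:
  fixes U :: "nat \<Rightarrow> 'a::euclidean_space set" and g :: "nat \<Rightarrow> 'a" and xd :: 'a
    and m :: nat and k1 \<epsilon> \<epsilon>bar \<delta> :: real
  assumes dim: "DIM('a) \<ge> 3"
    and U_closed: "\<And>i. i \<in> {1..m} \<Longrightarrow> closedin (top_of_set unit_sphere) (U i)"
    and U_star: "\<And>i. i \<in> {1..m} \<Longrightarrow> star_shaped (U i)"
    and xd: "xd \<in> sphere_interior (free_set 0 (\<Union>i\<in>{1..m}. U i))"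
    and delta: "0 < \<delta>" "\<delta> \<le> pi / 2"
    and A1: "\<And>i j. \<lbrakk>i \<in> {1..m}; j \<in> {1..m}; i \<noteq> j\<rbrakk>
               \<Longrightarrow> \<forall>a\<in>U i. \<forall>b\<in>U j. a \<bullet> b \<le> cos (2 * \<delta>)"
    and eps_bar: "\<epsilon>bar > 0" "xd \<notin> collar \<epsilon>bar (\<Union>i\<in>{1..m}. U i)"
    and eps: "0 < \<epsilon>" "\<epsilon> < min \<epsilon>bar (1 - cos \<delta>)"
    and g: "\<And>i. i \<in> {1..m} \<Longrightarrow> g i \<in> star_centers (U i) \<inter> sphere_interior (U i)"
    and g_xd: "\<And>i. i \<in> {1..m} \<Longrightarrow> g i \<noteq> - xd"
    and k1: "k1 > 0"
    and A2: "\<And>i j. \<lbrakk>i \<in> {1..m}; j \<in> {1..m}; i \<noteq> j\<rbrakk>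
               \<Longrightarrow> region xd \<epsilon> (U i) \<inter> region xd \<epsilon> (U j) = {}"
  shows "(\<forall>\<kappa>>0. forward_invariant (control m U xd g k1 \<kappa> \<epsilon>) (free_set 0 (\<Union>i\<in>{1..m}. U i))) \<and>
         (\<exists>\<kappa>bar>0. \<forall>\<kappa>>\<kappa>bar. almost_globally_asymptotically_stable
            (control m U xd g k1 \<kappa> \<epsilon>) (free_set 0 (\<Union>i\<in>{1..m}. U i)) xd)"
proof -
  have cU: "compact (U i)" "U i \<subseteq> unit_sphere" if "i \<in> {1..m}" for i
    using closedin_compact[OF compact_sphere U_closed[OF that]] closedin_imp_subset[OF U_closed[OF that]] by auto
  have gi: "g i \<in> star_centers (U i)" "g i \<in> U i" if "i \<in> {1..m}" for i
    using g[OF that] by (auto simp: star_centers_def)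
  have xd_M: "xd \<in> free_set 0 (\<Union>i\<in>{1..m}. U i)" using xd sphere_interior_subset by blast
  then have nxd: "norm xd = 1" by (auto simp: free_set_def)
  \<comment> \<open>As \<open>xd\<close> is not in the interior of the union, absence from the
    collar means absence from the dilation, so its separation exceeds
    \<open>\<epsilon>bar\<close>.\<close>
  have far: "\<epsilon> < set_sep xd (U i)" if i: "i \<in> {1..m}" for i
  proof -
    have "\<not> set_sep xd (\<Union>i\<in>{1..m}. U i) \<le> \<epsilon>bar"
      using eps_bar(2) xd_M nxd by (auto simp: collar_def dilation_def free_set_def)
    moreover have "U i \<noteq> {} \<and> U i \<subseteq> unit_sphere" if "i \<in> {1..m}" for i using cU gi that by blast
    ultimately have "\<not> set_sep xd (U i) \<le> \<epsilon>bar"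
      using set_sep_Union_le_iff[of "{1..m}" U xd \<epsilon>bar] i by auto
    then show ?thesis using eps by simp
  qed
  have nav: "star_navigation U g xd m k1 \<epsilon> \<kappa>" if "\<kappa> > 0" for \<kappa>
  proof
    show "dilation \<epsilon> (U i) \<inter> dilation \<epsilon> (U j) = {}" if "i \<in> {1..m}" "j \<in> {1..m}" "i \<noteq> j" for i j
      using dilations_disjoint[of "U i" "U j" \<delta> \<epsilon>] cU[OF that(1)] cU[OF that(2)] gi(2)[OF that(1)] gi(2)[OF that(2)]
        delta A1[OF that] eps(2) by auto
  qed (use cU gi A2 xd_M far k1 eps(1) that in auto)
  \<comment> \<open>Packs the three constants of an obstacle into one triple, so that a single
    choice over the indices yields them as functions.\<close>
  define good where "good i q \<longleftrightarrow> (case q of (\<eta>0, \<rho>1, \<rho>) \<Rightarrow> \<eta>0 > 0 \<and> \<rho>1 > 0 \<and> \<rho> > 0 \<and>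
      (\<forall>l\<in>{0..1}. \<forall>z. norm (z - ((1 - l) *\<^sub>R xd - l *\<^sub>R g i)) < \<rho>1 \<longrightarrow> \<eta>0 \<le> min 1 (set_sep (z /\<^sub>R norm z) (U i) / \<epsilon>)) \<and>
      (\<forall>z. norm (z - xd) < \<rho> \<longrightarrow> min 1 (set_sep (z /\<^sub>R norm z) (U i) / \<epsilon>) = 1))" for i q
  have "\<exists>q. good i q" if "i \<in> {1..m}" for i
    using obstacle_bounds[OF cU[OF that] gi(1)[OF that] nxd far[OF that] eps(1)]
    unfolding good_def split_paired_Ex case_prod_conv by blast
  then obtain q where q: "\<And>i. i \<in> {1..m} \<Longrightarrow> good i (q i)" by metis
  define \<eta>0 where "\<eta>0 i = fst (q i)" for i
  define \<rho>1 where "\<rho>1 i = fst (snd (q i))" for i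
  define \<rho> where "\<rho> i = snd (snd (q i))" for i
  have b: "\<eta>0 i > 0" "\<rho>1 i > 0" "\<rho> i > 0"
      "\<And>l z. l \<in> {0..1} \<Longrightarrow> norm (z - ((1 - l) *\<^sub>R xd - l *\<^sub>R g i)) < \<rho>1 i \<Longrightarrow>
        \<eta>0 i \<le> min 1 (set_sep (z /\<^sub>R norm z) (U i) / \<epsilon>)"
      "\<And>z. norm (z - xd) < \<rho> i \<Longrightarrow> min 1 (set_sep (z /\<^sub>R norm z) (U i) / \<epsilon>) = 1"
    if "i \<in> {1..m}" for i
    using q[OF that] unfolding good_def \<eta>0_def \<rho>1_def \<rho>_def case_prod_beta by blast+
  \<comment> \<open>Obstacle \<open>i\<close> requires
    \<open>\<kappa> > 1 / (\<eta>0 i * \<rho> i)\<close>; the sum dominates each of these, and the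
    summand 1 keeps the threshold positive when \<open>m = 0\<close>.\<close>
  define \<kappa>bar where "\<kappa>bar = 1 + (\<Sum>i\<in>{1..m}. 1 / (\<eta>0 i * \<rho> i))"
  have nn: "1 / (\<eta>0 i * \<rho> i) \<ge> 0" if "i \<in> {1..m}" for i using b(1,3)[OF that] by simp
  have kbar: "\<kappa>bar > 0" unfolding \<kappa>bar_def using nn by (intro add_pos_nonneg sum_nonneg) auto
  have small: "1 / \<kappa> / \<eta>0 i < \<rho> i" if "\<kappa> > \<kappa>bar" "i \<in> {1..m}" for \<kappa> i
  proof -
    have "1 / (\<eta>0 i * \<rho> i) \<le> (\<Sum>i\<in>{1..m}. 1 / (\<eta>0 i * \<rho> i))"
      by (rule member_le_sum[OF that(2)]) (use nn in auto)
    then have "1 / (\<eta>0 i * \<rho> i) < \<kappa>" using that(1) by (simp add: \<kappa>bar_def)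
    then show ?thesis using b(1,3)[OF that(2)] kbar that(1) by (simp add: field_simps)
  qed
  have "almost_globally_asymptotically_stable (control m U xd g k1 \<kappa> \<epsilon>) (free_set 0 (\<Union>i\<in>{1..m}. U i)) xd"
    if "\<kappa> > \<kappa>bar" for \<kappa>
  proof -
    interpret star_navigation U g xd m k1 \<epsilon> \<kappa> using nav that kbar by simp
    show ?thesis by (rule almost_globally_stable[OF dim small[OF that] b(1,2,4,5)])
  qed
  moreover have "forward_invariant (control m U xd g k1 \<kappa> \<epsilon>) (free_set 0 (\<Union>i\<in>{1..m}. U i))" if "\<kappa> > 0" for \<kappa>
  proof -
    interpret star_navigation U g xd m k1 \<epsilon> \<kappa> using nav that by simp
    show ?thesis by (rule forward_invariant)
  qed
  ultimately show ?thesis using kbar by blast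
qed

end
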